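(* Let $d\ge1$, $p\in[1,+\infty]$ and $s\ge d/p$ (with $d/p=0$ if $p=+\infty$). Let $C^s_p$ be the closure of $\mathcal{S}'_h\cap\dot{B}^s_{p,\infty}$ in $\dot{B}^s_{p,\infty}$. Then the quotient space $\dot{B}^s_{p,\infty}/C^s_p$ is not separable. In fact, there exists an embedding $J:\ell^\infty\to\dot{B}^s_{p,\infty}$ which satisfies $J(c_0)\subset C^s_p$ and whose induced map between the (non-separable) quotient spaces $J':\ell^\infty/c_0\to\dot{B}^s_{p,\infty}/C^s_p$ is a quasi-isometry.
   Context: All function spaces are spaces of complex-valued functions or distributions on $\mathbb{R}^d$; $\mathcal{S}$ is the Schwartz space and $\mathcal{S}'$ the space of tempered distributions. Fix a smooth radial function $\chi:\mathbb{R}^d\to\mathbb{R}$ supported in the ball $B(0,2)$, equal to $1$ in a neighborhood of $B(0,1)$, and such that $r\mapsto\chi(re)$ is nonincreasing on $\mathbb{R}_+$ for every unit vector $e$. Set $\varphi(\xi)=\chi(\xi)-\chi(2\xi)$. For a function $\sigma$, $\sigma(D)$ denotes the Fourier multiplier $f\mapsto\mathcal{F}^{-1}[\sigma(\xi)\widehat f(\xi)]$. The homogeneous dyadic blocks are $\dot\Delta_m=\varphi(2^{-m}D)$, $m\in\mathbb{Z}$. $\mathcal{S}'_h$ is the space of $f\in\mathcal{S}'$ such that $\chi(\lambda\xi)\widehat f(\xi)\to 0$ in $\mathcal{S}'$ as $\lambda\to+\infty$. Let $\mathcal{S}'/\mathcal{P}$ be the quotient of $\mathcal{S}'$ by the space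 $\mathcal{P}$ of polynomial functions on $\mathbb{R}^d$; the operators $\dot\Delta_m$ annihilate polynomials and hence are well defined on $\mathcal{S}'/\mathcal{P}$. The homogeneous Besov space $\dot{B}^s_{p,\infty}$ is the Banach space of those $f\in\mathcal{S}'/\mathcal{P}$ such that $\|f\|_{\dot{B}^s_{p,\infty}}=\sup_{m\in\mathbb{Z}}2^{ms}\|\dot\Delta_m f\|_{L^p}<+\infty$. Since $\mathcal{S}'_h$ contains no nonzero polynomial, the natural map $\mathcal{S}'_h\to\mathcal{S}'/\mathcal{P}$ is injective, and $\mathcal{S}'_h\cap\dot{B}^s_{p,\infty}$ denotes the subspace of those classes in $\dot{B}^s_{p,\infty}$ that have a representative in $\mathcal{S}'_h$. $\ell^\infty=\ell^\infty(\mathbb{N})$ is the space of bounded sequences and $c_0\subset\ell^\infty$ the subspace of sequences converging to $0$. For a closed subspace $C$ of a Banach space $X$, $X/C$ carries the norm $\|x\|_{X/C}=\inf_{h\in C}\|x-h\|_X$. An embedding is an injective bounded linear map. A quasi-isometry (not required to be surjective) is a linear map $T$ between normed spaces for which there is a constant $K\ge1$ with $K^{-1}\|x\|\le\|Tx\|\le K\|x\|$ for all $x$. The induced map $J'$ sends the class of $u$ modulo $c_0$ to the class of $Ju$ modulo $C^s_p$. *)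

theory Defs
  imports "HOL-Analysis.Analysis" "HOL-Probability.Essential_Supremum"
begin

section \<open>Complex vector spaces and normed spaces, their quotients and linear maps\<close>

record 'v cspace =
  vcarrier :: "'v set"
  vadd :: "'v \<Rightarrow> 'v \<Rightarrow> 'v"
  vscale :: "complex \<Rightarrow> 'v \<Rightarrow> 'v"

record 'v cnspace = "'v cspace" +
  vnorm :: "'v \<Rightarrow> real"

definition vsub :: "('v, 'z) cspace_scheme \<Rightarrow> 'v \<Rightarrow> 'v \<Rightarrow> 'v" where
  "vsub V x y = vadd V x (vscale V (-1) y)"

definition coset :: "('v, 'z) cspace_scheme \<Rightarrow> 'v set \<Rightarrow> 'v \<Rightarrow> 'v set" where
  "coset V C x = (\<lambda>h. vsub V x h) ` C"

text \<open>Scalar multiplication passes through the coset of \<open>c x\<close> because the plain image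
  \<open>{c x | x \<in> A}\<close> is not a coset when \<open>c = 0\<close>.\<close>

definition quotient_space :: "('v, 'z) cspace_scheme \<Rightarrow> 'v set \<Rightarrow> 'v set cspace" where
  "quotient_space V C =
    \<lparr> vcarrier = coset V C ` vcarrier V,
      vadd = (\<lambda>A B. {vadd V a b | a b. a \<in> A \<and> b \<in> B}),
      vscale = (\<lambda>c A. \<Union>a\<in>A. coset V C (vscale V c a)) \<rparr>"

text \<open>The coset of \<open>x\<close> is \<open>{x - h | h \<in> C}\<close>, so the norm below is the infimum of
  \<open>\<parallel>x - h\<parallel>\<close> over \<open>h \<in> C\<close>.\<close>

definition quotient_nspace :: "'v cnspace \<Rightarrow> 'v set \<Rightarrow> 'v set cnspace" where
  "quotient_nspace V C =
    \<lparr> vcarrier = vcarrier (quotient_space V C),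
      vadd = vadd (quotient_space V C),
      vscale = vscale (quotient_space V C),
      vnorm = (\<lambda>A. INF a\<in>A. vnorm V a) \<rparr>"

text \<open>The guard is there because the locale \<open>Metric_space\<close> requires symmetry and
  nonnegativity of the distance on the whole type.\<close>

definition vdist :: "'v cnspace \<Rightarrow> 'v \<Rightarrow> 'v \<Rightarrow> real" where
  "vdist V x y = (if x \<in> vcarrier V \<and> y \<in> vcarrier V then vnorm V (vsub V x y) else 0)"

definition norm_topology :: "'v cnspace \<Rightarrow> 'v topology" where
  "norm_topology V = Metric_space.mtopology (vcarrier V) (vdist V)"

definition linear_map ::
    "('v, 'z) cspace_scheme \<Rightarrow> ('w, 'y) cspace_scheme \<Rightarrow> ('v \<Rightarrow> 'w) \<Rightarrow> bool" where
  "linear_map V W T \<longleftrightarrow>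
    T \<in> vcarrier V \<rightarrow> vcarrier W \<and>
    (\<forall>x\<in>vcarrier V. \<forall>y\<in>vcarrier V. T (vadd V x y) = vadd W (T x) (T y)) \<and>
    (\<forall>c. \<forall>x\<in>vcarrier V. T (vscale V c x) = vscale W c (T x))"

definition embedding :: "'v cnspace \<Rightarrow> 'w cnspace \<Rightarrow> ('v \<Rightarrow> 'w) \<Rightarrow> bool" where
  "embedding V W T \<longleftrightarrow>
    linear_map V W T \<and>
    (\<exists>K. \<forall>x\<in>vcarrier V. vnorm W (T x) \<le> K * vnorm V x) \<and>
    inj_on T (vcarrier V)"

definition quasi_isometry :: "'v cnspace \<Rightarrow> 'w cnspace \<Rightarrow> ('v \<Rightarrow> 'w) \<Rightarrow> bool" where
  "quasi_isometry V W T \<longleftrightarrow>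
    linear_map V W T \<and>
    (\<exists>K\<ge>1. \<forall>x\<in>vcarrier V.
       inverse K * vnorm V x \<le> vnorm W (T x) \<and> vnorm W (T x) \<le> K * vnorm V x)"

definition linf :: "(nat \<Rightarrow> complex) cnspace" where
  "linf =
    \<lparr> vcarrier = {x. bounded (range x)},
      vadd = (\<lambda>x y n. x n + y n),
      vscale = (\<lambda>c x n. c * x n),
      vnorm = (\<lambda>x. SUP n. norm (x n)) \<rparr>"

definition c_zero :: "(nat \<Rightarrow> complex) set" where
  "c_zero = {x. x \<longlonglongrightarrow> 0}"


section \<open>Schwartz functions and tempered distributions\<close>

text \<open>Iterated partial derivatives are indexed by lists of basis vectors instead of
  multi-indices; for smooth functions the order of the list is irrelevant.\<close>

primrec iter_partial ::
    "'a list \<Rightarrow> ('a::euclidean_space \<Rightarrow> 'b::real_normed_vector) \<Rightarrow> 'a \<Rightarrow> 'b" where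
  "iter_partial [] f = f"
| "iter_partial (b # bs) f = (\<lambda>x. frechet_derivative (iter_partial bs f) (at x) b)"

definition smooth :: "('a::euclidean_space \<Rightarrow> 'b::real_normed_vector) \<Rightarrow> bool" where
  "smooth f \<longleftrightarrow> (\<forall>bs\<in>lists Basis. \<forall>x. iter_partial bs f differentiable (at x))"

definition schwartz :: "('a::euclidean_space \<Rightarrow> complex) set" where
  "schwartz =
    {f. smooth f \<and>
        (\<forall>N. \<forall>bs\<in>lists Basis. bounded (range (\<lambda>x. (1 + norm x) ^ N *\<^sub>R iter_partial bs f x)))}"

definition schwartz_norm :: "nat \<Rightarrow> ('a::euclidean_space \<Rightarrow> complex) \<Rightarrow> real" where
  "schwartz_norm N f =
    (SUP (bs, x) \<in> {bs \<in> lists Basis. length bs \<le> N} \<times> UNIV.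
       (1 + norm x) ^ N * norm (iter_partial bs f x))"

type_synonym 'a functional = "('a \<Rightarrow> complex) \<Rightarrow> complex"

text \<open>Functionals on the Schwartz space are extended by \<open>0\<close> to all functions, so that
  equality of distributions is equality in HOL.\<close>

definition on_schwartz :: "'a::euclidean_space functional \<Rightarrow> 'a functional" where
  "on_schwartz u = (\<lambda>f. if f \<in> schwartz then u f else 0)"

definition tempered :: "'a::euclidean_space functional cspace" where
  "tempered =
    \<lparr> vcarrier =
        {u. on_schwartz u = u \<and>
            (\<forall>f\<in>schwartz. \<forall>g\<in>schwartz. u (\<lambda>x. f x + g x) = u f + u g) \<and>
            (\<forall>c. \<forall>f\<in>schwartz. u (\<lambda>x. c * f x) = c * u f) \<and>
            (\<exists>K N. \<forall>f\<in>schwartz. norm (u f) \<le> K * schwartz_norm N f)},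
      vadd = (\<lambda>u v f. u f + v f),
      vscale = (\<lambda>c u f. c * u f) \<rparr>"

definition distr_of :: "('a::euclidean_space \<Rightarrow> complex) \<Rightarrow> 'a functional" where
  "distr_of g = on_schwartz (\<lambda>f. LINT x|lborel. g x * f x)"

definition fourier :: "('a::euclidean_space \<Rightarrow> complex) \<Rightarrow> 'a \<Rightarrow> complex" where
  "fourier f \<xi> = (LINT x|lborel. cis (- (x \<bullet> \<xi>)) * f x)"

definition inv_fourier :: "('a::euclidean_space \<Rightarrow> complex) \<Rightarrow> 'a \<Rightarrow> complex" where
  "inv_fourier f x = (LINT \<xi>|lborel. cis (x \<bullet> \<xi>) * f \<xi>) / of_real ((2 * pi) ^ DIM('a))"

definition fourier_distr :: "'a::euclidean_space functional \<Rightarrow> 'a functional" where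
  "fourier_distr u = on_schwartz (\<lambda>f. u (fourier f))"

definition inv_fourier_distr :: "'a::euclidean_space functional \<Rightarrow> 'a functional" where
  "inv_fourier_distr u = on_schwartz (\<lambda>f. u (inv_fourier f))"

definition mult_distr ::
    "('a::euclidean_space \<Rightarrow> complex) \<Rightarrow> 'a functional \<Rightarrow> 'a functional" where
  "mult_distr \<sigma> u = on_schwartz (\<lambda>f. u (\<lambda>x. \<sigma> x * f x))"

definition fourier_multiplier ::
    "('a::euclidean_space \<Rightarrow> complex) \<Rightarrow> 'a functional \<Rightarrow> 'a functional" where
  "fourier_multiplier \<sigma> u = inv_fourier_distr (mult_distr \<sigma> (fourier_distr u))"

definition polynomial_distrs :: "'a::euclidean_space functional set" where
  "polynomial_distrs = {distr_of P | P. polynomial_function P}"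

definition tempered_mod_poly :: "'a::euclidean_space functional set cspace" where
  "tempered_mod_poly = quotient_space tempered polynomial_distrs"


section \<open>Lebesgue norms\<close>

definition Lp_norm :: "ereal \<Rightarrow> ('a::euclidean_space \<Rightarrow> complex) \<Rightarrow> ennreal" where
  "Lp_norm p g =
    (if p = \<infinity> then esssup lborel (\<lambda>x. ennreal (norm (g x)))
     else let I = \<integral>\<^sup>+ x. ennreal (norm (g x) powr real_of_ereal p) \<partial>lborel
          in if I = \<infinity> then \<infinity> else ennreal (enn2real I powr (1 / real_of_ereal p)))"

text \<open>A representing function is unique up to null sets, so the infimum is over at most
  one value; it is \<open>\<infinity>\<close> if the distribution is not a function in \<open>L\<^sup>p\<close>.\<close>

definition distr_Lp_norm :: "ereal \<Rightarrow> 'a::euclidean_space functional \<Rightarrow> ennreal" where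
  "distr_Lp_norm p u = (INF g\<in>{g \<in> borel_measurable lborel. distr_of g = u}. Lp_norm p g)"


section \<open>Littlewood--Paley blocks and homogeneous Besov spaces\<close>

definition lp_cutoff :: "('a::euclidean_space \<Rightarrow> real) \<Rightarrow> bool" where
  "lp_cutoff chi \<longleftrightarrow>
    smooth chi \<and>
    (\<forall>x y. norm x = norm y \<longrightarrow> chi x = chi y) \<and>
    closure {x. chi x \<noteq> 0} \<subseteq> cball 0 2 \<and>
    (\<exists>U. open U \<and> cball 0 1 \<subseteq> U \<and> (\<forall>x\<in>U. chi x = 1)) \<and>
    (\<forall>e. norm e = 1 \<longrightarrow> antimono_on {0..} (\<lambda>r. chi (r *\<^sub>R e)))"

definition lp_phi :: "('a::euclidean_space \<Rightarrow> real) \<Rightarrow> 'a \<Rightarrow> real" where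
  "lp_phi chi \<xi> = chi \<xi> - chi (2 *\<^sub>R \<xi>)"

definition dyadic_block ::
    "('a::euclidean_space \<Rightarrow> real) \<Rightarrow> int \<Rightarrow> 'a functional \<Rightarrow> 'a functional" where
  "dyadic_block chi m =
    fourier_multiplier (\<lambda>\<xi>. complex_of_real (lp_phi chi ((2 powi (- m)) *\<^sub>R \<xi>)))"

text \<open>On a class modulo polynomials the block takes a single value, which
  \<open>the_elem\<close> selects.\<close>

definition dyadic_block_class ::
    "('a::euclidean_space \<Rightarrow> real) \<Rightarrow> int \<Rightarrow> 'a functional set \<Rightarrow> 'a functional" where
  "dyadic_block_class chi m A = the_elem (dyadic_block chi m ` A)"

definition besov_enorm ::
    "('a::euclidean_space \<Rightarrow> real) \<Rightarrow> real \<Rightarrow> ereal \<Rightarrow> 'a functional set \<Rightarrow> ennreal" where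
  "besov_enorm chi s p A =
    (SUP m. ennreal (2 powr (real_of_int m * s)) * distr_Lp_norm p (dyadic_block_class chi m A))"

definition besov ::
    "('a::euclidean_space \<Rightarrow> real) \<Rightarrow> real \<Rightarrow> ereal \<Rightarrow> 'a functional set cnspace" where
  "besov chi s p =
    \<lparr> vcarrier = {A \<in> vcarrier tempered_mod_poly. besov_enorm chi s p A < \<infinity>},
      vadd = vadd tempered_mod_poly,
      vscale = vscale tempered_mod_poly,
      vnorm = (\<lambda>A. enn2real (besov_enorm chi s p A)) \<rparr>"

text \<open>Convergence in the space of tempered distributions is convergence against every
  Schwartz function.\<close>

definition tempered_h :: "('a::euclidean_space \<Rightarrow> real) \<Rightarrow> 'a functional set" where
  "tempered_h chi =
    {u \<in> vcarrier tempered. \<forall>f\<in>schwartz.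
       ((\<lambda>t::real. mult_distr (\<lambda>\<xi>. complex_of_real (chi (t *\<^sub>R \<xi>))) (fourier_distr u) f)
          \<longlongrightarrow> 0) at_top}"

definition besov_h ::
    "('a::euclidean_space \<Rightarrow> real) \<Rightarrow> real \<Rightarrow> ereal \<Rightarrow> 'a functional set set" where
  "besov_h chi s p = {A \<in> vcarrier (besov chi s p). \<exists>u\<in>A. u \<in> tempered_h chi}"

definition besov_h_closure ::
    "('a::euclidean_space \<Rightarrow> real) \<Rightarrow> real \<Rightarrow> ereal \<Rightarrow> 'a functional set set" where
  "besov_h_closure chi s p = norm_topology (besov chi s p) closure_of besov_h chi s p"

end

theory Submission
  imports Defs "HOL-Probability.Distributions" "HOL-Probability.Characteristic_Functions"
begin

text \<open>
  Let \<open>g\<close> be the inverse Fourier transform of a bump \<open>G\<close> supported in a thin annulus on which the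
  cut-off \<open>\<phi>\<close> equals \<open>1\<close>, so that exactly one dyadic block sees each dilate of \<open>g\<close>. The embedding
  sends \<open>u\<close> to the class of \<open>\<Sum>k. u\<^sub>k 2\<^bsup>k(s - d/p)\<^esup> g(2\<^bsup>- k\<^esup> x)\<close>; the series converges after subtracting
  from each term its Taylor polynomial at \<open>0\<close>, which is invisible modulo polynomials. The block of
  index \<open>- k\<close> of the sum is its \<open>k\<close>-th term, whence boundedness, and finitely supported sequences
  are sent to \<open>\<S>'\<^sub>h\<close>, whence \<open>c\<^sub>0\<close> is sent to its closure.

  For the lower bound test with \<open>\<F>(\<phi>(2\<^bsup>k\<^esup> \<xi>))\<close>. The pairing with the image of \<open>u\<close> is a
  constant times \<open>u\<^sub>k 2\<^bsup>k(s - d/p)\<^esup>\<close>; by a Bernstein-type inequality the pairing with any \<open>w\<close> is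
  \<open>O(2\<^bsup>k(s - d/p)\<^esup> \<parallel>w\<parallel>)\<close>; and for \<open>h\<close> in \<open>\<S>'\<^sub>h\<close> the pairing tends to \<open>0\<close>. As
  \<open>s \<ge> d/p\<close>, this gives \<open>limsup \<bar>u\<^sub>k\<bar> \<le> C \<parallel>J u - h\<parallel>\<close>.

  That the Besov seminorm is a norm modulo polynomials amounts to the fact that a tempered
  distribution with Fourier transform supported at the origin is a polynomial.
\<close>

section \<open>Quotients of normed spaces\<close>

text \<open>The factor 2^(k(s - d/p)) is forced: dilating \<open>g\<close> by 2^k multiplies its L^p
  norm by 2^(kd/p), while the block of index -k enters the Besov norm with the factor 2^(-ks), so
  that the k-th term has a norm comparable to |u_k|, uniformly in k. The obstacle is that membership
  in S'_h is a purely weak condition: it gives a limit for each fixed test function, without any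
  rate and without control of an L^p norm. The distance of J u to S'_h can therefore only be seen
  through scalar pairings at ever lower frequencies, and each h yields information only for large k.
  This is what makes l^infty modulo c_0 the natural model: its norm is exactly limsup |u_k|. If s
  were below d/p, dividing by the factor would amplify the contribution of h instead of damping it.
  Non-separability is then a property of l^infty modulo c_0 alone, where the subsets of N yield an
  uncountable separated family, and a lower bound on distances carries it over.\<close>

locale cvector_space =
  fixes V :: "('v, 'z) cspace_scheme"
  assumes carrier_nonempty: "vcarrier V \<noteq> {}"
    and add_closed [simp]: "\<lbrakk>x \<in> vcarrier V; y \<in> vcarrier V\<rbrakk> \<Longrightarrow> vadd V x y \<in> vcarrier V"
    and scale_closed [simp]: "x \<in> vcarrier V \<Longrightarrow> vscale V c x \<in> vcarrier V"
    and add_assoc: "\<lbrakk>x \<in> vcarrier V; y \<in> vcarrier V; z \<in> vcarrier V\<rbrakk>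
      \<Longrightarrow> vadd V (vadd V x y) z = vadd V x (vadd V y z)"
    and add_commute: "\<lbrakk>x \<in> vcarrier V; y \<in> vcarrier V\<rbrakk> \<Longrightarrow> vadd V x y = vadd V y x"
    and scale_add: "\<lbrakk>x \<in> vcarrier V; y \<in> vcarrier V\<rbrakk>
      \<Longrightarrow> vscale V c (vadd V x y) = vadd V (vscale V c x) (vscale V c y)"
    and add_scale: "x \<in> vcarrier V \<Longrightarrow> vscale V (a + b) x = vadd V (vscale V a x) (vscale V b x)"
    and scale_scale: "x \<in> vcarrier V \<Longrightarrow> vscale V a (vscale V b x) = vscale V (a * b) x"
    and scale_one [simp]: "x \<in> vcarrier V \<Longrightarrow> vscale V 1 x = x"
    and scale_zero_eq: "\<lbrakk>x \<in> vcarrier V; y \<in> vcarrier V\<rbrakk> \<Longrightarrow> vscale V 0 x = vscale V 0 y"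
begin

lemma add_left_commute:
  assumes "x \<in> vcarrier V" "y \<in> vcarrier V" "z \<in> vcarrier V"
  shows "vadd V x (vadd V y z) = vadd V y (vadd V x z)"
  using assms add_assoc[of x y z] add_assoc[of y x z] add_commute[of x y] by simp

lemmas add_ac = add_assoc add_commute add_left_commute

text \<open>The record has no field for the zero vector; it is recovered as the common value of all
  products with the scalar 0, which \<open>scale_zero_eq\<close> guarantees. Neutral element and
  inverses then follow from \<open>add_scale\<close>.\<close>

definition zero where "zero = (THE z. \<forall>x\<in>vcarrier V. vscale V 0 x = z)"

lemma scale_zero [simp]:
  assumes "x \<in> vcarrier V" shows "vscale V 0 x = zero"
proof -
  have "zero = vscale V 0 x"
    unfolding zero_def
  proof (rule the_equality)
    show "\<forall>y\<in>vcarrier V. vscale V 0 y = vscale V 0 x" using assms scale_zero_eq by blast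
    show "z = vscale V 0 x" if "\<forall>y\<in>vcarrier V. vscale V 0 y = z" for z using assms that by simp
  qed
  then show ?thesis ..
qed

lemma zero_closed [simp]: "zero \<in> vcarrier V"
proof -
  obtain x where "x \<in> vcarrier V" using carrier_nonempty by blast
  then show ?thesis using scale_closed[of x 0] by simp
qed

lemma add_zero_left [simp]: "x \<in> vcarrier V \<Longrightarrow> vadd V zero x = x"
  using add_scale[of x 0 1] by simp

lemma add_zero_right [simp]: "x \<in> vcarrier V \<Longrightarrow> vadd V x zero = x"
  by (simp add: add_commute[of _ zero])

lemma scale_to_zero [simp]: "vscale V c zero = zero"
  by (metis scale_scale scale_zero mult_zero_right zero_closed)

lemma sub_closed [simp]: "\<lbrakk>x \<in> vcarrier V; y \<in> vcarrier V\<rbrakk> \<Longrightarrow> vsub V x y \<in> vcarrier V"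
  by (simp add: vsub_def)

lemma add_minus [simp]: "x \<in> vcarrier V \<Longrightarrow> vadd V x (vscale V (-1) x) = zero"
  using add_scale[of x 1 "-1"] by simp

lemma sub_self [simp]: "x \<in> vcarrier V \<Longrightarrow> vsub V x x = zero"
  by (simp add: vsub_def)

lemma sub_zero [simp]: "x \<in> vcarrier V \<Longrightarrow> vsub V x zero = x"
  by (simp add: vsub_def)

lemma sub_add_cancel [simp]:
  "\<lbrakk>x \<in> vcarrier V; y \<in> vcarrier V\<rbrakk> \<Longrightarrow> vadd V (vsub V x y) y = x"
  unfolding vsub_def by (simp add: add_assoc add_commute[of "vscale V (-1) y"])

lemma sub_eq_iff:
  "\<lbrakk>x \<in> vcarrier V; y \<in> vcarrier V; z \<in> vcarrier V\<rbrakk> \<Longrightarrow> vsub V x y = z \<longleftrightarrow> x = vadd V z y"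
  by (metis add_assoc add_minus add_zero_right sub_add_cancel scale_closed vsub_def)

lemma sub_eq_zero_iff:
  "\<lbrakk>x \<in> vcarrier V; y \<in> vcarrier V\<rbrakk> \<Longrightarrow> vsub V x y = zero \<longleftrightarrow> x = y"
  by (simp add: sub_eq_iff)

lemma sub_sub_cancel [simp]:
  "\<lbrakk>x \<in> vcarrier V; y \<in> vcarrier V\<rbrakk> \<Longrightarrow> vsub V x (vsub V x y) = y"
  by (metis add_commute sub_add_cancel sub_closed sub_eq_iff)

lemma sub_add_sub:
  "\<lbrakk>x \<in> vcarrier V; y \<in> vcarrier V; h \<in> vcarrier V; k \<in> vcarrier V\<rbrakk>
    \<Longrightarrow> vsub V (vadd V x y) (vadd V h k) = vadd V (vsub V x h) (vsub V y k)"
  unfolding vsub_def by (simp add: scale_add add_ac)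

lemma scale_sub:
  "\<lbrakk>x \<in> vcarrier V; y \<in> vcarrier V\<rbrakk>
    \<Longrightarrow> vscale V c (vsub V x y) = vsub V (vscale V c x) (vscale V c y)"
  unfolding vsub_def by (simp add: scale_add scale_scale mult.commute)

lemma sub_triangle:
  "\<lbrakk>x \<in> vcarrier V; y \<in> vcarrier V; z \<in> vcarrier V\<rbrakk>
    \<Longrightarrow> vadd V (vsub V x y) (vsub V y z) = vsub V x z"
  unfolding vsub_def[of V y z] vsub_def[of V x z] by (simp add: add_assoc[symmetric])

lemma minus_sub:
  "\<lbrakk>x \<in> vcarrier V; y \<in> vcarrier V\<rbrakk> \<Longrightarrow> vscale V (-1) (vsub V x y) = vsub V y x"
  unfolding vsub_def by (simp add: scale_add scale_scale add_commute)

end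

lemma cvector_space_cong:
  assumes "cvector_space V" "vcarrier W = vcarrier V" "vadd W = vadd V" "vscale W = vscale V"
  shows "cvector_space W"
  using assms(1) unfolding cvector_space_def assms(2-4) .

section \<open>Subspaces and their cosets\<close>

definition csubspace :: "('v, 'z) cspace_scheme \<Rightarrow> 'v set \<Rightarrow> bool" where
  "csubspace V C \<longleftrightarrow> C \<subseteq> vcarrier V \<and> C \<noteq> {} \<and>
     (\<forall>x\<in>C. \<forall>y\<in>C. vadd V x y \<in> C) \<and> (\<forall>c. \<forall>x\<in>C. vscale V c x \<in> C)"

lemma cvector_space_restrict:
  assumes "cvector_space V" "csubspace V (vcarrier W)" "vadd W = vadd V" "vscale W = vscale V"
  shows "cvector_space W"
proof -
  interpret cvector_space V by fact
  show ?thesis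
  proof
    fix x y z a b c
    assume *: "x \<in> vcarrier W" "y \<in> vcarrier W"
    then have V: "x \<in> vcarrier V" "y \<in> vcarrier V" using assms(2) by (auto simp: csubspace_def)
    show "vadd W x y \<in> vcarrier W" using * assms by (auto simp: csubspace_def)
    show "vadd W x y = vadd W y x" using V assms by (simp add: add_commute)
    show "vscale W c (vadd W x y) = vadd W (vscale W c x) (vscale W c y)"
      using V assms by (simp add: scale_add)
    show "vscale W 0 x = vscale W 0 y" using V assms by simp
    assume "z \<in> vcarrier W"
    then have "z \<in> vcarrier V" using assms(2) by (auto simp: csubspace_def)
    then show "vadd W (vadd W x y) z = vadd W x (vadd W y z)" using V assms by (simp add: add_assoc)
  next
    fix x a b
    assume *: "x \<in> vcarrier W"
    then have V: "x \<in> vcarrier V" using assms(2) by (auto simp: csubspace_def)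
    show "vscale W a x \<in> vcarrier W" using * assms by (auto simp: csubspace_def)
    show "vscale W (a + b) x = vadd W (vscale W a x) (vscale W b x)" using V assms by (simp add: add_scale)
    show "vscale W a (vscale W b x) = vscale W (a * b) x" using V assms by (simp add: scale_scale)
    show "vscale W 1 x = x" using V assms by simp
  qed (use assms in \<open>auto simp: csubspace_def\<close>)
qed

locale csubspace_of = cvector_space +
  fixes C
  assumes sub: "csubspace V C"
begin

lemma C_carrier: "h \<in> C \<Longrightarrow> h \<in> vcarrier V"
  and C_add: "\<lbrakk>h \<in> C; k \<in> C\<rbrakk> \<Longrightarrow> vadd V h k \<in> C"
  and C_scale: "h \<in> C \<Longrightarrow> vscale V c h \<in> C"
  using sub by (auto simp: csubspace_def vsub_def)

lemma C_zero: "zero \<in> C"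
  using sub C_scale[of _ 0] C_carrier unfolding csubspace_def by (metis ex_in_conv scale_zero)

lemma mem_coset_iff:
  assumes "x \<in> vcarrier V"
  shows "y \<in> coset V C x \<longleftrightarrow> y \<in> vcarrier V \<and> vsub V x y \<in> C"
proof
  assume "y \<in> coset V C x"
  then show "y \<in> vcarrier V \<and> vsub V x y \<in> C"
    using assms C_carrier by (auto simp: coset_def)
next
  assume *: "y \<in> vcarrier V \<and> vsub V x y \<in> C"
  then have "y = vsub V x (vsub V x y)" using assms by simp
  then show "y \<in> coset V C x" unfolding coset_def using * by blast
qed

lemma self_mem_coset: "x \<in> vcarrier V \<Longrightarrow> x \<in> coset V C x"
  by (simp add: mem_coset_iff C_zero)

lemma coset_eq_iff:
  assumes x: "x \<in> vcarrier V" and y: "y \<in> vcarrier V"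
  shows "coset V C x = coset V C y \<longleftrightarrow> vsub V x y \<in> C"
proof
  assume "coset V C x = coset V C y"
  then have "y \<in> coset V C x" using self_mem_coset[OF y] by simp
  then show "vsub V x y \<in> C" using mem_coset_iff[OF x] by simp
next
  assume xy: "vsub V x y \<in> C"
  then have yx: "vsub V y x \<in> C" using C_scale[of "vsub V x y" "-1"] x y by (simp add: minus_sub)
  show "coset V C x = coset V C y"
  proof (intro set_eqI)
    fix z
    show "z \<in> coset V C x \<longleftrightarrow> z \<in> coset V C y"
      using C_add[OF yx, of "vsub V x z"] C_add[OF xy, of "vsub V y z"] x y
      by (auto simp: mem_coset_iff sub_triangle)
  qed
qed

lemma coset_mem_eq: "\<lbrakk>x \<in> vcarrier V; y \<in> coset V C x\<rbrakk> \<Longrightarrow> coset V C y = coset V C x"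
  by (metis coset_eq_iff mem_coset_iff)

text \<open>The element \<open>h\<close> subtracted from a sum can be charged to the second summand
  alone, because \<open>x\<close> lies in its own coset.\<close>

lemma coset_add:
  assumes x: "x \<in> vcarrier V" and y: "y \<in> vcarrier V"
  shows "{vadd V a b | a b. a \<in> coset V C x \<and> b \<in> coset V C y} = coset V C (vadd V x y)"
    (is "?L = ?R")
proof
  show "?L \<subseteq> ?R"
    using x y by (auto simp: mem_coset_iff sub_add_sub C_add)
  show "?R \<subseteq> ?L"
  proof
    fix z assume "z \<in> ?R"
    then obtain h where h: "h \<in> C" "z = vsub V (vadd V x y) h" by (auto simp: coset_def)
    have "z = vadd V x (vsub V y h)"
      using h x y C_carrier by (simp add: vsub_def add_assoc)
    moreover have "vsub V y h \<in> coset V C y" using h by (auto simp: coset_def)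
    ultimately show "z \<in> ?L" using self_mem_coset[OF x] by blast
  qed
qed

text \<open>All cosets in the union coincide: two elements of \<open>coset V C x\<close> differ by
  an element of \<open>C\<close>, and so do their multiples. The argument is uniform in
  \<open>c\<close> and covers \<open>c = 0\<close>.\<close>

lemma coset_scale:
  assumes x: "x \<in> vcarrier V"
  shows "(\<Union>a\<in>coset V C x. coset V C (vscale V c a)) = coset V C (vscale V c x)"
proof -
  have "coset V C (vscale V c a) = coset V C (vscale V c x)" if "a \<in> coset V C x" for a
    using that x C_scale[of "vsub V a x" c] coset_eq_iff[of a x] coset_mem_eq[OF x that]
    by (simp add: coset_eq_iff mem_coset_iff scale_sub)
  then show ?thesis using self_mem_coset[OF x] by blast
qed

lemma quotient_carrier: "vcarrier (quotient_space V C) = coset V C ` vcarrier V"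
  and quotient_add: "\<lbrakk>x \<in> vcarrier V; y \<in> vcarrier V\<rbrakk> \<Longrightarrow>
    vadd (quotient_space V C) (coset V C x) (coset V C y) = coset V C (vadd V x y)"
  and quotient_scale: "x \<in> vcarrier V \<Longrightarrow>
    vscale (quotient_space V C) c (coset V C x) = coset V C (vscale V c x)"
  by (simp_all add: quotient_space_def coset_add coset_scale)

lemma quotient_cvector_space: "cvector_space (quotient_space V C)"
proof
  show "vcarrier (quotient_space V C) \<noteq> {}" by (simp add: quotient_carrier carrier_nonempty)
  show "vadd (quotient_space V C) A B = vadd (quotient_space V C) B A"
    if "A \<in> vcarrier (quotient_space V C)" "B \<in> vcarrier (quotient_space V C)" for A B
    using that add_commute by (auto simp: quotient_carrier quotient_add)
qed (auto simp: quotient_carrier quotient_add quotient_scale add_assoc scale_add add_scale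
       scale_scale)

end

section \<open>Normed spaces, closed subspaces and the quotient norm\<close>

locale cnormed_space = cvector_space V for V :: "'v cnspace" +
  assumes norm_nonneg: "x \<in> vcarrier V \<Longrightarrow> 0 \<le> vnorm V x"
    and norm_triangle: "\<lbrakk>x \<in> vcarrier V; y \<in> vcarrier V\<rbrakk>
      \<Longrightarrow> vnorm V (vadd V x y) \<le> vnorm V x + vnorm V y"
    and norm_scale_le: "x \<in> vcarrier V \<Longrightarrow> vnorm V (vscale V c x) \<le> cmod c * vnorm V x"
    and norm_zero_imp: "\<lbrakk>x \<in> vcarrier V; vnorm V x = 0\<rbrakk> \<Longrightarrow> x = vscale V 0 x"
begin

lemma norm_zero [simp]: "vnorm V zero = 0"
  using norm_scale_le[of zero 0] norm_nonneg[of zero] by simp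

lemma norm_eq_zero_iff: "x \<in> vcarrier V \<Longrightarrow> vnorm V x = 0 \<longleftrightarrow> x = zero"
  using norm_zero_imp by force

lemma norm_sub_commute:
  assumes "x \<in> vcarrier V" "y \<in> vcarrier V"
  shows "vnorm V (vsub V x y) = vnorm V (vsub V y x)"
  using norm_scale_le[of "vsub V x y" "-1"] norm_scale_le[of "vsub V y x" "-1"] assms
  by (simp add: minus_sub)

lemma norm_sub_triangle:
  assumes "x \<in> vcarrier V" "y \<in> vcarrier V" "z \<in> vcarrier V"
  shows "vnorm V (vsub V x z) \<le> vnorm V (vsub V x y) + vnorm V (vsub V y z)"
  using norm_triangle[of "vsub V x y" "vsub V y z"] assms by (simp add: sub_triangle)

sublocale M: Metric_space "vcarrier V" "vdist V"
proof
  fix x y z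
  show "0 \<le> vdist V x y" by (simp add: vdist_def norm_nonneg)
  show "vdist V x y = vdist V y x" by (simp add: vdist_def norm_sub_commute)
  show "\<lbrakk>x \<in> vcarrier V; y \<in> vcarrier V\<rbrakk> \<Longrightarrow> vdist V x y = 0 \<longleftrightarrow> x = y"
    by (simp add: vdist_def norm_eq_zero_iff sub_eq_zero_iff)
  show "\<lbrakk>x \<in> vcarrier V; y \<in> vcarrier V; z \<in> vcarrier V\<rbrakk>
      \<Longrightarrow> vdist V x z \<le> vdist V x y + vdist V y z"
    by (simp add: vdist_def norm_sub_triangle)
qed

lemma closure_iff:
  assumes "S \<subseteq> vcarrier V"
  shows "x \<in> norm_topology V closure_of S
    \<longleftrightarrow> x \<in> vcarrier V \<and> (\<forall>e>0. \<exists>h\<in>S. vnorm V (vsub V x h) < e)"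
  unfolding norm_topology_def M.metric_closure_of using assms
  by (auto simp: vdist_def subset_iff)

text \<open>Closedness is phrased by approximation because this is how the quotient norm uses it:
  distance zero from \<open>C\<close> forces membership in \<open>C\<close>.\<close>

definition closed_subspace :: "'v set \<Rightarrow> bool" where
  "closed_subspace C \<longleftrightarrow> csubspace V C \<and>
     (\<forall>x\<in>vcarrier V. (\<forall>e>0. \<exists>h\<in>C. vnorm V (vsub V x h) < e) \<longrightarrow> x \<in> C)"

lemma closed_subspace_closure:
  assumes "csubspace V S"
  shows "closed_subspace (norm_topology V closure_of S)"
proof -
  interpret csubspace_of V S by unfold_locales fact
  have S: "S \<subseteq> vcarrier V" using C_carrier by auto
  note cl = closure_iff[OF S]
  have "csubspace V (norm_topology V closure_of S)"
    unfolding csubspace_def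
  proof (intro conjI ballI allI)
    show "norm_topology V closure_of S \<subseteq> vcarrier V" using cl by auto
    show "norm_topology V closure_of S \<noteq> {}"
    proof -
      have "zero \<in> norm_topology V closure_of S"
        unfolding cl using C_zero by (auto intro!: bexI[of _ zero])
      then show ?thesis by blast
    qed
  next
    fix x y assume x: "x \<in> norm_topology V closure_of S" and y: "y \<in> norm_topology V closure_of S"
    show "vadd V x y \<in> norm_topology V closure_of S"
      unfolding cl
    proof (intro conjI allI impI)
      show "vadd V x y \<in> vcarrier V" using x y cl by auto
      fix e :: real assume "e > 0"
      then obtain h k where h: "h \<in> S" "vnorm V (vsub V x h) < e/2"
        and k: "k \<in> S" "vnorm V (vsub V y k) < e/2"
        using x y cl by (meson half_gt_zero)
      have "vnorm V (vsub V (vadd V x y) (vadd V h k)) < e"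
        using norm_triangle[of "vsub V x h" "vsub V y k"] h k x y cl
        by (simp add: sub_add_sub C_carrier)
      then show "\<exists>h\<in>S. vnorm V (vsub V (vadd V x y) h) < e" using h k C_add by blast
    qed
  next
    fix c x assume x: "x \<in> norm_topology V closure_of S"
    show "vscale V c x \<in> norm_topology V closure_of S"
      unfolding cl
    proof (intro conjI allI impI)
      show "vscale V c x \<in> vcarrier V" using x cl by auto
      fix e :: real assume "e > 0"
      then have "e / (cmod c + 1) > 0" by (simp add: add_nonneg_pos)
      then obtain h where h: "h \<in> S" "vnorm V (vsub V x h) < e / (cmod c + 1)"
        using x cl by meson
      have xV: "x \<in> vcarrier V" using x cl by auto
      have "vnorm V (vsub V (vscale V c x) (vscale V c h)) \<le> cmod c * vnorm V (vsub V x h)"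
        using norm_scale_le[of "vsub V x h" c] xV h C_carrier by (simp add: scale_sub)
      also have "\<dots> \<le> cmod c * (e / (cmod c + 1))" using h by (intro mult_left_mono) auto
      also have "\<dots> < e"
        using \<open>e > 0\<close> norm_ge_zero[of c] by (simp add: divide_less_eq mult.commute add_nonneg_pos)
      finally show "\<exists>h\<in>S. vnorm V (vsub V (vscale V c x) h) < e" using h C_scale by blast
    qed
  qed
  moreover have "x \<in> norm_topology V closure_of S"
    if x: "x \<in> vcarrier V" and *: "\<forall>e>0. \<exists>h\<in>norm_topology V closure_of S. vnorm V (vsub V x h) < e" for x
    unfolding cl
  proof (intro conjI allI impI x)
    fix e :: real assume "e > 0"
    then obtain k where k: "k \<in> norm_topology V closure_of S" "vnorm V (vsub V x k) < e/2"
      using * by (meson half_gt_zero)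
    then obtain h where h: "h \<in> S" "vnorm V (vsub V k h) < e/2"
      using cl \<open>e > 0\<close> by (meson half_gt_zero)
    have "vnorm V (vsub V x h) < e"
      using norm_sub_triangle[of x k h] h k x cl C_carrier by auto
    then show "\<exists>h\<in>S. vnorm V (vsub V x h) < e" using h by blast
  qed
  ultimately show ?thesis by (auto simp: closed_subspace_def)
qed

text \<open>Choose for every \<open>S\<close> a point of a countable dense set within e/2 of
  \<open>f S\<close>. Two sets with the same choice would have images at distance less than
  \<open>e\<close>, so the choice is injective and would make the power set of the natural numbers
  countable.\<close>

lemma not_separable:
  fixes f :: "nat set \<Rightarrow> 'v"
  assumes f: "\<And>S. f S \<in> vcarrier V" and e: "e > 0"
    and sep: "\<And>S T. S \<noteq> T \<Longrightarrow> e \<le> vnorm V (vsub V (f S) (f T))"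
  shows "\<not> separable_space (norm_topology V)"
proof
  assume "separable_space (norm_topology V)"
  then obtain D where D: "countable D" "D \<subseteq> vcarrier V" "norm_topology V closure_of D = vcarrier V"
    by (auto simp: separable_space_def norm_topology_def)
  have "\<exists>h\<in>D. vnorm V (vsub V (f S) h) < e/2" for S
    using f[of S] D closure_iff[OF D(2)] e by (metis half_gt_zero)
  then obtain g where g: "\<And>S. g S \<in> D" "\<And>S. vnorm V (vsub V (f S) (g S)) < e/2" by metis
  have "inj g"
  proof (rule injI, rule ccontr)
    fix S T assume "g S = g T" "S \<noteq> T"
    then show False
      using sep[of S T] g(2)[of S] g(2)[of T] norm_sub_triangle[of "f S" "g S" "f T"] f D(2) g(1)[of S]
        norm_sub_commute[of "f T" "g T"] by (auto simp: subset_iff)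
  qed
  then have "countable (UNIV :: nat set set)"
    using D(1) g(1) by (metis (no_types, lifting) countable_image_inj_on countable_subset image_subsetI inj_on_subset)
  then show False using uncountable_def Cantors_theorem by (metis Pow_UNIV UNIV_not_empty)
qed

end

locale closed_csubspace_of = cnormed_space +
  fixes C
  assumes closed: "closed_subspace C"
begin

sublocale csubspace_of V C
  by unfold_locales (use closed in \<open>auto simp: closed_subspace_def\<close>)

abbreviation "Q \<equiv> quotient_nspace V C"

lemma Q_carrier: "vcarrier Q = coset V C ` vcarrier V"
  and Q_add: "\<lbrakk>x \<in> vcarrier V; y \<in> vcarrier V\<rbrakk> \<Longrightarrow>
    vadd Q (coset V C x) (coset V C y) = coset V C (vadd V x y)"
  and Q_scale: "x \<in> vcarrier V \<Longrightarrow>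
    vscale Q c (coset V C x) = coset V C (vscale V c x)"
  by (simp_all add: quotient_nspace_def quotient_add quotient_scale quotient_carrier)

lemma Q_sub: "\<lbrakk>x \<in> vcarrier V; y \<in> vcarrier V\<rbrakk> \<Longrightarrow>
    vsub Q (coset V C x) (coset V C y) = coset V C (vsub V x y)"
  by (simp add: vsub_def Q_add Q_scale)

lemma Q_norm: "vnorm Q (coset V C x) = (INF h\<in>C. vnorm V (vsub V x h))"
  by (simp add: quotient_nspace_def coset_def image_image)

lemma Q_norm_bdd: "x \<in> vcarrier V \<Longrightarrow> bdd_below ((\<lambda>h. vnorm V (vsub V x h)) ` C)"
  by (rule bdd_belowI2[of _ 0]) (simp add: norm_nonneg C_carrier)

lemma Q_norm_le: "\<lbrakk>x \<in> vcarrier V; h \<in> C\<rbrakk> \<Longrightarrow> vnorm Q (coset V C x) \<le> vnorm V (vsub V x h)"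
  unfolding Q_norm by (intro cINF_lower Q_norm_bdd)

lemma Q_norm_greatest:
  "(\<And>h. h \<in> C \<Longrightarrow> b \<le> vnorm V (vsub V x h)) \<Longrightarrow> b \<le> vnorm Q (coset V C x)"
  unfolding Q_norm using C_zero by (intro cINF_greatest) auto

lemma Q_norm_approx:
  assumes "x \<in> vcarrier V" "e > 0"
  obtains h where "h \<in> C" "vnorm V (vsub V x h) < vnorm Q (coset V C x) + e"
  using cINF_less_iff[OF _ Q_norm_bdd[OF assms(1)], of "vnorm Q (coset V C x) + e"] C_zero assms
  by (auto simp: Q_norm)

lemma quotient_cnormed_space: "cnormed_space Q"
proof -
  have "cvector_space Q"
    by (rule cvector_space_cong[OF quotient_cvector_space]) (auto simp: quotient_nspace_def)
  then interpret Q: cvector_space Q .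
  show ?thesis
  proof
    fix A B c assume "A \<in> vcarrier Q"
    then obtain x where x: "x \<in> vcarrier V" "A = coset V C x" by (auto simp: Q_carrier)
    show "0 \<le> vnorm Q A" unfolding x by (rule Q_norm_greatest) (simp add: norm_nonneg x C_carrier)
    show "vnorm Q (vscale Q c A) \<le> cmod c * vnorm Q A"
    proof (cases "c = 0")
      case True
      then show ?thesis using Q_norm_le[of zero zero] C_zero by (simp add: x Q_scale)
    next
      case False
      have "vnorm Q (vscale Q c A) / cmod c \<le> vnorm Q A"
        unfolding x
      proof (rule Q_norm_greatest)
        fix h assume h: "h \<in> C"
        have "vnorm Q (vscale Q c (coset V C x)) \<le> vnorm V (vsub V (vscale V c x) (vscale V c h))"
          using h x by (simp add: Q_scale Q_norm_le C_scale)
        also have "\<dots> \<le> cmod c * vnorm V (vsub V x h)"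
          using norm_scale_le[of "vsub V x h" c] x h C_carrier by (simp add: scale_sub)
        finally show "vnorm Q (vscale Q c (coset V C x)) / cmod c \<le> vnorm V (vsub V x h)"
          using False by (simp add: field_simps)
      qed
      then show ?thesis using False by (simp add: field_simps)
    qed
    show "A = vscale Q 0 A" if "vnorm Q A = 0"
    proof -
      \<comment> \<open>Quotient norm zero means that \<open>x\<close> is approximated by
        \<open>C\<close>; this is where closedness enters.\<close>
      have "x \<in> C"
        using Q_norm_approx[OF x(1)] that x(1) closed unfolding closed_subspace_def x(2)
        by (metis add_0)
      then show ?thesis using x by (simp add: Q_scale coset_eq_iff)
    qed
    assume "B \<in> vcarrier Q"
    then obtain y where y: "y \<in> vcarrier V" "B = coset V C y" by (auto simp: Q_carrier)
    show "vnorm Q (vadd Q A B) \<le> vnorm Q A + vnorm Q B"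
    proof (rule field_le_epsilon)
      fix e :: real assume "e > 0"
      then have "e/2 > 0" by simp
      obtain h where h: "h \<in> C" "vnorm V (vsub V x h) < vnorm Q A + e/2"
        using Q_norm_approx[OF x(1) \<open>e/2 > 0\<close>] x by auto
      obtain k where k: "k \<in> C" "vnorm V (vsub V y k) < vnorm Q B + e/2"
        using Q_norm_approx[OF y(1) \<open>e/2 > 0\<close>] y by auto
      have "vnorm Q (vadd Q A B) \<le> vnorm V (vsub V (vadd V x y) (vadd V h k))"
        using x y h k by (simp add: Q_add Q_norm_le C_add)
      also have "\<dots> \<le> vnorm V (vsub V x h) + vnorm V (vsub V y k)"
        using x y h k C_carrier by (simp add: sub_add_sub norm_triangle)
      finally show "vnorm Q (vadd Q A B) \<le> vnorm Q A + vnorm Q B + e" using h k by simp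
    qed
  qed
qed

end

section \<open>Linear maps induced on quotients\<close>

lemma linear_map_sub:
  assumes "linear_map V W T" "x \<in> vcarrier V" "y \<in> vcarrier V" "cvector_space V"
  shows "T (vsub V x y) = vsub W (T x) (T y)"
  using assms by (simp add: linear_map_def vsub_def cvector_space.scale_closed)

theorem induced_quasi_isometry:
  assumes V: "closed_csubspace_of V C" and W: "closed_csubspace_of W D"
    and J: "linear_map V W J" and K: "\<And>x. x \<in> vcarrier V \<Longrightarrow> vnorm W (J x) \<le> K * vnorm V x"
    and CD: "J ` C \<subseteq> D"
    and L: "\<And>x h. \<lbrakk>x \<in> vcarrier V; h \<in> D\<rbrakk>
      \<Longrightarrow> vnorm (quotient_nspace V C) (coset V C x) \<le> L * vnorm W (vsub W (J x) h)"
  shows "\<exists>J'. (\<forall>x\<in>vcarrier V. J' (coset V C x) = coset W D (J x)) \<and>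
      quasi_isometry (quotient_nspace V C) (quotient_nspace W D) J'"
proof -
  interpret V: closed_csubspace_of V C by fact
  interpret W: closed_csubspace_of W D by fact
  interpret VQ: cnormed_space V.Q by (rule V.quotient_cnormed_space)
  interpret WQ: cnormed_space W.Q by (rule W.quotient_cnormed_space)
  have JW: "J x \<in> vcarrier W" if "x \<in> vcarrier V" for x using J that by (auto simp: linear_map_def)
  define J' where "J' = (\<lambda>A. coset W D (J (SOME x. x \<in> A)))"
  have J': "J' (coset V C x) = coset W D (J x)" if x: "x \<in> vcarrier V" for x
  proof -
    define y where "y = (SOME y. y \<in> coset V C x)"
    have y: "y \<in> coset V C x" unfolding y_def using V.self_mem_coset[OF x] by (rule someI)
    then have yV: "y \<in> vcarrier V" and d: "vsub V x y \<in> C" using x by (auto simp: V.mem_coset_iff)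
    have "vsub W (J x) (J y) \<in> D"
      using CD d linear_map_sub[OF J x yV V.cvector_space_axioms] by auto
    then have "coset W D (J x) = coset W D (J y)" using x yV JW by (simp add: W.coset_eq_iff)
    then show ?thesis by (simp add: J'_def y_def)
  qed
  \<comment> \<open>A single constant for both inequalities, at least 1 as
    \<open>quasi_isometry\<close> demands.\<close>
  define M where "M = max 1 (max K L)"
  have M: "M \<ge> 1" "M \<ge> K" "M \<ge> L" by (auto simp: M_def)
  have "linear_map V.Q W.Q J'"
    using J J' JW unfolding linear_map_def V.Q_carrier W.Q_carrier
    by (auto simp: V.Q_add V.Q_scale W.Q_add W.Q_scale)
  moreover have "inverse M * vnorm V.Q A \<le> vnorm W.Q (J' A) \<and> vnorm W.Q (J' A) \<le> M * vnorm V.Q A"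
    if A: "A \<in> vcarrier V.Q" for A
  proof -
    obtain x where x: "x \<in> vcarrier V" and Ax: "A = coset V C x" using A by (auto simp: V.Q_carrier)
    have "inverse M * vnorm V.Q A \<le> vnorm W.Q (J' A)"
      unfolding Ax J'[OF x]
    proof (rule W.Q_norm_greatest)
      fix h assume h: "h \<in> D"
      have "vnorm V.Q (coset V C x) \<le> M * vnorm W (vsub W (J x) h)"
        using L[OF x h] M(3) W.norm_nonneg[of "vsub W (J x) h"] x h JW W.C_carrier
        by (smt (verit) mult_right_mono W.sub_closed)
      then show "inverse M * vnorm V.Q (coset V C x) \<le> vnorm W (vsub W (J x) h)"
        using M(1) by (simp add: field_simps)
    qed
    moreover have "inverse M * vnorm W.Q (J' A) \<le> vnorm V.Q A"
      unfolding Ax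
    proof (rule V.Q_norm_greatest)
      fix h assume h: "h \<in> C"
      have hV: "h \<in> vcarrier V" using h V.C_carrier by auto
      have "vnorm W.Q (J' (coset V C x)) \<le> vnorm W (vsub W (J x) (J h))"
        unfolding J'[OF x] using CD h JW[OF x] by (intro W.Q_norm_le) auto
      also have "\<dots> \<le> K * vnorm V (vsub V x h)"
        using K[of "vsub V x h"] x hV by (simp add: linear_map_sub[OF J x hV V.cvector_space_axioms])
      also have "\<dots> \<le> M * vnorm V (vsub V x h)"
        using M(2) x hV by (intro mult_right_mono V.norm_nonneg) auto
      finally show "inverse M * vnorm W.Q (J' (coset V C x)) \<le> vnorm V (vsub V x h)"
        using M(1) by (simp add: field_simps)
    qed
    ultimately show ?thesis using M(1) by (simp add: field_simps)
  qed
  ultimately have "quasi_isometry V.Q W.Q J'"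
    using M(1) unfolding quasi_isometry_def by blast
  then show ?thesis using J' by blast
qed

text \<open>Distances shrink by at most the factor \<open>K\<close>, so an uncountable separated
  family in \<open>V\<close> is mapped to one in \<open>W\<close>, wherever the range of
  \<open>T\<close> may lie.\<close>

lemma quasi_isometry_not_separable:
  fixes f :: "nat set \<Rightarrow> 'v"
  assumes V: "cnormed_space V" and W: "cnormed_space W" and T: "quasi_isometry V W T"
    and f: "\<And>S. f S \<in> vcarrier V" and e: "e > 0"
    and sep: "\<And>S T. S \<noteq> T \<Longrightarrow> e \<le> vnorm V (vsub V (f S) (f T))"
  shows "\<not> separable_space (norm_topology W)"
proof -
  interpret V: cnormed_space V by fact
  interpret W: cnormed_space W by fact
  obtain K where K: "K \<ge> 1" "\<And>x. x \<in> vcarrier V \<Longrightarrow> inverse K * vnorm V x \<le> vnorm W (T x)"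
    and lin: "linear_map V W T" using T by (auto simp: quasi_isometry_def)
  show ?thesis
  proof (rule W.not_separable)
    show "T (f S) \<in> vcarrier W" for S using lin f by (auto simp: linear_map_def)
    show "0 < inverse K * e" using K e by simp
    show "inverse K * e \<le> vnorm W (vsub W (T (f S)) (T (f R)))" if "S \<noteq> R" for S R
    proof -
      have "inverse K * e \<le> inverse K * vnorm V (vsub V (f S) (f R))"
        using sep[OF that] K by (intro mult_left_mono) auto
      also have "\<dots> \<le> vnorm W (T (vsub V (f S) (f R)))" using K(2) f by simp
      finally show ?thesis using linear_map_sub[OF lin f f V.cvector_space_axioms] by simp
    qed
  qed
qed

section \<open>Bounded sequences modulo null sequences\<close>

lemma linf_cnormed_space: "cnormed_space linf"
proof -
  have bdd: "bdd_above (range (\<lambda>n. cmod (x n)))" if b: "bounded (range x)" for x :: "nat \<Rightarrow> complex"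
  proof -
    obtain B where "\<And>n. cmod (x n) \<le> B" using b by (auto simp: bounded_iff)
    then show ?thesis by (intro bdd_aboveI2)
  qed
  have le: "cmod (x n) \<le> vnorm linf x" if "bounded (range x)" for x n
    unfolding linf_def using cSUP_upper[OF _ bdd[OF that], of n] by simp
  have bddI: "bounded (range x)" if "\<And>n. cmod (x n) \<le> B" for x :: "nat \<Rightarrow> complex" and B
    using that by (auto simp: bounded_iff)
  have add: "bounded (range (\<lambda>n. x n + y n))" if "bounded (range x)" "bounded (range y)"
    for x y :: "nat \<Rightarrow> complex"
    using le[OF that(1)] le[OF that(2)]
    by (intro bddI[where B = "vnorm linf x + vnorm linf y"]) (meson add_mono norm_triangle_le)
  have scale: "bounded (range (\<lambda>n. c * x n))" if "bounded (range x)" for x :: "nat \<Rightarrow> complex" and c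
    using le[OF that] by (intro bddI[where B = "cmod c * vnorm linf x"]) (simp add: norm_mult mult_left_mono)
  have leastI: "vnorm linf x \<le> B" if "\<And>n. cmod (x n) \<le> B" for x B
    using that by (auto simp: linf_def intro!: cSUP_least)
  show ?thesis
  proof
    show "vcarrier linf \<noteq> {}" by (auto simp: linf_def intro!: exI[of _ "\<lambda>_. 0"])
    fix x y :: "nat \<Rightarrow> complex" and c
    assume x: "x \<in> vcarrier linf"
    then have bx: "bounded (range x)" by (simp add: linf_def)
    show "vscale linf c x \<in> vcarrier linf" using scale[OF bx] by (simp add: linf_def)
    show "0 \<le> vnorm linf x" using le[OF bx, of 0] norm_ge_zero order_trans by blast
    show "vnorm linf (vscale linf c x) \<le> cmod c * vnorm linf x"
      using le[OF bx] by (intro leastI) (simp add: linf_def norm_mult mult_left_mono)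
    show "x = vscale linf 0 x" if "vnorm linf x = 0"
      using le[OF bx] that by (auto simp: linf_def)
    assume y: "y \<in> vcarrier linf"
    then have bY: "bounded (range y)" by (simp add: linf_def)
    show "vadd linf x y \<in> vcarrier linf" using add[OF bx bY] by (simp add: linf_def)
    show "vnorm linf (vadd linf x y) \<le> vnorm linf x + vnorm linf y"
      using le[OF bx] le[OF bY]
      by (intro leastI) (auto simp: linf_def intro: norm_triangle_le add_mono)
  qed (auto simp: linf_def algebra_simps)
qed

lemma linf_norm_le:
  assumes "x \<in> vcarrier linf" shows "cmod (x n) \<le> vnorm linf x"
proof -
  obtain B where "\<And>n. cmod (x n) \<le> B" using assms by (auto simp: linf_def bounded_iff)
  then have "bdd_above (range (\<lambda>n. cmod (x n)))" by (intro bdd_aboveI2)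
  from cSUP_upper[OF _ this, of n] show ?thesis by (simp add: linf_def)
qed

lemma linf_norm_least: "(\<And>n. cmod (x n) \<le> B) \<Longrightarrow> vnorm linf x \<le> B"
  by (auto simp: linf_def intro!: cSUP_least)

lemma linf_sub: "vsub linf x y = (\<lambda>n. x n - y n)"
  by (simp add: vsub_def linf_def)

lemma c_zero_closed_subspace: "closed_csubspace_of linf c_zero"
proof -
  interpret cnormed_space linf by (rule linf_cnormed_space)
  have "csubspace linf c_zero"
    unfolding csubspace_def c_zero_def linf_def
    by (auto intro: convergent_imp_bounded tendsto_add_zero tendsto_mult_right_zero
        intro!: exI[of _ "\<lambda>_. 0"])
  moreover have "x \<in> c_zero"
    if x: "x \<in> vcarrier linf" and *: "\<And>e. e > 0 \<Longrightarrow> \<exists>h\<in>c_zero. vnorm linf (vsub linf x h) < e" for x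
    unfolding c_zero_def mem_Collect_eq
  proof (rule LIMSEQ_I)
    fix r :: real assume "r > 0"
    then obtain h where h: "h \<in> c_zero" "vnorm linf (vsub linf x h) < r/2" using *[of "r/2"] by auto
    then obtain N where N: "\<And>n. n \<ge> N \<Longrightarrow> cmod (h n) < r/2"
      using \<open>r > 0\<close> LIMSEQ_D[of h 0 "r/2"] by (auto simp: c_zero_def)
    have hV: "h \<in> vcarrier linf" using h \<open>csubspace linf c_zero\<close> by (auto simp: csubspace_def)
    have "cmod (x n - 0) < r" if "n \<ge> N" for n
      using N[OF that] linf_norm_le[OF sub_closed[OF x hV], of n] h(2) norm_triangle_sub[of "x n" "h n"]
      by (simp add: linf_sub)
    then show "\<exists>no. \<forall>n\<ge>no. cmod (x n - 0) < r" by blast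
  qed
  ultimately show ?thesis by unfold_locales (auto simp: closed_subspace_def)
qed

text \<open>For bounded \<open>x\<close> the quotient norm modulo \<open>c_zero\<close> is \<open>limsup |x n|\<close>.\<close>

lemma linf_quotient_norm_le:
  assumes x: "x \<in> vcarrier linf" and ev: "eventually (\<lambda>n. cmod (x n) \<le> B) sequentially" and "B \<ge> 0"
  shows "vnorm (quotient_nspace linf c_zero) (coset linf c_zero x) \<le> B"
proof -
  interpret closed_csubspace_of linf c_zero by (rule c_zero_closed_subspace)
  obtain N where N: "\<And>n. n \<ge> N \<Longrightarrow> cmod (x n) \<le> B" using ev by (auto simp: eventually_sequentially)
  \<comment> \<open>The head of \<open>x\<close> is a null sequence; removing it leaves only entries
    bounded by \<open>B\<close>.\<close>
  define h where "h n = (if n < N then x n else 0)" for n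
  have "eventually (\<lambda>n. h n = 0) sequentially"
    unfolding eventually_sequentially h_def by (intro exI[of _ N]) auto
  then have "h \<in> c_zero" by (auto simp: c_zero_def intro: tendsto_eventually)
  then have "vnorm Q (coset linf c_zero x) \<le> vnorm linf (vsub linf x h)" using Q_norm_le x by blast
  also have "\<dots> \<le> B" by (rule linf_norm_least) (use N \<open>B \<ge> 0\<close> in \<open>auto simp: linf_sub h_def\<close>)
  finally show ?thesis .
qed

text \<open>A null sequence changes the late entries by arbitrarily little, and \<open>x\<close> has
  entries of size at least \<open>B\<close> arbitrarily late.\<close>

lemma linf_quotient_norm_ge:
  assumes x: "x \<in> vcarrier linf" and fr: "\<And>N. \<exists>n\<ge>N. B \<le> cmod (x n)"
  shows "B \<le> vnorm (quotient_nspace linf c_zero) (coset linf c_zero x)"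
proof -
  interpret closed_csubspace_of linf c_zero by (rule c_zero_closed_subspace)
  show ?thesis
  proof (rule Q_norm_greatest, rule field_le_epsilon)
    fix h and e :: real assume h: "h \<in> c_zero" and "e > 0"
    then obtain N where N: "\<And>n. n \<ge> N \<Longrightarrow> cmod (h n) < e"
      using LIMSEQ_D[of h 0 e] by (auto simp: c_zero_def)
    obtain n where n: "n \<ge> N" "B \<le> cmod (x n)" using fr by blast
    have "cmod (x n) \<le> vnorm linf (vsub linf x h) + e"
      using N[OF n(1)] linf_norm_le[OF sub_closed[OF x C_carrier[OF h]], of n] norm_triangle_sub[of "x n" "h n"]
      by (simp add: linf_sub)
    then show "B \<le> vnorm linf (vsub linf x h) + e" using n by simp
  qed
qed

text \<open>Reading \<open>n\<close> as a pair and testing only its first component repeats every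
  natural number infinitely often. Hence the indicator sequences of two different sets differ by 1
  in modulus infinitely often, which no null sequence can repair; with indicators of the sets
  themselves a finite difference would be lost modulo \<open>c_zero\<close>.\<close>

lemma linf_separated_family:
  obtains f :: "nat set \<Rightarrow> (nat \<Rightarrow> complex) set" where
    "\<And>S. f S \<in> vcarrier (quotient_nspace linf c_zero)"
    "\<And>S T. S \<noteq> T \<Longrightarrow> 1 \<le> vnorm (quotient_nspace linf c_zero) (vsub (quotient_nspace linf c_zero) (f S) (f T))"
proof
  interpret closed_csubspace_of linf c_zero by (rule c_zero_closed_subspace)
  define g :: "nat set \<Rightarrow> nat \<Rightarrow> complex" where
    "g S n = (if fst (prod_decode n) \<in> S then 1 else 0)" for S n
  have g: "g S \<in> vcarrier linf" for S
    by (auto simp: linf_def g_def bounded_iff intro!: exI[of _ 1])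
  show "coset linf c_zero (g S) \<in> vcarrier Q" for S using g by (simp add: Q_carrier)
  show "1 \<le> vnorm Q (vsub Q (coset linf c_zero (g S)) (coset linf c_zero (g T)))" if ST: "S \<noteq> T" for S T
  proof -
    obtain i where i: "i \<in> S - T \<union> (T - S)" using ST by blast
    have "\<exists>n\<ge>N. 1 \<le> cmod (vsub linf (g S) (g T) n)" for N
      using i by (intro exI[of _ "prod_encode (i, N)"]) (auto simp: linf_sub g_def le_prod_encode_2)
    then show ?thesis using g by (simp add: Q_sub linf_quotient_norm_ge)
  qed
qed


section \<open>Smooth functions\<close>

abbreviation pd :: "'a::euclidean_space \<Rightarrow> ('a \<Rightarrow> 'b::real_normed_vector) \<Rightarrow> 'a \<Rightarrow> 'b" where
  "pd b f \<equiv> (\<lambda>x. frechet_derivative f (at x) b)"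

lemma pd_eq: "(f has_derivative f') (at x) \<Longrightarrow> pd b f x = f' b"
  using frechet_derivative_at by metis

text \<open>The recursion of \<open>iter_partial\<close> peels off the derivative taken last.
  Peeling off the one taken first leaves the same operator applied to another function, which is
  what inductions generalised over \<open>f\<close> require.\<close>

lemma iter_partial_snoc: "iter_partial (bs @ [b]) f = iter_partial bs (pd b f)"
  by (induction bs) auto

lemma all_lists_Suc:
  "(\<forall>bs\<in>lists Basis. length bs \<le> Suc n \<longrightarrow> P bs) \<longleftrightarrow>
    P [] \<and> (\<forall>b\<in>Basis. \<forall>bs\<in>lists Basis. length bs \<le> n \<longrightarrow> P (bs @ [b]))" (is "?L \<longleftrightarrow> ?R")
proof
  assume R: ?R
  show ?L
  proof (intro ballI impI)
    fix bs :: "'a list" assume "bs \<in> lists Basis" "length bs \<le> Suc n"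
    then show "P bs" using R by (cases bs rule: rev_cases) auto
  qed
qed auto

lemma smooth_differentiable: "smooth f \<Longrightarrow> f differentiable (at x)"
  unfolding smooth_def by (metis iter_partial.simps(1) lists.Nil)

lemma smooth_pd: "\<lbrakk>smooth f; b \<in> Basis\<rbrakk> \<Longrightarrow> smooth (pd b f)"
  unfolding smooth_def by (metis append_in_lists_conv iter_partial_snoc lists.Cons lists.Nil)

lemma smooth_has_derivative: "smooth f \<Longrightarrow> (f has_derivative frechet_derivative f (at x)) (at x)"
  using smooth_differentiable frechet_derivative_works by blast

lemma smooth_continuous: "smooth f \<Longrightarrow> continuous_on S f"
  by (meson continuous_at_imp_continuous_on differentiable_imp_continuous_within smooth_differentiable)

lemma smooth_measurable: "smooth f \<Longrightarrow> f \<in> borel_measurable borel"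
  by (intro borel_measurable_continuous_onI smooth_continuous)

inductive_set sum_closure :: "('a \<Rightarrow> 'b::plus) set \<Rightarrow> ('a \<Rightarrow> 'b) set" for X where
  base: "f \<in> X \<Longrightarrow> f \<in> sum_closure X"
| add: "\<lbrakk>f \<in> sum_closure X; g \<in> sum_closure X\<rbrakk> \<Longrightarrow> (\<lambda>x. f x + g x) \<in> sum_closure X"

lemma pd_add:
  assumes "f differentiable (at x)" "g differentiable (at x)"
  shows "pd b (\<lambda>x. f x + g x) x = pd b f x + pd b g x"
  using assms by (intro pd_eq) (auto intro!: derivative_eq_intros simp: frechet_derivative_works)

lemma pd_mult:
  fixes f g :: "'a::euclidean_space \<Rightarrow> 'b::real_normed_algebra"
  assumes "f differentiable (at x)" "g differentiable (at x)"
  shows "pd b (\<lambda>x. f x * g x) x = f x * pd b g x + pd b f x * g x"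
  using assms by (intro pd_eq) (auto intro!: has_derivative_mult simp: frechet_derivative_works)

lemma pd_cmult:
  fixes f :: "'a::euclidean_space \<Rightarrow> 'b::real_normed_algebra"
  assumes "f differentiable (at x)"
  shows "pd b (\<lambda>x. c * f x) x = c * pd b f x"
  using assms by (intro pd_eq has_derivative_mult_right) (simp add: frechet_derivative_works)

lemma pd_affine:
  assumes "f differentiable (at (r *\<^sub>R x + y))"
  shows "pd b (\<lambda>x. f (r *\<^sub>R x + y)) x = r *\<^sub>R pd b f (r *\<^sub>R x + y)"
proof (rule pd_eq)
  let ?F = "frechet_derivative f (at (r *\<^sub>R x + y))"
  have F: "(f has_derivative ?F) (at (r *\<^sub>R x + y))" using assms by (simp add: frechet_derivative_works)
  then interpret bounded_linear ?F by (rule has_derivative_bounded_linear)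
  have "((\<lambda>x. f (r *\<^sub>R x + y)) has_derivative (\<lambda>h. ?F (r *\<^sub>R h))) (at x)"
    by (rule has_derivative_compose[of "\<lambda>x. r *\<^sub>R x + y", OF _ F]) (auto intro!: derivative_eq_intros)
  then show "((\<lambda>x. f (r *\<^sub>R x + y)) has_derivative (\<lambda>h. r *\<^sub>R ?F h)) (at x)" by (simp add: scaleR)
qed

text \<open>Coinduction up to finite sums, as needed for Leibniz-type rules.\<close>

lemma smooth_coinduct:
  assumes f: "f \<in> sum_closure X"
    and diff: "\<And>f x. f \<in> X \<Longrightarrow> f differentiable (at x)"
    and pd: "\<And>f b. \<lbrakk>f \<in> X; b \<in> Basis\<rbrakk> \<Longrightarrow> pd b f \<in> sum_closure X"
  shows "smooth f"
proof -
  have diff': "f differentiable (at x)" if "f \<in> sum_closure X" for f x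
    using that by induction (auto simp: diff)
  have pd': "pd b f \<in> sum_closure X" if "f \<in> sum_closure X" "b \<in> Basis" for f b
    using that by induction (auto simp: pd pd_add diff' intro: sum_closure.add)
  have "iter_partial bs f \<in> sum_closure X" if "bs \<in> lists Basis" for bs
    using that by (induction bs) (auto simp: f pd')
  then show ?thesis unfolding smooth_def using diff' by blast
qed

lemma smooth_add:
  assumes "smooth f" "smooth g"
  shows "smooth (\<lambda>x. f x + g x)"
  by (rule smooth_coinduct[where X = "Collect smooth"])
    (use assms in \<open>auto simp: smooth_differentiable smooth_pd intro: sum_closure.intros\<close>)

lemma smooth_mult:
  fixes f g :: "'a::euclidean_space \<Rightarrow> 'b::real_normed_algebra"
  assumes "smooth f" "smooth g"
  shows "smooth (\<lambda>x. f x * g x)"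
proof (rule smooth_coinduct[where X = "{\<lambda>x. f x * g x | f g. smooth f \<and> smooth g}"])
  fix h :: "'a \<Rightarrow> 'b" and b :: 'a
  assume "h \<in> {\<lambda>x. f x * g x | f g. smooth f \<and> smooth g}" "b \<in> Basis"
  then obtain f g where h: "h = (\<lambda>x. f x * g x)" "smooth f" "smooth g" by blast
  then have "pd b h = (\<lambda>x. f x * pd b g x + pd b f x * g x)"
    by (simp add: pd_mult smooth_differentiable)
  also have "\<dots> \<in> sum_closure {\<lambda>x. f x * g x | f g. smooth f \<and> smooth g}"
  proof (intro sum_closure.add sum_closure.base)
    have mem: "(\<lambda>x. u x * v x) \<in> {\<lambda>x. f x * g x | f g. smooth f \<and> smooth g}"
      if "smooth u" "smooth v" for u v :: "'a \<Rightarrow> 'b" using that by blast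
    show "(\<lambda>x. f x * pd b g x) \<in> {\<lambda>x. f x * g x | f g. smooth f \<and> smooth g}"
      "(\<lambda>x. pd b f x * g x) \<in> {\<lambda>x. f x * g x | f g. smooth f \<and> smooth g}"
      using h \<open>b \<in> Basis\<close> by (intro mem smooth_pd; simp)+
  qed
  finally show "pd b h \<in> sum_closure {\<lambda>x. f x * g x | f g. smooth f \<and> smooth g}" .
qed (use assms in \<open>auto simp: smooth_differentiable intro!: differentiable_mult sum_closure.base\<close>)

lemma smooth_const: "smooth (\<lambda>x. c)"
  by (rule smooth_coinduct[where X = "range (\<lambda>c x. c)"])
    (auto intro!: sum_closure.base simp: pd_eq[OF has_derivative_const])

lemma smooth_affine:
  assumes "smooth f"
  shows "smooth (\<lambda>x. f (r *\<^sub>R x + y))"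
\<comment> \<open>The factor \<open>c\<close> is built into the family to absorb the powers of
  \<open>r\<close> that the chain rule produces.\<close>
proof (rule smooth_coinduct[where X = "{\<lambda>x. c *\<^sub>R f (r *\<^sub>R x + y) | c f. smooth f}"])
  have diff: "(\<lambda>x. f (r *\<^sub>R x + y)) differentiable (at x)" if "smooth f" for x and f :: "'a \<Rightarrow> 'b"
    by (rule differentiable_chain_at[unfolded o_def, of "\<lambda>x. r *\<^sub>R x + y"])
      (auto simp: smooth_differentiable that)
  show "h differentiable (at x)"
    if "h \<in> {\<lambda>x. c *\<^sub>R f (r *\<^sub>R x + y) | c f. smooth f}" for h :: "'a \<Rightarrow> 'b" and x
    using that diff by auto
  fix h :: "'a \<Rightarrow> 'b" and b :: 'a
  assume "h \<in> {\<lambda>x. c *\<^sub>R f (r *\<^sub>R x + y) | c f. smooth f}" and b: "b \<in> Basis"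
  then obtain c f where h: "h = (\<lambda>x. c *\<^sub>R f (r *\<^sub>R x + y))" and f: "smooth f" by blast
  have "pd b h = (\<lambda>x. c *\<^sub>R pd b (\<lambda>x. f (r *\<^sub>R x + y)) x)"
    unfolding h using diff[OF f]
    by (intro ext pd_eq has_derivative_scaleR_right) (simp add: frechet_derivative_works)
  also have "\<dots> = (\<lambda>x. (c * r) *\<^sub>R pd b f (r *\<^sub>R x + y))"
    by (simp add: pd_affine smooth_differentiable f)
  finally show "pd b h \<in> sum_closure {\<lambda>x. c *\<^sub>R f (r *\<^sub>R x + y) | c f. smooth f}"
    using smooth_pd[OF f b] by (auto intro!: sum_closure.base)
next
  show "(\<lambda>x. f (r *\<^sub>R x + y)) \<in> sum_closure {\<lambda>x. c *\<^sub>R f (r *\<^sub>R x + y) | c f. smooth f}"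
    using assms by (auto intro!: sum_closure.base exI[of _ 1] exI[of _ f])
qed

lemma smooth_of_real:
  assumes "smooth (f :: 'a::euclidean_space \<Rightarrow> real)"
  shows "smooth (\<lambda>x. complex_of_real (f x))"
proof (rule smooth_coinduct[where X = "{\<lambda>x. complex_of_real (f x) | f. smooth f}"])
  have d: "((\<lambda>x. complex_of_real (f x)) has_derivative
      (\<lambda>v. complex_of_real (frechet_derivative f (at x) v))) (at x)"
    if "smooth f" for f :: "'a \<Rightarrow> real" and x
    by (intro has_derivative_of_real smooth_has_derivative that)
  fix h :: "'a \<Rightarrow> complex"
  assume "h \<in> {\<lambda>x. complex_of_real (f x) | f. smooth f}"
  then obtain f :: "'a \<Rightarrow> real" where h: "h = (\<lambda>x. complex_of_real (f x))" and f: "smooth f" by blast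
  show "h differentiable (at x)" for x using d[OF f] h differentiable_def by blast
  fix b :: 'a assume b: "b \<in> Basis"
  have "pd b h = (\<lambda>x. complex_of_real (pd b f x))" using pd_eq[OF d[OF f]] h by auto
  then show "pd b h \<in> sum_closure {\<lambda>x. complex_of_real (f x) | f. smooth f}"
    using smooth_pd[OF f b] by (auto intro!: sum_closure.base)
qed (use assms in \<open>auto intro!: sum_closure.base\<close>)

lemma smooth_cmult: "smooth f \<Longrightarrow> smooth (\<lambda>x. c * f x)" for f :: "'a::euclidean_space \<Rightarrow> complex"
  using smooth_mult[OF smooth_const] .

lemma smooth_coord: "smooth (\<lambda>x::'a::euclidean_space. complex_of_real (x \<bullet> v))"
proof (rule smooth_of_real, rule smooth_coinduct[where X = "insert (\<lambda>x. x \<bullet> v) (range (\<lambda>c x. c))"])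
  have d: "((\<lambda>x. x \<bullet> v) has_derivative (\<lambda>h. h \<bullet> v)) (at x)" for x :: 'a
    by (auto intro!: derivative_eq_intros)
  fix f :: "'a \<Rightarrow> real" and b :: 'a
  assume f: "f \<in> insert (\<lambda>x. x \<bullet> v) (range (\<lambda>c x. c))"
  show "f differentiable (at x)" for x using f by auto
  show "pd b f \<in> sum_closure (insert (\<lambda>x. x \<bullet> v) (range (\<lambda>c x. c)))"
    using f by (auto intro!: sum_closure.base simp: pd_eq[OF has_derivative_const] pd_eq[OF d])
qed (auto intro: sum_closure.base)

section \<open>Iterated derivatives of sums, dilates and products\<close>

lemma iter_partial_add:
  "\<lbrakk>smooth f; smooth g; bs \<in> lists Basis\<rbrakk>
    \<Longrightarrow> iter_partial bs (\<lambda>x. f x + g x) = (\<lambda>x. iter_partial bs f x + iter_partial bs g x)"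
  by (induction bs arbitrary: f g rule: rev_induct)
    (auto simp: iter_partial_snoc pd_add smooth_differentiable smooth_pd)

lemma iter_partial_cmult:
  fixes f :: "'a::euclidean_space \<Rightarrow> complex"
  shows "\<lbrakk>smooth f; bs \<in> lists Basis\<rbrakk>
    \<Longrightarrow> iter_partial bs (\<lambda>x. c * f x) = (\<lambda>x. c * iter_partial bs f x)"
  by (induction bs arbitrary: f rule: rev_induct)
    (auto simp: iter_partial_snoc pd_cmult smooth_differentiable smooth_pd)

lemma iter_partial_affine:
  fixes f :: "'a::euclidean_space \<Rightarrow> complex"
  shows "\<lbrakk>smooth f; bs \<in> lists Basis\<rbrakk> \<Longrightarrow> iter_partial bs (\<lambda>x. f (r *\<^sub>R x + y))
    = (\<lambda>x. of_real (r ^ length bs) * iter_partial bs f (r *\<^sub>R x + y))"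
proof (induction bs arbitrary: f rule: rev_induct)
  case (snoc b bs)
  then have b: "b \<in> Basis" and bs: "bs \<in> lists Basis" by auto
  have "iter_partial (bs @ [b]) (\<lambda>x. f (r *\<^sub>R x + y))
      = iter_partial bs (\<lambda>x. of_real r * pd b f (r *\<^sub>R x + y))"
    unfolding iter_partial_snoc using snoc
    by (simp add: pd_affine smooth_differentiable scaleR_conv_of_real)
  also have "\<dots> = (\<lambda>x. of_real r * iter_partial bs (\<lambda>x. pd b f (r *\<^sub>R x + y)) x)"
    using snoc.prems b bs by (intro iter_partial_cmult smooth_affine smooth_pd)
  also have "\<dots> = (\<lambda>x. of_real (r ^ length (bs @ [b])) * iter_partial (bs @ [b]) f (r *\<^sub>R x + y))"
    unfolding iter_partial_snoc using snoc.IH[OF smooth_pd[OF snoc.prems(1) b] bs]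
    by (simp add: mult_ac)
  finally show ?case .
qed simp

text \<open>A crude pointwise Leibniz rule: every derivative doubles the number of terms, and each
  term is a product of derivatives of total order at most \<open>n\<close>. The induction moves one
  derivative onto a factor and lowers \<open>n\<close> by one. Keeping \<open>x\<close> fixed allows
  bounds that depend on the point.\<close>

lemma iter_partial_mult_bound:
  fixes f g :: "'a::euclidean_space \<Rightarrow> complex"
  assumes "smooth f" "smooth g"
    and "\<And>bs. \<lbrakk>bs \<in> lists Basis; length bs \<le> n\<rbrakk> \<Longrightarrow> cmod (iter_partial bs f x) \<le> A"
    and "\<And>bs. \<lbrakk>bs \<in> lists Basis; length bs \<le> n\<rbrakk> \<Longrightarrow> cmod (iter_partial bs g x) \<le> B"
    and "bs \<in> lists Basis" "length bs \<le> n"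
  shows "cmod (iter_partial bs (\<lambda>x. f x * g x) x) \<le> 2 ^ length bs * A * B"
  using assms
proof (induction bs arbitrary: f g n rule: rev_induct)
  case Nil
  have "cmod (f x) \<le> A" "cmod (g x) \<le> B" using Nil(3)[of "[]"] Nil(4)[of "[]"] by auto
  then show ?case by (auto simp: norm_mult intro!: mult_mono order_trans[OF norm_ge_zero])
next
  case (snoc b bs)
  have b: "b \<in> Basis" and bs: "bs \<in> lists Basis" and n: "length bs \<le> n - 1" "n \<ge> 1"
    using snoc.prems by auto
  have *: "iter_partial (bs @ [b]) (\<lambda>x. f x * g x) x
     = iter_partial bs (\<lambda>x. f x * pd b g x) x + iter_partial bs (\<lambda>x. pd b f x * g x) x"
    unfolding iter_partial_snoc using snoc.prems(1,2) b bs
    by (simp add: pd_mult smooth_differentiable iter_partial_add smooth_mult smooth_pd)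
  have pf: "cmod (iter_partial cs (pd b f) x) \<le> A" "cmod (iter_partial cs (pd b g) x) \<le> B"
    if "cs \<in> lists Basis" "length cs \<le> n - 1" for cs
    using snoc.prems(3)[of "cs @ [b]"] snoc.prems(4)[of "cs @ [b]"] that b n
    by (auto simp: iter_partial_snoc)
  have "cmod (iter_partial bs (\<lambda>x. f x * pd b g x) x) \<le> 2 ^ length bs * A * B"
    using snoc.prems(1-4) b bs n pf by (intro snoc.IH[of f "pd b g" "n - 1"] smooth_pd) auto
  moreover have "cmod (iter_partial bs (\<lambda>x. pd b f x * g x) x) \<le> 2 ^ length bs * A * B"
    using snoc.prems(1-4) b bs n pf by (intro snoc.IH[of "pd b f" g "n - 1"] smooth_pd) auto
  ultimately show ?case unfolding * by (auto intro: order_trans[OF norm_triangle_ineq])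
qed


section \<open>Schwartz functions\<close>

text \<open>Decay order \<open>N\<close> and differentiation order \<open>n\<close> are kept apart,
  since most operations shift only one of them, and the seminorm appears as an upper bound so that
  no supremum has to be handled. The diagonal case \<open>n = N\<close> corresponds to
  \<open>schwartz_norm N\<close>.\<close>

definition schwartz_bound :: "nat \<Rightarrow> nat \<Rightarrow> real \<Rightarrow> ('a::euclidean_space \<Rightarrow> complex) \<Rightarrow> bool" where
  "schwartz_bound N n A f \<longleftrightarrow>
    (\<forall>bs\<in>lists Basis. length bs \<le> n \<longrightarrow> (\<forall>x. (1 + norm x) ^ N * cmod (iter_partial bs f x) \<le> A))"

lemma schwartz_bound_0: "schwartz_bound N 0 A f \<longleftrightarrow> (\<forall>x. (1 + norm x) ^ N * cmod (f x) \<le> A)"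
  by (force simp: schwartz_bound_def)

lemma schwartz_bound_Suc:
  "schwartz_bound N (Suc n) A f \<longleftrightarrow> schwartz_bound N 0 A f \<and> (\<forall>b\<in>Basis. schwartz_bound N n A (pd b f))"
  unfolding schwartz_bound_def all_lists_Suc by (force simp: iter_partial_snoc)

lemma schwartz_bound_nonneg:
  fixes f :: "'a::euclidean_space \<Rightarrow> complex"
  assumes "schwartz_bound N n A f" shows "0 \<le> A"
proof -
  have "(1 + norm (0::'a)) ^ N * cmod (iter_partial [] f 0) \<le> A"
    using assms lists.Nil[of Basis] unfolding schwartz_bound_def by (metis le0 list.size(3))
  then show ?thesis using order_trans[OF norm_ge_zero] by auto
qed

lemma schwartz_bound_mono:
  fixes f :: "'a::euclidean_space \<Rightarrow> complex"
  assumes "schwartz_bound N n A f" "N' \<le> N" "n' \<le> n" "A \<le> A'"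
  shows "schwartz_bound N' n' A' f"
  unfolding schwartz_bound_def
proof (intro ballI impI allI)
  fix bs :: "'a list" and x :: 'a assume bs: "bs \<in> lists Basis" "length bs \<le> n'"
  have "(1 + norm x) ^ N' * cmod (iter_partial bs f x) \<le> (1 + norm x) ^ N * cmod (iter_partial bs f x)"
    using assms(2) by (intro mult_right_mono power_increasing) auto
  also have "\<dots> \<le> A'" using assms bs unfolding schwartz_bound_def by (meson order_trans)
  finally show "(1 + norm x) ^ N' * cmod (iter_partial bs f x) \<le> A'" .
qed

lemma schwartz_bound_add:
  fixes f g :: "'a::euclidean_space \<Rightarrow> complex"
  assumes "schwartz_bound N n A f" "schwartz_bound N n B g" "smooth f" "smooth g"
  shows "schwartz_bound N n (A + B) (\<lambda>x. f x + g x)"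
  unfolding schwartz_bound_def
proof (intro ballI impI allI)
  fix bs :: "'a list" and x :: 'a assume bs: "bs \<in> lists Basis" "length bs \<le> n"
  have "(1 + norm x) ^ N * cmod (iter_partial bs f x + iter_partial bs g x)
      \<le> (1 + norm x) ^ N * cmod (iter_partial bs f x) + (1 + norm x) ^ N * cmod (iter_partial bs g x)"
    unfolding distrib_left[symmetric] by (intro mult_left_mono norm_triangle_ineq) auto
  also have "\<dots> \<le> A + B" using assms bs unfolding schwartz_bound_def by (intro add_mono) blast+
  finally show "(1 + norm x) ^ N * cmod (iter_partial bs (\<lambda>x. f x + g x) x) \<le> A + B"
    using assms bs by (simp add: iter_partial_add)
qed

lemma schwartz_bound_cmult:
  fixes f :: "'a::euclidean_space \<Rightarrow> complex"
  assumes "schwartz_bound N n A f" "smooth f"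
  shows "schwartz_bound N n (cmod c * A) (\<lambda>x. c * f x)"
  unfolding schwartz_bound_def
proof (intro ballI impI allI)
  fix bs :: "'a list" and x :: 'a assume bs: "bs \<in> lists Basis" "length bs \<le> n"
  have "cmod c * ((1 + norm x) ^ N * cmod (iter_partial bs f x)) \<le> cmod c * A"
    using assms bs unfolding schwartz_bound_def by (intro mult_left_mono) auto
  then show "(1 + norm x) ^ N * cmod (iter_partial bs (\<lambda>x. c * f x) x) \<le> cmod c * A"
    using assms bs by (simp add: iter_partial_cmult norm_mult mult_ac)
qed

text \<open>All the decay is supplied by \<open>g\<close>; the multiplier \<open>f\<close> only
  needs bounded derivatives.\<close>

lemma schwartz_bound_mult:
  fixes f g :: "'a::euclidean_space \<Rightarrow> complex"
  assumes "schwartz_bound 0 n A f" "schwartz_bound N n B g" "smooth f" "smooth g"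
  shows "schwartz_bound N n (2 ^ n * A * B) (\<lambda>x. f x * g x)"
  unfolding schwartz_bound_def
proof (intro ballI impI allI)
  fix bs :: "'a list" and x :: 'a assume bs: "bs \<in> lists Basis" "length bs \<le> n"
  have pos: "(1 + norm x) ^ N > 0" by (simp add: add_pos_nonneg)
  have A: "A \<ge> 0" and B: "B \<ge> 0" using assms schwartz_bound_nonneg by blast+
  have "cmod (iter_partial bs (\<lambda>x. f x * g x) x) \<le> 2 ^ length bs * A * (B / (1 + norm x) ^ N)"
  proof (rule iter_partial_mult_bound[OF assms(3,4) _ _ bs])
    show "cmod (iter_partial cs f x) \<le> A" if "cs \<in> lists Basis" "length cs \<le> n" for cs
      using assms(1) that unfolding schwartz_bound_def by force
    show "cmod (iter_partial cs g x) \<le> B / (1 + norm x) ^ N" if "cs \<in> lists Basis" "length cs \<le> n" for cs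
      using assms(2) that pos unfolding schwartz_bound_def by (simp add: field_simps)
  qed
  then have "(1 + norm x) ^ N * cmod (iter_partial bs (\<lambda>x. f x * g x) x) \<le> 2 ^ length bs * A * B"
    using pos by (simp add: field_simps)
  also have "\<dots> \<le> 2 ^ n * A * B"
    using A B bs by (intro mult_right_mono power_increasing) auto
  finally show "(1 + norm x) ^ N * cmod (iter_partial bs (\<lambda>x. f x * g x) x) \<le> 2 ^ n * A * B" .
qed

lemma pd_coord_mult:
  fixes f :: "'a::euclidean_space \<Rightarrow> complex"
  assumes "smooth f"
  shows "pd c (\<lambda>x. of_real (x \<bullet> b) * f x) = (\<lambda>x. of_real (x \<bullet> b) * pd c f x + of_real (c \<bullet> b) * f x)"
proof
  fix x
  have "((\<lambda>x. complex_of_real (x \<bullet> b)) has_derivative (\<lambda>h. complex_of_real (h \<bullet> b))) (at x)"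
    by (auto intro!: derivative_eq_intros)
  then have "pd c (\<lambda>x. complex_of_real (x \<bullet> b)) x = complex_of_real (c \<bullet> b)" by (rule pd_eq)
  then show "pd c (\<lambda>x. of_real (x \<bullet> b) * f x) x = of_real (x \<bullet> b) * pd c f x + of_real (c \<bullet> b) * f x"
    using pd_mult[OF smooth_differentiable[OF smooth_coord[of b], of x] smooth_differentiable[OF assms, of x], of c] by simp
qed

text \<open>The coordinate costs one order of decay. Each derivative either passes to
  \<open>f\<close> or hits the coordinate and leaves a constant of modulus at most 1; one extra term
  per order accounts for the factor \<open>n + 1\<close>.\<close>

lemma schwartz_bound_coord_mult:
  assumes "b \<in> Basis"
  shows "\<lbrakk>schwartz_bound (Suc N) n A f; smooth f\<rbrakk>
    \<Longrightarrow> schwartz_bound N n ((real n + 1) * A) (\<lambda>x. of_real (x \<bullet> b) * f x)"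
proof (induction n arbitrary: f)
  have base: "schwartz_bound N 0 A (\<lambda>x. of_real (x \<bullet> b) * f x)" if "schwartz_bound (Suc N) 0 A f" for f
    unfolding schwartz_bound_0
  proof
    fix x
    have "cmod (of_real (x \<bullet> b) * f x) \<le> (1 + norm x) * cmod (f x)"
      using Basis_le_norm[OF assms, of x] unfolding norm_mult norm_of_real by (intro mult_right_mono) auto
    then have "(1 + norm x) ^ N * cmod (of_real (x \<bullet> b) * f x)
        \<le> (1 + norm x) ^ N * ((1 + norm x) * cmod (f x))" by (intro mult_left_mono) auto
    also have "\<dots> = (1 + norm x) ^ Suc N * cmod (f x)" by simp
    finally have "(1 + norm x) ^ N * cmod (of_real (x \<bullet> b) * f x) \<le> (1 + norm x) ^ Suc N * cmod (f x)" .
    then show "(1 + norm x) ^ N * cmod (of_real (x \<bullet> b) * f x) \<le> A"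
      using that unfolding schwartz_bound_0 by (meson order_trans)
  qed
  {
    case 0 then show ?case using base by simp
  next
    case (Suc n)
    have A: "0 \<le> A" using Suc.prems schwartz_bound_nonneg by blast
    show ?case unfolding schwartz_bound_Suc
    proof (intro conjI ballI)
      show "schwartz_bound N 0 ((real (Suc n) + 1) * A) (\<lambda>x. of_real (x \<bullet> b) * f x)"
        using A Suc.prems schwartz_bound_mono
        by (intro schwartz_bound_mono[OF base, of _ _ 0]) (auto simp: schwartz_bound_Suc algebra_simps)
      fix c :: 'a assume c: "c \<in> Basis"
      have sf: "schwartz_bound (Suc N) n A (pd c f)" using Suc.prems c by (simp add: schwartz_bound_Suc)
      have 1: "schwartz_bound N n ((real n + 1) * A) (\<lambda>x. of_real (x \<bullet> b) * pd c f x)"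
        using Suc.IH[OF sf smooth_pd[OF Suc.prems(2) c]] .
      have "cmod (of_real (c \<bullet> b)) \<le> 1" using assms c by (auto simp: inner_Basis)
      then have "cmod (of_real (c \<bullet> b)) * A \<le> 1 * A" using A by (intro mult_right_mono) auto
      then have 2: "schwartz_bound N n A (\<lambda>x. of_real (c \<bullet> b) * f x)"
        by (intro schwartz_bound_mono[OF schwartz_bound_cmult[OF Suc.prems]]) auto
      show "schwartz_bound N n ((real (Suc n) + 1) * A) (pd c (\<lambda>x. of_real (x \<bullet> b) * f x))"
        unfolding pd_coord_mult[OF Suc.prems(2)]
        by (rule schwartz_bound_mono[OF schwartz_bound_add[OF 1 2]])
          (use Suc.prems smooth_pd c in \<open>auto intro!: smooth_mult smooth_coord smooth_const simp: algebra_simps\<close>)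
    qed
  }
qed

lemma finite_short_lists: "finite {bs \<in> lists (Basis :: 'a::euclidean_space set). length bs \<le> n}"
  using finite_lists_length_le[OF finite_Basis, of n] by (auto simp: lists_eq_set Collect_conj_eq Int_commute)

text \<open>There are only finitely many lists of basis vectors of bounded length, so the bounds for
  the individual derivatives combine into one.\<close>

lemma schwartz_iff: "f \<in> schwartz \<longleftrightarrow> smooth f \<and> (\<forall>N n. \<exists>A. schwartz_bound N n A f)"
proof
  assume f: "f \<in> schwartz"
  have "\<exists>A. schwartz_bound N n A f" for N n
  proof -
    have "\<exists>A. \<forall>x. (1 + norm x) ^ N * cmod (iter_partial bs f x) \<le> A" if "bs \<in> lists Basis" for bs
    proof -
      have "bounded (range (\<lambda>x. (1 + norm x) ^ N *\<^sub>R iter_partial bs f x))"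
        using f that by (simp add: schwartz_def)
      then obtain A where "\<And>x. norm ((1 + norm x) ^ N *\<^sub>R iter_partial bs f x) \<le> A"
        by (auto simp: bounded_iff)
      then show ?thesis by (auto simp: abs_of_nonneg)
    qed
    then obtain A where A: "\<And>bs x. bs \<in> lists Basis \<Longrightarrow> (1 + norm x) ^ N * cmod (iter_partial bs f x) \<le> A bs"
      by metis
    let ?L = "{bs \<in> lists (Basis :: 'a set). length bs \<le> n}"
    have "schwartz_bound N n (Max (A ` ?L)) f"
      unfolding schwartz_bound_def using finite_short_lists[of n]
      by (intro ballI impI allI order_trans[OF A] Max_ge finite_imageI imageI) auto
    then show ?thesis by blast
  qed
  then show "smooth f \<and> (\<forall>N n. \<exists>A. schwartz_bound N n A f)" using f by (simp add: schwartz_def)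
next
  assume f: "smooth f \<and> (\<forall>N n. \<exists>A. schwartz_bound N n A f)"
  have "bounded (range (\<lambda>x. (1 + norm x) ^ N *\<^sub>R iter_partial bs f x))" if "bs \<in> lists Basis" for N bs
  proof -
    obtain A where "schwartz_bound N (length bs) A f" using f by blast
    then show ?thesis using that unfolding schwartz_bound_def bounded_iff by (auto simp: abs_of_nonneg)
  qed
  then show "f \<in> schwartz" using f by (auto simp: schwartz_def)
qed

lemma schwartz_smooth: "f \<in> schwartz \<Longrightarrow> smooth f"
  by (simp add: schwartz_iff)

lemma schwartz_boundE:
  assumes "f \<in> schwartz" obtains A where "schwartz_bound N n A f"
  using assms by (auto simp: schwartz_iff)

lemma schwartz_bound_norm:
  assumes "f \<in> schwartz" shows "schwartz_bound N N (schwartz_norm N f) f"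
proof -
  obtain A where "schwartz_bound N N A f" using assms by (rule schwartz_boundE)
  then have "bdd_above ((\<lambda>(bs, x). (1 + norm x) ^ N * norm (iter_partial bs f x))
      ` ({bs \<in> lists Basis. length bs \<le> N} \<times> UNIV))"
    by (intro bdd_aboveI2[where M = A]) (auto simp: schwartz_bound_def)
  from cSUP_upper[OF _ this] show ?thesis
    unfolding schwartz_bound_def schwartz_norm_def by force
qed

lemma schwartz_norm_le: "schwartz_bound N N A f \<Longrightarrow> schwartz_norm N f \<le> A"
  unfolding schwartz_norm_def schwartz_bound_def
  by (intro cSUP_least) (auto intro: exI[of _ "[]"])

lemma schwartz_norm_nonneg: "f \<in> schwartz \<Longrightarrow> 0 \<le> schwartz_norm N f"
  using schwartz_bound_norm schwartz_bound_nonneg by blast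

lemma schwartz_norm_mono: "\<lbrakk>f \<in> schwartz; N \<le> M\<rbrakk> \<Longrightarrow> schwartz_norm N f \<le> schwartz_norm M f"
  using schwartz_norm_le[OF schwartz_bound_mono[OF schwartz_bound_norm[of f M]]] by simp

lemma schwartz_pd: "\<lbrakk>f \<in> schwartz; b \<in> Basis\<rbrakk> \<Longrightarrow> pd b f \<in> schwartz"
  unfolding schwartz_iff by (metis schwartz_bound_Suc smooth_pd)

lemma schwartz_add:
  assumes "f \<in> schwartz" "g \<in> schwartz"
  shows "(\<lambda>x. f x + g x) \<in> schwartz"
  unfolding schwartz_iff
proof (intro conjI allI)
  fix N n
  obtain A B where "schwartz_bound N n A f" "schwartz_bound N n B g"
    using assms schwartz_boundE by metis
  then show "\<exists>A. schwartz_bound N n A (\<lambda>x. f x + g x)"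
    using assms schwartz_bound_add schwartz_smooth by blast
qed (intro smooth_add schwartz_smooth assms)

lemma schwartz_mult:
  assumes "smooth f" "\<And>n. \<exists>A. schwartz_bound 0 n A f" "g \<in> schwartz"
  shows "(\<lambda>x. f x * g x) \<in> schwartz"
  unfolding schwartz_iff
proof (intro conjI allI)
  fix N n
  obtain A where "schwartz_bound 0 n A f" using assms by blast
  moreover obtain B where "schwartz_bound N n B g" using assms schwartz_boundE by metis
  ultimately show "\<exists>A. schwartz_bound N n A (\<lambda>x. f x * g x)"
    using assms schwartz_bound_mult schwartz_smooth by blast
qed (intro smooth_mult schwartz_smooth assms)

lemma schwartz_mult': "\<lbrakk>f \<in> schwartz; g \<in> schwartz\<rbrakk> \<Longrightarrow> (\<lambda>x. f x * g x) \<in> schwartz"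
  by (rule schwartz_mult) (auto simp: schwartz_iff)

lemma schwartz_cmult:
  assumes "f \<in> schwartz" shows "(\<lambda>x. c * f x) \<in> schwartz"
  unfolding schwartz_iff
proof (intro conjI allI)
  fix N n
  obtain A where "schwartz_bound N n A f" using assms schwartz_boundE by metis
  then show "\<exists>A. schwartz_bound N n A (\<lambda>x. c * f x)"
    using assms schwartz_bound_cmult schwartz_smooth by blast
qed (intro smooth_cmult schwartz_smooth assms)

lemma schwartz_coord_mult:
  assumes "f \<in> schwartz" "b \<in> Basis" shows "(\<lambda>x. of_real (x \<bullet> b) * f x) \<in> schwartz"
  unfolding schwartz_iff
proof (intro conjI allI)
  fix N n
  obtain A where "schwartz_bound (Suc N) n A f" using assms schwartz_boundE by metis
  then show "\<exists>A. schwartz_bound N n A (\<lambda>x. of_real (x \<bullet> b) * f x)"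
    using assms schwartz_bound_coord_mult schwartz_smooth by blast
qed (intro smooth_mult smooth_coord schwartz_smooth assms)

lemma schwartz_zero: "(\<lambda>x::'a::euclidean_space. 0) \<in> schwartz"
proof -
  have "schwartz_bound N n 0 (\<lambda>x::'a. 0)" for N n
  proof (induction n)
    case (Suc n)
    then show ?case by (simp add: schwartz_bound_Suc schwartz_bound_0 pd_eq[OF has_derivative_const])
  qed (simp add: schwartz_bound_0)
  then show ?thesis by (auto simp: schwartz_iff smooth_const)
qed

text \<open>The exterior of the ball is open, so the derivatives vanish there too. The induction
  over the order thus reduces everything to the boundedness of a continuous function on a compact
  ball.\<close>

lemma schwartz_compact_support:
  fixes f :: "'a::euclidean_space \<Rightarrow> complex"
  assumes "smooth f" "\<And>x. norm x > R \<Longrightarrow> f x = 0"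
  shows "f \<in> schwartz"
  unfolding schwartz_iff
proof (intro conjI allI)
  fix N n
  show "\<exists>A. schwartz_bound N n A f"
    using assms
  proof (induction n arbitrary: f)
    case (0 f)
    have "compact ((\<lambda>x. (1 + norm x) ^ N * cmod (f x)) ` cball 0 R)"
      by (intro compact_continuous_image continuous_intros smooth_continuous 0 compact_cball)
    then have "bounded ((\<lambda>x. (1 + norm x) ^ N * cmod (f x)) ` cball 0 R)" by (rule compact_imp_bounded)
    then obtain A where "\<forall>x\<in>cball 0 R. norm ((1 + norm x) ^ N * cmod (f x)) \<le> A"
      by (auto simp: bounded_iff)
    then have A: "(1 + norm x) ^ N * cmod (f x) \<le> A" if "norm x \<le> R" for x
      using that by (force simp: abs_mult)
    have "schwartz_bound N 0 (max A 0) f"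
      unfolding schwartz_bound_0
    proof
      fix x show "(1 + norm x) ^ N * cmod (f x) \<le> max A 0"
        using A[of x] 0(2)[of x] by (cases "norm x \<le> R") auto
    qed
    then show ?case by blast
  next
    case (Suc n f)
    have "pd b f x = 0" if "norm x > R" for x b
    proof (rule pd_eq)
      have "open {x. norm x > R}" by (intro open_Collect_less continuous_intros)
      with has_derivative_const show "(f has_derivative (\<lambda>_. 0)) (at x)"
        by (rule has_derivative_transform_within_open) (use that Suc.prems in auto)
    qed
    then have "\<forall>b\<in>Basis. \<exists>A. schwartz_bound N n A (pd b f)"
      using Suc smooth_pd by blast
    then obtain A where A: "\<And>b. b \<in> Basis \<Longrightarrow> schwartz_bound N n (A b) (pd b f)" by metis
    obtain A0 where A0: "schwartz_bound N n A0 f" using Suc by blast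
    define M where "M = Max (insert A0 (A ` Basis))"
    have "schwartz_bound N (Suc n) M f"
      unfolding schwartz_bound_Suc M_def
      by (intro conjI ballI schwartz_bound_mono[OF A0] schwartz_bound_mono[OF A] Max_ge) auto
    then show ?case by blast
  qed
qed (fact assms)

section \<open>Integrability from polynomial decay\<close>

definition weight :: "'a::euclidean_space \<Rightarrow> real" where
  "weight x = inverse ((1 + norm x) ^ (DIM('a) + 2))"

lemma weight_measurable [measurable]: "weight \<in> borel_measurable borel"
  unfolding weight_def by measurable

lemma weight_nonneg: "0 \<le> weight x"
  by (simp add: weight_def)

text \<open>Comparison with a layered majorant: if \<open>k\<close> is the integer part of
  \<open>norm x\<close>, the weight is at most (k+1)^(-d-2), and the ball of radius k+1 has volume
  of order (k+1)^d. The exponent d+2 in \<open>weight\<close> thus leaves the convergent series of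
  1/(k+1)^2.\<close>

lemma integrable_weight: "integrable lborel (weight :: 'a::euclidean_space \<Rightarrow> real)"
proof (rule integrableI_bounded)
  let ?d = "DIM('a)"
  let ?v = "unit_ball_vol (real ?d)"
  have bd: "ennreal (norm (weight x)) \<le>
      (\<Sum>k. ennreal (inverse (real (Suc k) ^ (?d + 2))) * indicator (ball 0 (real (Suc k))) x)" for x :: 'a
  proof -
    define k where "k = nat \<lfloor>norm x\<rfloor>"
    have k: "real k \<le> norm x" "norm x < real (Suc k)"
      using norm_ge_zero[of x] unfolding k_def by linarith+
    have "real (Suc k) ^ (?d + 2) \<le> (1 + norm x) ^ (?d + 2)" using k by (intro power_mono) auto
    then have "weight x \<le> inverse (real (Suc k) ^ (?d + 2))"
      unfolding weight_def by (rule le_imp_inverse_le) (simp del: of_nat_Suc)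
    then have "ennreal (norm (weight x)) \<le> ennreal (inverse (real (Suc k) ^ (?d + 2)))"
      unfolding real_norm_def abs_of_nonneg[OF weight_nonneg] by (rule ennreal_leI)
    also have "\<dots> = (\<Sum>i\<in>{k}. ennreal (inverse (real (Suc i) ^ (?d + 2))) * indicator (ball 0 (real (Suc i))) x)"
      using k by simp
    also have "\<dots> \<le> (\<Sum>i. ennreal (inverse (real (Suc i) ^ (?d + 2))) * indicator (ball 0 (real (Suc i))) x)"
      by (intro sum_le_suminf) auto
    finally show ?thesis .
  qed
  have "(\<integral>\<^sup>+x. ennreal (norm (weight (x::'a))) \<partial>lborel) \<le>
     (\<integral>\<^sup>+x. (\<Sum>k. ennreal (inverse (real (Suc k) ^ (?d + 2))) * indicator (ball (0::'a) (real (Suc k))) x) \<partial>lborel)"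
    by (intro nn_integral_mono bd)
  also have "\<dots> = (\<Sum>k. \<integral>\<^sup>+x. ennreal (inverse (real (Suc k) ^ (?d + 2))) * indicator (ball (0::'a) (real (Suc k))) x \<partial>lborel)"
    by (intro nn_integral_suminf borel_measurable_times_ennreal borel_measurable_const
      borel_measurable_indicator) auto
  also have "\<dots> = (\<Sum>k. ennreal (?v * inverse (real (Suc k) ^ 2)))"
  proof (intro suminf_cong)
    fix k
    have "(\<integral>\<^sup>+x. ennreal (inverse (real (Suc k) ^ (?d + 2))) * indicator (ball (0::'a) (real (Suc k))) x \<partial>lborel)
        = ennreal (inverse (real (Suc k) ^ (?d + 2))) * ennreal (?v * real (Suc k) ^ ?d)"
      by (subst nn_integral_cmult_indicator) (auto simp: emeasure_ball)
    also have "\<dots> = ennreal (inverse (real (Suc k) ^ (?d + 2)) * (?v * real (Suc k) ^ ?d))"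
      by (intro ennreal_mult[symmetric]) auto
    also have "inverse (real (Suc k) ^ (?d + 2)) * (?v * real (Suc k) ^ ?d) = ?v * inverse (real (Suc k) ^ 2)"
      unfolding power_add by (simp add: field_simps del: of_nat_Suc)
    finally show "(\<integral>\<^sup>+x. ennreal (inverse (real (Suc k) ^ (?d + 2))) * indicator (ball (0::'a) (real (Suc k))) x \<partial>lborel)
      = ennreal (?v * inverse (real (Suc k) ^ 2))" .
  qed
  also have "\<dots> = ennreal (\<Sum>k. ?v * inverse (real (Suc k) ^ 2))"
  proof (rule suminf_ennreal2)
    have "summable (\<lambda>n. inverse (real n ^ 2))" by (rule inverse_power_summable) simp
    then show "summable (\<lambda>k. ?v * inverse (real (Suc k) ^ 2))"
      by (intro summable_mult) (subst summable_Suc_iff)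
  qed auto
  also have "\<dots> < \<infinity>" by simp
  finally show "(\<integral>\<^sup>+x. ennreal (norm (weight (x::'a))) \<partial>lborel) < \<infinity>" .
qed simp

lemma weight_bound_iff:
  "(1 + norm (x::'a::euclidean_space)) ^ (DIM('a) + 2) * r \<le> A \<longleftrightarrow> r \<le> A * weight x"
proof -
  have "(1 + norm x) ^ (DIM('a) + 2) > 0" by (simp add: add_pos_nonneg)
  then show ?thesis unfolding weight_def by (simp add: field_simps)
qed

lemma weight_dominated:
  fixes f :: "'a::euclidean_space \<Rightarrow> complex"
  assumes [measurable]: "f \<in> borel_measurable borel"
    and bd: "\<And>x. cmod (f x) \<le> A * weight x"
  shows "integrable lborel f" "(LINT x|lborel. cmod (f x)) \<le> A * integral\<^sup>L lborel (weight :: 'a \<Rightarrow> real)"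
proof -
  have int: "integrable lborel (\<lambda>x::'a. A * weight x)" by (intro integrable_mult_right integrable_weight)
  show f: "integrable lborel f"
    by (rule Bochner_Integration.integrable_bound[OF int]) (auto intro!: AE_I2 order_trans[OF bd])
  have "(LINT x|lborel. cmod (f x)) \<le> (LINT x|lborel. A * weight (x::'a))"
    by (intro integral_mono integrable_norm f int bd)
  then show "(LINT x|lborel. cmod (f x)) \<le> A * integral\<^sup>L lborel (weight :: 'a \<Rightarrow> real)" by simp
qed

text \<open>\<open>M\<close> orders of decay compensate the growth of \<open>g\<close>, and the
  remaining d+2 produce the integrable \<open>weight\<close>.\<close>

lemma schwartz_mult_growth:
  fixes f g :: "'a::euclidean_space \<Rightarrow> complex"
  assumes [measurable]: "g \<in> borel_measurable borel"
    and g: "\<And>x. cmod (g x) \<le> B * (1 + norm x) ^ M"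
    and f: "smooth f" "schwartz_bound (M + DIM('a) + 2) 0 A f"
  shows "integrable lborel (\<lambda>x. g x * f x)"
    and "(LINT x|lborel. cmod (g x * f x)) \<le> B * A * integral\<^sup>L lborel (weight :: 'a \<Rightarrow> real)"
proof -
  have [measurable]: "f \<in> borel_measurable borel" by (rule smooth_measurable[OF f(1)])
  have "0 \<le> cmod (g 0)" by simp
  also have "\<dots> \<le> B" using g[of 0] by simp
  finally have "B \<ge> 0" .
  have *: "cmod (g x * f x) \<le> (B * A) * weight x" for x
  proof -
    have "(1 + norm x) ^ (DIM('a) + 2) * cmod (g x * f x)
        \<le> (1 + norm x) ^ (DIM('a) + 2) * (B * (1 + norm x) ^ M * cmod (f x))"
      unfolding norm_mult by (intro mult_left_mono mult_right_mono g) auto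
    also have "\<dots> = B * ((1 + norm x) ^ (M + DIM('a) + 2) * cmod (f x))" by (simp add: power_add mult_ac)
    also have "\<dots> \<le> B * A"
      using f(2) \<open>B \<ge> 0\<close> unfolding schwartz_bound_0 by (intro mult_left_mono) auto
    finally show ?thesis by (simp only: weight_bound_iff)
  qed
  show "integrable lborel (\<lambda>x. g x * f x)"
    "(LINT x|lborel. cmod (g x * f x)) \<le> B * A * integral\<^sup>L lborel (weight :: 'a \<Rightarrow> real)"
    by (rule weight_dominated[OF _ *]; measurable)+
qed

lemma schwartz_measurable [measurable_dest]: "f \<in> schwartz \<Longrightarrow> f \<in> borel_measurable borel"
  by (intro smooth_measurable schwartz_smooth)

lemma schwartz_integrable:
  fixes f :: "'a::euclidean_space \<Rightarrow> complex"
  assumes "f \<in> schwartz" shows "integrable lborel f"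
proof -
  obtain A where "schwartz_bound (0 + DIM('a) + 2) 0 A f" using schwartz_boundE[OF assms] by blast
  from schwartz_mult_growth(1)[OF _ _ schwartz_smooth[OF assms] this, of "\<lambda>_. 1" 1] show ?thesis by simp
qed


section \<open>The Fourier transform on the Schwartz space\<close>

lemma
  fixes f :: "'a::euclidean_space \<Rightarrow> 'b::{banach, second_countable_topology}" and t :: 'a
  assumes [measurable]: "f \<in> borel_measurable borel" and c: "c \<noteq> 0"
  shows lborel_integral_affine:
      "(LINT x|lborel. f x) = \<bar>c\<bar> ^ DIM('a) *\<^sub>R (LINT x|lborel. f (t + c *\<^sub>R x))"
    and lborel_integrable_affine_iff:
      "integrable lborel (\<lambda>x. f (t + c *\<^sub>R x)) \<longleftrightarrow> integrable lborel f"
proof -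
  have *: "lborel = density (distr lborel borel (\<lambda>x::'a. t + c *\<^sub>R x)) (\<lambda>_. ennreal (\<bar>c\<bar> ^ DIM('a)))"
    using lborel_affine[OF c, of t] by (simp add: ennreal_power)
  show "(LINT x|lborel. f x) = \<bar>c\<bar> ^ DIM('a) *\<^sub>R (LINT x|lborel. f (t + c *\<^sub>R x))"
    by (subst *) (simp add: integral_density integral_distr)
  have "integrable lborel f \<longleftrightarrow> integrable lborel (\<lambda>x. \<bar>c\<bar> ^ DIM('a) *\<^sub>R f (t + c *\<^sub>R x))"
    by (subst *) (simp add: integrable_density integrable_distr_eq)
  also have "\<dots> \<longleftrightarrow> integrable lborel (\<lambda>x. f (t + c *\<^sub>R x))"
  proof
    assume "integrable lborel (\<lambda>x. \<bar>c\<bar> ^ DIM('a) *\<^sub>R f (t + c *\<^sub>R x))"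
    from integrable_scaleR_right[OF this, of "inverse (\<bar>c\<bar> ^ DIM('a))"]
    show "integrable lborel (\<lambda>x. f (t + c *\<^sub>R x))" using c by simp
  qed simp
  finally show "integrable lborel (\<lambda>x. f (t + c *\<^sub>R x)) \<longleftrightarrow> integrable lborel f" ..
qed

lemma lborel_nn_integral_affine:
  fixes f :: "'a::euclidean_space \<Rightarrow> ennreal"
  assumes [measurable]: "f \<in> borel_measurable borel" and c: "c \<noteq> 0"
  shows "(\<integral>\<^sup>+x. f x \<partial>lborel) = ennreal (\<bar>c\<bar> ^ DIM('a)) * (\<integral>\<^sup>+x. f (t + c *\<^sub>R x) \<partial>lborel)"
proof -
  have *: "lborel = density (distr lborel borel (\<lambda>x::'a. t + c *\<^sub>R x)) (\<lambda>_. ennreal (\<bar>c\<bar> ^ DIM('a)))"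
    using lborel_affine[OF c, of t] by (simp add: ennreal_power)
  show ?thesis
    by (subst *) (simp add: nn_integral_density nn_integral_distr nn_integral_cmult)
qed

text \<open>The sign \<open>\<sigma> = \<plusminus>1\<close> lets the Fourier transform and its inverse share their theory.\<close>

definition ft :: "real \<Rightarrow> ('a::euclidean_space \<Rightarrow> complex) \<Rightarrow> 'a \<Rightarrow> complex" where
  "ft \<sigma> f \<xi> = (LINT x|lborel. cis (\<sigma> * (x \<bullet> \<xi>)) * f x)"

lemma fourier_eq_ft: "fourier f = ft (-1) f"
  by (simp add: fun_eq_iff fourier_def ft_def)

lemma inv_fourier_eq_ft:
  "inv_fourier f = (\<lambda>x::'a. ft 1 f x / of_real ((2 * pi) ^ DIM('a::euclidean_space)))"
  by (simp add: fun_eq_iff inv_fourier_def ft_def inner_commute)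

lemma ft_integrable:
  assumes "integrable lborel f"
  shows "integrable lborel (\<lambda>x. cis (\<sigma> * (x \<bullet> \<xi>)) * f x)"
proof (rule Bochner_Integration.integrable_bound[OF assms])
  have [measurable]: "f \<in> borel_measurable borel" using assms by auto
  have [measurable]: "(\<lambda>x. cis (\<sigma> * (x \<bullet> \<xi>))) \<in> borel_measurable borel"
    by (intro borel_measurable_continuous_onI continuous_intros)
  show "(\<lambda>x. cis (\<sigma> * (x \<bullet> \<xi>)) * f x) \<in> borel_measurable lborel" by simp
qed (simp add: norm_mult)

lemma ft_add:
  "\<lbrakk>integrable lborel f; integrable lborel g\<rbrakk> \<Longrightarrow> ft \<sigma> (\<lambda>x. f x + g x) \<xi> = ft \<sigma> f \<xi> + ft \<sigma> g \<xi>"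
  unfolding ft_def by (simp add: distrib_left ft_integrable)

lemma ft_cmult: "ft \<sigma> (\<lambda>x. c * f x) \<xi> = c * ft \<sigma> f \<xi>"
  unfolding ft_def by (simp add: mult.left_commute[of _ c])

lemma ft_norm_le: "cmod (ft \<sigma> f \<xi>) \<le> (LINT x|lborel. cmod (f x))"
  unfolding ft_def
  using integral_norm_bound[of lborel "\<lambda>x. cis (\<sigma> * (x \<bullet> \<xi>)) * f x"] by (simp add: norm_mult)

lemma cis_approx: "cmod (cis (a + h) - cis a - \<i> * of_real h * cis a) \<le> h\<^sup>2 / 2"
proof -
  have "cis (a + h) - cis a - \<i> * of_real h * cis a = cis a * (cis h - (1 + \<i> * of_real h))"
    by (simp add: cis_mult[symmetric] algebra_simps)
  moreover have "cmod (cis h - (1 + \<i> * of_real h)) \<le> h\<^sup>2 / 2"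
    using iexp_approx1[of h 1] by (simp add: cis_conv_exp power2_eq_square)
  ultimately show ?thesis by (simp add: norm_mult)
qed

text \<open>The exponential differs from its linearisation by at most half the square of the
  increment. Integrating this bound leaves the second absolute moment of \<open>f\<close> times the
  square of \<open>norm (y - \<xi>)\<close>, which is better than the little-o that a derivative
  asks for.\<close>

lemma ft_has_derivative:
  fixes f :: "'a::euclidean_space \<Rightarrow> complex"
  assumes f: "f \<in> schwartz"
  shows "(ft \<sigma> f has_derivative
     (\<lambda>h. \<Sum>b\<in>Basis. of_real (h \<bullet> b) * ft \<sigma> (\<lambda>x. \<i> * of_real \<sigma> * (of_real (x \<bullet> b) * f x)) \<xi>)) (at \<xi>)"
    (is "(_ has_derivative ?L) _")
proof (rule has_derivativeI)
  show "bounded_linear ?L"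
    by (intro bounded_linear_sum bounded_linear_mult_const bounded_linear_compose[OF bounded_linear_of_real]
      bounded_linear_inner_left)
  obtain A where A: "schwartz_bound (2 + DIM('a) + 2) 0 A f" using schwartz_boundE[OF f] by blast
  have "cmod (of_real ((norm x)\<^sup>2)) \<le> 1 * (1 + norm x) ^ 2" for x :: 'a
    unfolding norm_of_real by (simp add: power_mono)
  from schwartz_mult_growth(1)[OF _ this schwartz_smooth[OF f] A]
  have int2: "integrable lborel (\<lambda>x. complex_of_real ((norm x)\<^sup>2) * f x)" by simp
  define C where "C = (LINT x|lborel. cmod (complex_of_real ((norm x)\<^sup>2) * f x)) * \<sigma>\<^sup>2 / 2"
  have fi: "integrable lborel f" by (rule schwartz_integrable[OF f])
  have bi: "integrable lborel (\<lambda>x. \<i> * of_real \<sigma> * (of_real (x \<bullet> b) * f x))" if "b \<in> Basis" for b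
    using that f by (intro schwartz_integrable schwartz_cmult schwartz_coord_mult)
  have L: "?L h = (LINT x|lborel. cis (\<sigma> * (x \<bullet> \<xi>)) * (\<i> * of_real \<sigma> * of_real (x \<bullet> h) * f x))"
    and Li: "integrable lborel (\<lambda>x. cis (\<sigma> * (x \<bullet> \<xi>)) * (\<i> * of_real \<sigma> * of_real (x \<bullet> h) * f x))" for h
  proof -
    have eq: "cis (\<sigma> * (x \<bullet> \<xi>)) * (\<i> * of_real \<sigma> * of_real (x \<bullet> h) * f x)
       = (\<Sum>b\<in>Basis. of_real (h \<bullet> b) * (cis (\<sigma> * (x \<bullet> \<xi>)) * (\<i> * of_real \<sigma> * (of_real (x \<bullet> b) * f x))))" for x
      unfolding euclidean_inner[of x h] by (simp add: sum_distrib_left sum_distrib_right mult_ac)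
    show "?L h = (LINT x|lborel. cis (\<sigma> * (x \<bullet> \<xi>)) * (\<i> * of_real \<sigma> * of_real (x \<bullet> h) * f x))"
      unfolding eq ft_def
      by (subst Bochner_Integration.integral_sum) (auto intro!: sum.cong integrable_mult_right ft_integrable bi)
    show "integrable lborel (\<lambda>x. cis (\<sigma> * (x \<bullet> \<xi>)) * (\<i> * of_real \<sigma> * of_real (x \<bullet> h) * f x))"
      unfolding eq by (intro Bochner_Integration.integrable_sum integrable_mult_right ft_integrable bi)
  qed
  have bound: "norm (ft \<sigma> f y - ft \<sigma> f \<xi> - ?L (y - \<xi>)) \<le> C * (norm (y - \<xi>))\<^sup>2" for y
  proof -
    let ?G = "\<lambda>x. cis (\<sigma> * (x \<bullet> y)) * f x - cis (\<sigma> * (x \<bullet> \<xi>)) * f x -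
        cis (\<sigma> * (x \<bullet> \<xi>)) * (\<i> * of_real \<sigma> * of_real (x \<bullet> (y - \<xi>)) * f x)"
    have Gi: "integrable lborel ?G"
      by (intro Bochner_Integration.integrable_diff ft_integrable fi Li)
    have "norm (ft \<sigma> f y - ft \<sigma> f \<xi> - ?L (y - \<xi>)) = cmod (LINT x|lborel. ?G x)"
      unfolding L unfolding ft_def
      by (subst Bochner_Integration.integral_diff[OF Bochner_Integration.integrable_diff[OF
            ft_integrable[OF fi] ft_integrable[OF fi]] Li],
          subst Bochner_Integration.integral_diff[OF ft_integrable[OF fi] ft_integrable[OF fi]], rule refl)
    also have "\<dots> \<le> (LINT x|lborel. cmod (?G x))" by (rule integral_norm_bound)
    also have "\<dots> \<le> (LINT x|lborel. (\<sigma>\<^sup>2 / 2 * (norm (y - \<xi>))\<^sup>2) * cmod (complex_of_real ((norm x)\<^sup>2) * f x))"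
    proof (intro integral_mono integrable_norm Gi integrable_mult_right int2)
      fix x
      have "?G x = (cis (\<sigma> * (x \<bullet> \<xi>) + \<sigma> * (x \<bullet> (y - \<xi>))) - cis (\<sigma> * (x \<bullet> \<xi>))
          - \<i> * of_real (\<sigma> * (x \<bullet> (y - \<xi>))) * cis (\<sigma> * (x \<bullet> \<xi>))) * f x"
        by (simp add: algebra_simps inner_diff_right)
      then have "cmod (?G x) \<le> (\<sigma> * (x \<bullet> (y - \<xi>)))\<^sup>2 / 2 * cmod (f x)"
        by (simp only: norm_mult[of _ "f x"]) (intro mult_right_mono cis_approx norm_ge_zero)
      also have "\<dots> \<le> (\<bar>\<sigma>\<bar> * (norm x * norm (y - \<xi>)))\<^sup>2 / 2 * cmod (f x)"
        using Cauchy_Schwarz_ineq2[of x "y - \<xi>"]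
        by (intro mult_right_mono divide_right_mono power2_le_iff_abs_le[THEN iffD2])
          (auto simp: abs_mult mult_left_mono)
      finally show "cmod (?G x) \<le> (\<sigma>\<^sup>2 / 2 * (norm (y - \<xi>))\<^sup>2) * cmod (complex_of_real ((norm x)\<^sup>2) * f x)"
        by (simp add: norm_mult norm_power power_mult_distrib mult_ac del: of_real_power)
    qed
    also have "\<dots> = C * (norm (y - \<xi>))\<^sup>2" by (simp add: C_def)
    finally show ?thesis .
  qed
  have C: "C \<ge> 0" unfolding C_def by simp
  show "((\<lambda>y. (ft \<sigma> f y - ft \<sigma> f \<xi> - ?L (y - \<xi>)) /\<^sub>R norm (y - \<xi>)) \<longlongrightarrow> 0) (at \<xi>)"
  proof (rule Lim_null_comparison)
    show "\<forall>\<^sub>F y in at \<xi>. norm ((ft \<sigma> f y - ft \<sigma> f \<xi> - ?L (y - \<xi>)) /\<^sub>R norm (y - \<xi>)) \<le> C * norm (y - \<xi>)"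
    proof (intro always_eventually allI)
      fix y
      show "norm ((ft \<sigma> f y - ft \<sigma> f \<xi> - ?L (y - \<xi>)) /\<^sub>R norm (y - \<xi>)) \<le> C * norm (y - \<xi>)"
        using bound[of y] C
        by (cases "y = \<xi>") (auto simp: divide_simps power2_eq_square mult_ac)
    qed
    have "((\<lambda>y. C * norm (y - \<xi>)) \<longlongrightarrow> C * norm (\<xi> - \<xi>)) (at \<xi>)" by (intro tendsto_intros)
    then show "((\<lambda>y. C * norm (y - \<xi>)) \<longlongrightarrow> 0) (at \<xi>)" by simp
  qed
qed

lemma pd_ft:
  assumes "f \<in> schwartz" "b \<in> Basis"
  shows "pd b (ft \<sigma> f) = ft \<sigma> (\<lambda>x. \<i> * of_real \<sigma> * (of_real (x \<bullet> b) * f x))"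
proof
  fix \<xi>
  have "pd b (ft \<sigma> f) \<xi> = (\<Sum>c\<in>Basis. of_real (b \<bullet> c) * ft \<sigma> (\<lambda>x. \<i> * of_real \<sigma> * (of_real (x \<bullet> c) * f x)) \<xi>)"
    by (rule pd_eq[OF ft_has_derivative[OF assms(1)]])
  also have "\<dots> = (\<Sum>c\<in>Basis. if c = b then ft \<sigma> (\<lambda>x. \<i> * of_real \<sigma> * (of_real (x \<bullet> c) * f x)) \<xi> else 0)"
    using assms by (intro sum.cong) (auto simp: inner_Basis)
  finally show "pd b (ft \<sigma> f) \<xi> = ft \<sigma> (\<lambda>x. \<i> * of_real \<sigma> * (of_real (x \<bullet> b) * f x)) \<xi>"
    using assms by simp
qed

lemma smooth_ft:
  fixes f :: "'a::euclidean_space \<Rightarrow> complex"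
  assumes "f \<in> schwartz" shows "smooth (ft \<sigma> f)"
proof (rule smooth_coinduct[where X = "ft \<sigma> ` schwartz"])
  fix g :: "'a \<Rightarrow> complex" assume "g \<in> ft \<sigma> ` schwartz"
  then obtain f where f: "f \<in> schwartz" "g = ft \<sigma> f" by blast
  show "g differentiable (at x)" for x using ft_has_derivative[OF f(1)] f(2) differentiable_def by blast
  fix b :: 'a assume "b \<in> Basis"
  then show "pd b g \<in> sum_closure (ft \<sigma> ` schwartz)"
    using f by (auto simp: pd_ft intro!: sum_closure.base imageI schwartz_cmult schwartz_coord_mult)
qed (use assms in \<open>auto intro: sum_closure.base\<close>)

text \<open>By translation invariance the integral of the difference quotients vanishes.\<close>

lemma integral_pd_zero:
  fixes f :: "'a::euclidean_space \<Rightarrow> complex"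
  assumes f: "integrable lborel f" and diff: "\<And>x. f differentiable (at x)" and b: "b \<in> Basis"
    and [measurable]: "pd b f \<in> borel_measurable borel"
    and bd: "\<And>x. cmod (pd b f x) \<le> A * weight x"
  shows "(LINT x|lborel. pd b f x) = 0"
proof -
  have [measurable]: "f \<in> borel_measurable borel" using f by auto
  define q where "q n x = real (Suc n) *\<^sub>R (f (x + inverse (real (Suc n)) *\<^sub>R b) - f x)" for n x
  have A: "A \<ge> 0"
    using bd[of 0] order_trans[OF norm_ge_zero] by (fastforce simp: weight_def zero_le_mult_iff)
  have line: "((\<lambda>t. f (x + t *\<^sub>R b)) has_vector_derivative pd b f (x + t *\<^sub>R b)) (at t within S)" for x t S
  proof -
    let ?F = "frechet_derivative f (at (x + t *\<^sub>R b))"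
    have F: "(f has_derivative ?F) (at (x + t *\<^sub>R b))" using diff by (simp add: frechet_derivative_works)
    then interpret bounded_linear ?F by (rule has_derivative_bounded_linear)
    have "((\<lambda>t. f (x + t *\<^sub>R b)) has_derivative (\<lambda>h. ?F (h *\<^sub>R b))) (at t within S)"
      by (rule has_derivative_compose[of "\<lambda>t. x + t *\<^sub>R b", OF _ F]) (auto intro!: derivative_eq_intros)
    then show ?thesis by (simp add: has_vector_derivative_def scaleR)
  qed
  have q0: "(LINT x|lborel. q n x) = 0" for n
  proof -
    have i: "integrable lborel (\<lambda>x. f (inverse (real (Suc n)) *\<^sub>R b + 1 *\<^sub>R x))"
      using f by (subst lborel_integrable_affine_iff) auto
    have "(LINT x|lborel. f (inverse (real (Suc n)) *\<^sub>R b + 1 *\<^sub>R x)) = (LINT x|lborel. f x)"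
      by (subst (2) lborel_integral_affine[of _ 1 "inverse (real (Suc n)) *\<^sub>R b"]) auto
    then show ?thesis unfolding q_def using i f by (simp add: add.commute)
  qed
  have "(\<lambda>n. LINT x|lborel. q n x) \<longlonglongrightarrow> (LINT x|lborel. pd b f x)"
  proof (rule integral_dominated_convergence)
    show "pd b f \<in> borel_measurable lborel" by simp
    show "q n \<in> borel_measurable lborel" for n unfolding q_def by measurable
    show "integrable lborel (\<lambda>x::'a. (A * 2 ^ (DIM('a) + 2)) * weight x)"
      by (intro integrable_mult_right integrable_weight)
    show "AE x in lborel. (\<lambda>n. q n x) \<longlonglongrightarrow> pd b f x"
    proof (rule AE_I2)
      fix x
      have "((\<lambda>t. norm ((f (x + t *\<^sub>R b) - f x - t *\<^sub>R pd b f x) /\<^sub>R \<bar>t\<bar>)) \<longlongrightarrow> 0) (at 0)"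
        using line[of x 0 UNIV]
        by (intro tendsto_norm_zero) (simp add: has_vector_derivative_def has_derivative_at_within)
      moreover have "\<forall>\<^sub>F t in at 0. norm ((f (x + t *\<^sub>R b) - f x - t *\<^sub>R pd b f x) /\<^sub>R \<bar>t\<bar>)
          = norm ((f (x + t *\<^sub>R b) - f x) /\<^sub>R t - pd b f x)"
      proof (rule eventually_mono[OF eventually_neq_at_within[of 0]])
        fix t :: real assume "t \<noteq> 0"
        then have "(f (x + t *\<^sub>R b) - f x) /\<^sub>R t - pd b f x = (f (x + t *\<^sub>R b) - f x - t *\<^sub>R pd b f x) /\<^sub>R t"
          by (simp add: scaleR_diff_right)
        then show "norm ((f (x + t *\<^sub>R b) - f x - t *\<^sub>R pd b f x) /\<^sub>R \<bar>t\<bar>)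
          = norm ((f (x + t *\<^sub>R b) - f x) /\<^sub>R t - pd b f x)" by simp
      qed
      ultimately have "((\<lambda>t. norm ((f (x + t *\<^sub>R b) - f x) /\<^sub>R t - pd b f x)) \<longlongrightarrow> 0) (at 0)"
        by (rule Lim_transform_eventually)
      then have "((\<lambda>t. (f (x + t *\<^sub>R b) - f x) /\<^sub>R t) \<longlongrightarrow> pd b f x) (at 0)"
        by (metis tendsto_norm_zero_iff LIM_zero_iff)
      moreover have "filterlim (\<lambda>n. inverse (real (Suc n))) (at 0) sequentially"
        unfolding filterlim_at using LIMSEQ_inverse_real_of_nat by auto
      ultimately have "(\<lambda>n. (f (x + inverse (real (Suc n)) *\<^sub>R b) - f x) /\<^sub>R inverse (real (Suc n)))
          \<longlonglongrightarrow> pd b f x" by (rule filterlim_compose)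
      then show "(\<lambda>n. q n x) \<longlonglongrightarrow> pd b f x"
        unfolding q_def by simp
    qed
    \<comment> \<open>Points at distance at most 1 have comparable weights, with the factor 2^(d+2).
      The mean value inequality along the segment therefore bounds all difference quotients by one
      integrable function.\<close>
    show "AE x in lborel. norm (q n x) \<le> (A * 2 ^ (DIM('a) + 2)) * weight x" for n
    proof (rule AE_I2)
      fix x
      let ?t = "inverse (real (Suc n))"
      have pb: "cmod (pd b f (x + t *\<^sub>R b)) \<le> (A * 2 ^ (DIM('a) + 2)) * weight x" if t: "t \<in> {0..?t}" for t
      proof -
        have "norm (t *\<^sub>R b) \<le> 1" using t b inverse_le_1_iff[of "real (Suc n)"] by (auto intro: order_trans)
        then have "1 + norm x \<le> 2 * (1 + norm (x + t *\<^sub>R b))"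
          using norm_triangle_ineq4[of "x + t *\<^sub>R b" "t *\<^sub>R b"] norm_ge_zero[of "x + t *\<^sub>R b"]
          by (simp del: norm_ge_zero)
        then have "(1 + norm x) ^ (DIM('a) + 2) \<le> (2 * (1 + norm (x + t *\<^sub>R b))) ^ (DIM('a) + 2)"
          by (intro power_mono) auto
        then have "weight (x + t *\<^sub>R b) \<le> 2 ^ (DIM('a) + 2) * weight x"
          unfolding weight_def power_mult_distrib
          by (subst (asm) mult.commute) (simp add: field_simps add_pos_nonneg del: power_add power_Suc)
        then have "A * weight (x + t *\<^sub>R b) \<le> A * (2 ^ (DIM('a) + 2) * weight x)"
          using A by (intro mult_left_mono) auto
        then show ?thesis using bd[of "x + t *\<^sub>R b"] by (simp add: mult_ac)
      qed
      have "norm (f (x + ?t *\<^sub>R b) - f (x + 0 *\<^sub>R b)) \<le> (A * 2 ^ (DIM('a) + 2)) * weight x * norm (?t - 0)"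
        using weight_nonneg[of x] pb A
        by (intro differentiable_bound[where S = "{0..?t}" and f = "\<lambda>t. f (x + t *\<^sub>R b)",
              OF _ line[unfolded has_vector_derivative_def]] onorm_le)
          (auto simp: mult.commute[of _ "\<bar>_\<bar>"] intro!: mult_left_mono)
      then show "norm (q n x) \<le> (A * 2 ^ (DIM('a) + 2)) * weight x"
        unfolding q_def norm_scaleR by (simp add: field_simps del: power_Suc)
    qed
  qed
  then show ?thesis using q0 LIMSEQ_unique[OF _ tendsto_const] by simp
qed

lemma cis_has_derivative:
  "((\<lambda>x. cis (\<sigma> * (x \<bullet> \<xi>))) has_derivative
      (\<lambda>h. \<i> * of_real (\<sigma> * (h \<bullet> \<xi>)) * cis (\<sigma> * (x \<bullet> \<xi>)))) (at x)"
proof -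
  have 1: "((\<lambda>x. \<i> * complex_of_real (\<sigma> * (x \<bullet> \<xi>))) has_derivative
      (\<lambda>h. \<i> * of_real (\<sigma> * (h \<bullet> \<xi>)))) (at x)"
    by (auto intro!: derivative_eq_intros)
  have 2: "(exp has_derivative (\<lambda>h. h * exp z)) (at z)" for z :: complex
  proof -
    have "(*) (exp z) = (\<lambda>h. h * exp z)" by (simp add: fun_eq_iff)
    then show ?thesis using DERIV_exp[of z] by (simp only: has_field_derivative_def)
  qed
  from has_derivative_compose[OF 1 2] show ?thesis by (simp add: cis_conv_exp)
qed

text \<open>Integration by parts in the form that the derivative of the product of the exponential
  and \<open>f\<close> has integral zero.\<close>

lemma ft_pd:
  fixes f :: "'a::euclidean_space \<Rightarrow> complex"
  assumes f: "f \<in> schwartz" and b: "b \<in> Basis"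
  shows "ft \<sigma> (pd b f) \<xi> = - (\<i> * of_real \<sigma> * of_real (\<xi> \<bullet> b) * ft \<sigma> f \<xi>)"
proof -
  let ?e = "\<lambda>x. cis (\<sigma> * (x \<bullet> \<xi>))"
  let ?c = "\<i> * complex_of_real \<sigma> * of_real (\<xi> \<bullet> b)"
  note pf = schwartz_pd[OF f b]
  have diff: "?e differentiable (at x)" for x using cis_has_derivative differentiable_def by blast
  have fd: "f differentiable (at x)" for x by (intro smooth_differentiable schwartz_smooth f)
  have pe: "pd b ?e x = ?c * ?e x" for x
    using pd_eq[OF cis_has_derivative, of \<sigma> \<xi> x b] by (simp add: inner_commute mult_ac)
  have eq: "pd b (\<lambda>x. ?e x * f x) x = ?e x * pd b f x + ?c * (?e x * f x)" for x
    using pd_mult[OF diff fd, of x b] pe by (simp add: mult_ac)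
  obtain A where A: "schwartz_bound (DIM('a) + 2) 0 A f" using schwartz_boundE[OF f] by blast
  obtain B where B: "schwartz_bound (DIM('a) + 2) 0 B (pd b f)" using schwartz_boundE[OF pf] by blast
  have [measurable]: "f \<in> borel_measurable borel" "pd b f \<in> borel_measurable borel"
    using schwartz_measurable f pf by blast+
  have [measurable]: "?e \<in> borel_measurable borel"
    by (intro borel_measurable_continuous_onI continuous_intros)
  have "(LINT x|lborel. pd b (\<lambda>x. ?e x * f x) x) = 0"
  proof (rule integral_pd_zero[OF _ _ b])
    show "integrable lborel (\<lambda>x. ?e x * f x)" by (intro ft_integrable schwartz_integrable f)
    show "(\<lambda>x. ?e x * f x) differentiable (at x)" for x by (intro differentiable_mult diff fd)
    show "pd b (\<lambda>x. ?e x * f x) \<in> borel_measurable borel" unfolding eq by measurable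
    fix x
    have "cmod (f x) \<le> A * weight x" "cmod (pd b f x) \<le> B * weight x"
      using A B unfolding schwartz_bound_0 weight_bound_iff by blast+
    then have "cmod (pd b f x) + cmod ?c * cmod (f x) \<le> B * weight x + cmod ?c * (A * weight x)"
      by (intro add_mono mult_left_mono) auto
    moreover have "cmod (pd b (\<lambda>x. ?e x * f x) x) \<le> cmod (pd b f x) + cmod ?c * cmod (f x)"
      unfolding eq by (rule order_trans[OF norm_triangle_ineq]) (simp add: norm_mult)
    ultimately show "cmod (pd b (\<lambda>x. ?e x * f x) x) \<le> (B + cmod ?c * A) * weight x"
      by (simp add: algebra_simps)
  qed
  then have "ft \<sigma> (pd b f) \<xi> + ?c * ft \<sigma> f \<xi> = 0"
    unfolding eq ft_def
    by (subst (asm) Bochner_Integration.integral_add[OF ft_integrable[OF schwartz_integrable[OF pf]]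
          integrable_mult_right[OF ft_integrable[OF schwartz_integrable[OF f]]]]) simp
  then show ?thesis by (simp add: add_eq_0_iff2)
qed

text \<open>This simultaneously shows that the transform preserves the Schwartz space and that it is
  continuous there.\<close>

lemma schwartz_bound_ft:
  "\<exists>C M. \<forall>f A. f \<in> schwartz \<longrightarrow> schwartz_bound M M A f \<longrightarrow>
     schwartz_bound N n (C * A) (ft \<sigma> (f :: 'a::euclidean_space \<Rightarrow> complex))"
  if \<sigma>: "\<bar>\<sigma>\<bar> = 1"
proof (induction n)
  case 0
  show ?case
  proof (induction N)
    case 0
    let ?I = "integral\<^sup>L lborel (weight :: 'a \<Rightarrow> real)"
    have "schwartz_bound 0 0 (?I * A) (ft \<sigma> f)"
      if f: "f \<in> schwartz" and A: "schwartz_bound (DIM('a) + 2) (DIM('a) + 2) A f" for f :: "'a \<Rightarrow> complex" and A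
    proof -
      have "schwartz_bound (DIM('a) + 2) 0 A f" by (rule schwartz_bound_mono[OF A]) auto
      then have "(LINT x|lborel. cmod (f x)) \<le> A * ?I"
        using f by (intro weight_dominated) (auto simp: schwartz_measurable schwartz_bound_0 weight_bound_iff[symmetric])
      then show ?thesis
        unfolding schwartz_bound_0 by (auto simp: mult.commute intro: order_trans[OF ft_norm_le])
    qed
    then show ?case by blast
  next
    case (Suc N)
    then obtain C M where CM: "\<And>f A. \<lbrakk>(f :: 'a \<Rightarrow> complex) \<in> schwartz; schwartz_bound M M A f\<rbrakk>
      \<Longrightarrow> schwartz_bound N 0 (C * A) (ft \<sigma> f)" by blast
    have "schwartz_bound (Suc N) 0 ((C + DIM('a) * C) * A) (ft \<sigma> f)"
      if f: "f \<in> schwartz" and A: "schwartz_bound (Suc M) (Suc M) A f" for f :: "'a \<Rightarrow> complex" and A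
      unfolding schwartz_bound_0
    proof
      fix \<xi> :: 'a
      let ?w = "(1 + norm \<xi>) ^ N"
      have 1: "?w * cmod (ft \<sigma> f \<xi>) \<le> C * A"
        using CM[OF f schwartz_bound_mono[OF A]] unfolding schwartz_bound_0 by simp
      have 2: "?w * (\<bar>\<xi> \<bullet> b\<bar> * cmod (ft \<sigma> f \<xi>)) \<le> C * A" if b: "b \<in> Basis" for b
      proof -
        have "schwartz_bound (Suc M) M A (pd b f)" using A b by (simp add: schwartz_bound_Suc)
        then have "schwartz_bound M M A (pd b f)" by (rule schwartz_bound_mono) auto
        then have "?w * cmod (ft \<sigma> (pd b f) \<xi>) \<le> C * A"
          using CM[OF schwartz_pd[OF f b]] unfolding schwartz_bound_0 by blast
        then show ?thesis using \<sigma> by (simp add: ft_pd[OF f b] norm_mult)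
      qed
      \<comment> \<open>The additional factor \<open>1 + norm \<xi>\<close> is traded for the
        coordinates of \<open>\<xi>\<close>, and each coordinate for one derivative of
        \<open>f\<close>.\<close>
      have "(1 + norm \<xi>) ^ Suc N * cmod (ft \<sigma> f \<xi>)
          \<le> ?w * (1 + (\<Sum>b\<in>Basis. \<bar>\<xi> \<bullet> b\<bar>)) * cmod (ft \<sigma> f \<xi>)"
        using norm_le_l1[of \<xi>] unfolding power_Suc2 by (intro mult_right_mono mult_left_mono) auto
      also have "\<dots> = ?w * cmod (ft \<sigma> f \<xi>) + (\<Sum>b\<in>Basis. ?w * (\<bar>\<xi> \<bullet> b\<bar> * cmod (ft \<sigma> f \<xi>)))"
        by (simp add: algebra_simps sum_distrib_left sum_distrib_right)
      also have "\<dots> \<le> C * A + (\<Sum>b\<in>(Basis::'a set). C * A)" by (intro add_mono sum_mono 1 2)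
      finally show "(1 + norm \<xi>) ^ Suc N * cmod (ft \<sigma> f \<xi>) \<le> (C + DIM('a) * C) * A"
        by (simp add: algebra_simps)
    qed
    then show ?case by blast
  qed
next
  case (Suc n)
  obtain C0 M0 where C0: "\<And>f A. \<lbrakk>(f :: 'a \<Rightarrow> complex) \<in> schwartz; schwartz_bound M0 M0 A f\<rbrakk>
      \<Longrightarrow> schwartz_bound N n (C0 * A) (ft \<sigma> f)" using Suc by blast
  \<comment> \<open>A derivative of the transform is the transform of a coordinate multiple of
    \<open>f\<close>. The multiplication costs one order of decay and the factor
    \<open>M0 + 1\<close>; the absolute value in \<open>C\<close> is there because nothing is known
    about the sign of \<open>C0\<close>.\<close>
  define M where "M = Suc M0"
  define C where "C = \<bar>C0\<bar> * (real M0 + 1)"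
  have "schwartz_bound N (Suc n) (C * A) (ft \<sigma> f)"
    if f: "f \<in> schwartz" and A: "schwartz_bound M M A f" for f :: "'a \<Rightarrow> complex" and A
    unfolding schwartz_bound_Suc
  proof (intro conjI ballI)
    have A0: "A \<ge> 0" using A by (rule schwartz_bound_nonneg)
    have "C0 * A \<le> \<bar>C0\<bar> * A" using A0 by (intro mult_right_mono) auto
    also have "\<dots> \<le> C * A" unfolding C_def using A0 by (intro mult_right_mono) (auto simp: algebra_simps)
    finally have le: "C0 * A \<le> C * A" .
    show "schwartz_bound N 0 (C * A) (ft \<sigma> f)"
      by (rule schwartz_bound_mono[OF C0[OF f schwartz_bound_mono[OF A]] _ _ le]) (auto simp: M_def)
    fix b :: 'a assume b: "b \<in> Basis"
    have "schwartz_bound M0 M0 ((real M0 + 1) * A) (\<lambda>x. of_real (x \<bullet> b) * f x)"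
      by (rule schwartz_bound_coord_mult[OF b schwartz_bound_mono[OF A] schwartz_smooth[OF f]])
        (auto simp: M_def)
    from schwartz_bound_cmult[OF this, of "\<i> * of_real \<sigma>"] f b
    have "schwartz_bound M0 M0 ((real M0 + 1) * A) (\<lambda>x. \<i> * of_real \<sigma> * (of_real (x \<bullet> b) * f x))"
      using \<sigma> by (simp add: norm_mult schwartz_smooth schwartz_coord_mult)
    from C0[OF schwartz_cmult[OF schwartz_coord_mult[OF f b]] this]
    have "schwartz_bound N n (C0 * ((real M0 + 1) * A)) (pd b (ft \<sigma> f))"
      by (simp add: pd_ft[OF f b])
    then show "schwartz_bound N n (C * A) (pd b (ft \<sigma> f))"
    proof (rule schwartz_bound_mono)
      have "C0 * ((real M0 + 1) * A) \<le> \<bar>C0\<bar> * ((real M0 + 1) * A)" using A0 by (intro mult_right_mono) auto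
      then show "C0 * ((real M0 + 1) * A) \<le> C * A" by (simp add: C_def mult.assoc)
    qed auto
  qed
  then show ?case by blast
qed

lemma schwartz_ft:
  fixes f :: "'a::euclidean_space \<Rightarrow> complex"
  assumes f: "f \<in> schwartz" and \<sigma>: "\<bar>\<sigma>\<bar> = 1"
  shows "ft \<sigma> f \<in> schwartz"
  unfolding schwartz_iff
proof (intro conjI allI smooth_ft f)
  fix N n
  obtain C M where CM: "\<And>A. schwartz_bound M M A f \<Longrightarrow> schwartz_bound N n (C * A) (ft \<sigma> f)"
    using schwartz_bound_ft[OF \<sigma>, where 'a = 'a and N = N and n = n] f by blast
  obtain A where "schwartz_bound M M A f" using schwartz_boundE[OF f] by blast
  then show "\<exists>A. schwartz_bound N n A (ft \<sigma> f)" using CM by blast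
qed


section \<open>Fourier inversion\<close>

text \<open>The multiplication formula: both sides are iterated integrals of the same kernel, which
  is symmetric in the two variables apart from \<open>f\<close> and \<open>g\<close>.\<close>

lemma ft_pair:
  fixes f g :: "'a::euclidean_space \<Rightarrow> complex"
  assumes f: "integrable lborel f" and g: "integrable lborel g"
  shows "(LINT \<xi>|lborel. ft \<sigma> f \<xi> * g \<xi>) = (LINT x|lborel. f x * ft \<sigma> g x)"
proof -
  let ?F = "\<lambda>x \<xi>. cis (\<sigma> * (x \<bullet> \<xi>)) * f x * g \<xi>"
  have [measurable]: "f \<in> borel_measurable borel" "g \<in> borel_measurable borel" using f g by auto
  have "(\<lambda>(x::'a, \<xi>::'a). cis (\<sigma> * (x \<bullet> \<xi>))) \<in> borel_measurable borel"
    unfolding split_beta by (intro borel_measurable_continuous_onI continuous_intros)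
  then have [measurable]: "(\<lambda>(x::'a, \<xi>::'a). cis (\<sigma> * (x \<bullet> \<xi>))) \<in> borel_measurable (lborel \<Otimes>\<^sub>M lborel)"
    unfolding lborel_prod by simp
  have "integrable (lborel \<Otimes>\<^sub>M lborel) (case_prod ?F)"
  proof (rule lborel_pair.Fubini_integrable)
    show "case_prod ?F \<in> borel_measurable (lborel \<Otimes>\<^sub>M lborel)"
      unfolding split_beta by measurable
    have "integrable lborel (\<lambda>x. cmod (f x) * (LINT y|lborel. cmod (g y)))"
      using f by (intro integrable_mult_left integrable_norm)
    then show "integrable lborel (\<lambda>x. LINT y|lborel. norm (case_prod ?F (x, y)))"
      by (simp add: norm_mult)
    show "AE x in lborel. integrable lborel (\<lambda>y. case_prod ?F (x, y))"
      using ft_integrable[OF g, of \<sigma>]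
      by (intro AE_I2) (simp add: mult.commute[of _ "f _"] mult.assoc inner_commute integrable_mult_right)
  qed
  from lborel_pair.Fubini_integral[OF this]
  have "(LINT \<xi>|lborel. LINT x|lborel. ?F x \<xi>) = (LINT x|lborel. LINT \<xi>|lborel. ?F x \<xi>)" .
  moreover have "(LINT x|lborel. ?F x \<xi>) = ft \<sigma> f \<xi> * g \<xi>" for \<xi>
    by (simp add: ft_def)
  moreover have "(LINT \<xi>|lborel. ?F x \<xi>) = f x * ft \<sigma> g x" for x
    by (simp add: ft_def mult.commute[of _ "f x"] mult.assoc inner_commute)
  ultimately show ?thesis by (simp only:)
qed

text \<open>Lebesgue measure is the image of the product of one-dimensional Lebesgue measures
  indexed by the basis, and there a product of functions of separate variables integrates factor by
  factor.\<close>

lemma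
  fixes h :: "'a::euclidean_space \<Rightarrow> real \<Rightarrow> complex"
  assumes h: "\<And>b. b \<in> Basis \<Longrightarrow> integrable lborel (h b)"
  shows lborel_integral_prod_Basis:
      "(LINT x|lborel. (\<Prod>b\<in>Basis. h b (x \<bullet> b))) = (\<Prod>b\<in>Basis. LINT t|lborel. h b t)"
    and lborel_integrable_prod_Basis: "integrable lborel (\<lambda>x. \<Prod>b\<in>Basis. h b (x \<bullet> b))"
proof -
  interpret product_sigma_finite "\<lambda>_::'a. lborel :: real measure" ..
  have [measurable]: "h b \<in> borel_measurable borel" if "b \<in> Basis" for b using h[OF that] by auto
  have m: "(\<lambda>x. \<Prod>b\<in>Basis. h b (x \<bullet> b)) \<in> borel_measurable borel" by measurable
  have m2: "(\<lambda>f. \<Sum>b\<in>Basis. f b *\<^sub>R b) \<in> measurable (\<Pi>\<^sub>M b\<in>(Basis::'a set). lborel) borel" by measurable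
  have eq: "(\<Prod>b\<in>Basis. h b ((\<Sum>b\<in>Basis. f b *\<^sub>R b) \<bullet> b)) = (\<Prod>b\<in>Basis. h b (f b))" for f
    by (intro prod.cong) auto
  show "(LINT x|lborel. (\<Prod>b\<in>Basis. h b (x \<bullet> b))) = (\<Prod>b\<in>Basis. LINT t|lborel. h b t)"
    by (subst lborel_eq, subst integral_distr[OF m2 m]) (simp add: eq product_integral_prod h)
  show "integrable lborel (\<lambda>x. \<Prod>b\<in>Basis. h b (x \<bullet> b))"
    by (subst lborel_eq, subst integrable_distr_eq[OF m2 m]) (simp add: eq product_integrable_prod h)
qed

text \<open>This is the characteristic function of the standard normal distribution, freed from the
  normalising constant of the density.\<close>

lemma integral_cis_gauss_real:
  "(LINT z|lborel. cis (t * z) * complex_of_real (exp (- z\<^sup>2 / 2))) = sqrt (2 * pi) * exp (- t\<^sup>2 / 2)"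
    (is ?eq)
  and integrable_cis_gauss_real:
    "integrable lborel (\<lambda>z. cis (t * z) * complex_of_real (exp (- z\<^sup>2 / 2)))" (is ?int)
proof -
  have [measurable]: "(\<lambda>z. cis (t * z)) \<in> borel_measurable borel"
    by (intro borel_measurable_continuous_onI continuous_intros)
  have gauss: "complex_of_real (exp (- z\<^sup>2 / 2)) = sqrt (2 * pi) * std_normal_density z" for z
    by (simp add: std_normal_density_def)
  have "char std_normal_distribution t = (LINT z|lborel. std_normal_density z *\<^sub>R cis (t * z))"
    unfolding char_def by (subst integral_density) (auto simp: cis_conv_exp)
  then have 1: "(LINT z|lborel. cis (t * z) * complex_of_real (std_normal_density z)) = exp (- t\<^sup>2 / 2)"
    by (simp add: char_std_normal_distribution scaleR_conv_of_real mult.commute)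
  have "(LINT z|lborel. cis (t * z) * complex_of_real (exp (- z\<^sup>2 / 2)))
      = (LINT z|lborel. complex_of_real (sqrt (2 * pi)) * (cis (t * z) * complex_of_real (std_normal_density z)))"
    unfolding gauss by (simp add: mult_ac)
  also have "\<dots> = sqrt (2 * pi) * exp (- t\<^sup>2 / 2)"
    unfolding integral_mult_right_zero 1 by simp
  finally show ?eq .
  have "integrable lborel (\<lambda>z. complex_of_real (std_normal_density z))"
    by (intro integrable_of_real integrable_normal_density) simp
  then have "integrable lborel (\<lambda>z. cis (t * z) * complex_of_real (std_normal_density z))"
    by (rule Bochner_Integration.integrable_bound) (auto simp: norm_mult)
  from integrable_mult_right[OF this, of "complex_of_real (sqrt (2 * pi))"] show ?int
    unfolding gauss by (simp add: mult_ac)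
qed

definition gauss :: "'a::euclidean_space \<Rightarrow> complex" where
  "gauss x = of_real (exp (- (norm x)\<^sup>2 / 2))"

lemma gauss_measurable [measurable]: "gauss \<in> borel_measurable borel"
  unfolding gauss_def by measurable

lemma gauss_norm: "cmod (gauss x) \<le> 1"
  by (simp add: gauss_def)

lemma gauss_0: "gauss 0 = 1"
  by (simp add: gauss_def)

lemma continuous_gauss: "isCont gauss x"
  unfolding gauss_def by (intro continuous_intros) auto

lemma norm_sq_sum: "(norm (x::'a::euclidean_space))\<^sup>2 = (\<Sum>b\<in>Basis. (x \<bullet> b)\<^sup>2)"
  unfolding power2_norm_eq_inner euclidean_inner[of x x] by (simp add: power2_eq_square)

lemma exp_norm_sq: "complex_of_real (exp (- (norm (x::'a::euclidean_space))\<^sup>2 / 2))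
    = (\<Prod>b\<in>Basis. of_real (exp (- (x \<bullet> b)\<^sup>2 / 2)))"
  by (simp add: norm_sq_sum exp_sum[symmetric] sum_negf sum_divide_distrib flip: of_real_prod)

lemma cis_inner: "cis (r * (x \<bullet> (t::'a::euclidean_space))) = (\<Prod>b\<in>Basis. cis (r * (t \<bullet> b) * (x \<bullet> b)))"
proof -
  have "r * (x \<bullet> t) = (\<Sum>b\<in>Basis. r * (t \<bullet> b) * (x \<bullet> b))"
    unfolding euclidean_inner[of x t] by (simp add: sum_distrib_left mult_ac)
  then show ?thesis by (simp add: cis_conv_exp sum_distrib_left exp_sum)
qed

text \<open>Both the Gaussian and the exponential factor over the coordinates, which leaves the
  one-dimensional integral.\<close>

lemma
  fixes t :: "'a::euclidean_space"
  shows ft_gauss: "ft \<sigma> gauss t = of_real (sqrt (2 * pi) ^ DIM('a)) * gauss (\<sigma> *\<^sub>R t)"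
    and gauss_integrable: "integrable lborel (gauss :: 'a \<Rightarrow> complex)"
proof -
  have eq: "cis (r * (x \<bullet> t)) * gauss x =
      (\<Prod>b\<in>Basis. cis (r * (t \<bullet> b) * (x \<bullet> b)) * complex_of_real (exp (- (x \<bullet> b)\<^sup>2 / 2)))" for x r
    unfolding gauss_def exp_norm_sq[of x] cis_inner[of r x t] prod.distrib ..
  have "ft \<sigma> gauss t = (\<Prod>b\<in>Basis. complex_of_real (sqrt (2 * pi) * exp (- (\<sigma> * (t \<bullet> b))\<^sup>2 / 2)))"
    unfolding ft_def eq
    by (subst lborel_integral_prod_Basis[where h = "\<lambda>b z. cis (\<sigma> * (t \<bullet> b) * z) * complex_of_real (exp (- z\<^sup>2 / 2))",
          OF integrable_cis_gauss_real]) (simp only: integral_cis_gauss_real of_real_mult)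
  also have "\<dots> = of_real (sqrt (2 * pi) ^ DIM('a)) * gauss (\<sigma> *\<^sub>R t)"
    unfolding gauss_def exp_norm_sq by (simp add: prod.distrib)
  finally show "ft \<sigma> gauss t = of_real (sqrt (2 * pi) ^ DIM('a)) * gauss (\<sigma> *\<^sub>R t)" .
  show "integrable lborel (gauss :: 'a \<Rightarrow> complex)"
    using lborel_integrable_prod_Basis[where h = "\<lambda>b::'a. \<lambda>z. cis (0 * z) * complex_of_real (exp (- z\<^sup>2 / 2))",
      OF integrable_cis_gauss_real] unfolding gauss_def exp_norm_sq by simp
qed

lemma integral_gauss: "(LINT x|lborel. gauss (x::'a::euclidean_space)) = of_real (sqrt (2 * pi) ^ DIM('a))"
  using ft_gauss[of 0 "0::'a"] by (simp add: ft_def gauss_0)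

text \<open>Gaussian summation: a slowly varying Gaussian is inserted into the outer integral, and
  the multiplication formula turns it into an average of \<open>f\<close> over a Gaussian
  concentrating at \<open>x\<close>. Both sides pass to the limit by dominated convergence. One
  factor \<open>sqrt (2 * pi) ^ DIM('a)\<close> comes from the transform of the Gaussian, the other
  from its integral.\<close>

theorem ft_inversion:
  fixes f :: "'a::euclidean_space \<Rightarrow> complex"
  assumes f: "f \<in> schwartz" and \<sigma>: "\<bar>\<sigma>\<bar> = 1"
  shows "ft (- \<sigma>) (ft \<sigma> f) x = of_real ((2 * pi) ^ DIM('a)) * f x"
proof -
  let ?c = "complex_of_real (sqrt (2 * pi) ^ DIM('a))"
  define e where "e n = inverse (real (Suc n))" for n
  have e: "e n > 0" "e \<longlonglongrightarrow> 0" for n unfolding e_def using LIMSEQ_inverse_real_of_nat by auto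
  have fi: "integrable lborel f" by (rule schwartz_integrable[OF f])
  have Fi: "integrable lborel (ft \<sigma> f)" by (intro schwartz_integrable schwartz_ft f \<sigma>)
  have [measurable]: "f \<in> borel_measurable borel" "ft \<sigma> f \<in> borel_measurable borel" using fi Fi by auto
  have [measurable]: "(\<lambda>\<xi>. cis (r * (\<xi> \<bullet> y))) \<in> borel_measurable borel" for r and y :: 'a
    by (intro borel_measurable_continuous_onI continuous_intros)
  \<comment> \<open>Including the exponential in \<open>g\<close> recentres its transform from the
    origin to \<open>x\<close>.\<close>
  define g where "g n \<xi> = cis (- \<sigma> * (\<xi> \<bullet> x)) * gauss (e n *\<^sub>R \<xi>)" for n \<xi>
  have gauss_e: "integrable lborel (\<lambda>\<xi>::'a. gauss (e n *\<^sub>R \<xi>))" for n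
    using lborel_integrable_affine_iff[of "gauss :: 'a \<Rightarrow> complex" "e n" 0] e(1)[of n] gauss_integrable by simp
  have g: "integrable lborel (g n)" for n
    unfolding g_def by (intro ft_integrable gauss_e)
  have ftg: "ft \<sigma> (g n) y = of_real (inverse (e n) ^ DIM('a)) * ?c * gauss (inverse (e n) *\<^sub>R (y - x))" for n y
  proof -
    let ?d = "inverse (e n)"
    have "ft \<sigma> (g n) y = (LINT \<xi>|lborel. cis (\<sigma> * (\<xi> \<bullet> (y - x))) * gauss (e n *\<^sub>R \<xi>))"
    proof -
      have "cis (\<sigma> * (\<xi> \<bullet> y)) * (cis (- \<sigma> * (\<xi> \<bullet> x)) * z) = cis (\<sigma> * (\<xi> \<bullet> (y - x))) * z" for \<xi> z
        unfolding mult.assoc[symmetric] cis_mult by (simp add: inner_diff_right right_diff_distrib)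
      then show ?thesis unfolding ft_def g_def by (simp only:)
    qed
    also have "\<dots> = \<bar>?d\<bar> ^ DIM('a) *\<^sub>R
        (LINT \<xi>|lborel. cis (\<sigma> * ((0 + ?d *\<^sub>R \<xi>) \<bullet> (y - x))) * gauss (e n *\<^sub>R (0 + ?d *\<^sub>R \<xi>)))"
      using e(1)[of n] by (intro lborel_integral_affine) auto
    also have "\<dots> = of_real (?d ^ DIM('a)) * ft \<sigma> gauss (?d *\<^sub>R (y - x))"
      using e(1)[of n] by (simp add: ft_def scaleR_conv_of_real mult_ac)
    also have "gauss (\<sigma> *\<^sub>R ?d *\<^sub>R (y - x)) = gauss (?d *\<^sub>R (y - x))"
      using \<sigma> by (simp add: gauss_def abs_mult)
    then have "of_real (?d ^ DIM('a)) * ft \<sigma> gauss (?d *\<^sub>R (y - x))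
        = of_real (?d ^ DIM('a)) * ?c * gauss (?d *\<^sub>R (y - x))" by (simp add: ft_gauss)
    finally show ?thesis .
  qed
  have I: "(LINT \<xi>|lborel. g n \<xi> * ft \<sigma> f \<xi>) = ?c * (LINT z|lborel. gauss z * f (x + e n *\<^sub>R z))" for n
  proof -
    let ?d = "inverse (e n)"
    have "(LINT \<xi>|lborel. g n \<xi> * ft \<sigma> f \<xi>) = (LINT y|lborel. ft \<sigma> (g n) y * f y)"
      by (rule ft_pair[OF g fi, symmetric])
    also have "\<dots> = \<bar>e n\<bar> ^ DIM('a) *\<^sub>R (LINT z|lborel. ft \<sigma> (g n) (x + e n *\<^sub>R z) * f (x + e n *\<^sub>R z))"
      using e(1)[of n] unfolding ftg by (intro lborel_integral_affine) auto
    also have "\<dots> = (LINT z|lborel. ?c * (gauss z * f (x + e n *\<^sub>R z)))"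
      unfolding ftg using e(1)[of n]
      by (simp add: scaleR_conv_of_real power_inverse mult.assoc)
    finally show ?thesis by simp
  qed
  have "(\<lambda>n. LINT \<xi>|lborel. g n \<xi> * ft \<sigma> f \<xi>) \<longlonglongrightarrow> (LINT \<xi>|lborel. cis (- \<sigma> * (\<xi> \<bullet> x)) * ft \<sigma> f \<xi>)"
  proof (rule integral_dominated_convergence[OF _ _ integrable_norm[OF Fi]])
    show "AE \<xi> in lborel. (\<lambda>n. g n \<xi> * ft \<sigma> f \<xi>) \<longlonglongrightarrow> cis (- \<sigma> * (\<xi> \<bullet> x)) * ft \<sigma> f \<xi>"
    proof (rule AE_I2)
      fix \<xi> :: 'a
      have "(\<lambda>n. e n *\<^sub>R \<xi>) \<longlonglongrightarrow> 0" using tendsto_scaleR[OF e(2) tendsto_const[of \<xi>]] by simp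
      from isCont_tendsto_compose[OF continuous_gauss this]
      have "(\<lambda>n. gauss (e n *\<^sub>R \<xi>)) \<longlonglongrightarrow> 1" by (simp add: gauss_0)
      then have "(\<lambda>n. cis (- \<sigma> * (\<xi> \<bullet> x)) * gauss (e n *\<^sub>R \<xi>) * ft \<sigma> f \<xi>)
          \<longlonglongrightarrow> cis (- \<sigma> * (\<xi> \<bullet> x)) * 1 * ft \<sigma> f \<xi>" by (intro tendsto_intros)
      then show "(\<lambda>n. g n \<xi> * ft \<sigma> f \<xi>) \<longlonglongrightarrow> cis (- \<sigma> * (\<xi> \<bullet> x)) * ft \<sigma> f \<xi>"
        by (simp add: g_def)
    qed
    show "AE \<xi> in lborel. norm (g n \<xi> * ft \<sigma> f \<xi>) \<le> norm (ft \<sigma> f \<xi>)" for n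
      by (intro AE_I2) (auto simp: g_def norm_mult intro!: mult_left_le_one_le gauss_norm)
    show "(\<lambda>\<xi>. cis (- \<sigma> * (\<xi> \<bullet> x)) * ft \<sigma> f \<xi>) \<in> borel_measurable lborel"
      by measurable
    show "(\<lambda>\<xi>. g n \<xi> * ft \<sigma> f \<xi>) \<in> borel_measurable lborel" for n
      unfolding g_def by measurable
  qed
  then have lim1: "(\<lambda>n. LINT \<xi>|lborel. g n \<xi> * ft \<sigma> f \<xi>) \<longlonglongrightarrow> ft (- \<sigma>) (ft \<sigma> f) x"
    by (simp add: ft_def[of "- \<sigma>"])
  obtain B where "schwartz_bound 0 0 B f" using schwartz_boundE[OF f] by blast
  then have B: "cmod (f y) \<le> B" for y by (simp add: schwartz_bound_0)
  have "(\<lambda>n. LINT z|lborel. gauss z * f (x + e n *\<^sub>R z)) \<longlonglongrightarrow> (LINT z|lborel. gauss (z::'a) * f x)"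
  proof (rule integral_dominated_convergence)
    show "integrable lborel (\<lambda>z::'a. cmod (gauss z) * B)"
      by (intro integrable_mult_left integrable_norm gauss_integrable)
    show "AE z in lborel. (\<lambda>n. gauss z * f (x + e n *\<^sub>R z)) \<longlonglongrightarrow> gauss z * f x"
    proof (rule AE_I2)
      fix z :: 'a
      have "(\<lambda>n. x + e n *\<^sub>R z) \<longlonglongrightarrow> x + 0 *\<^sub>R z" by (intro tendsto_intros e)
      then have "(\<lambda>n. x + e n *\<^sub>R z) \<longlonglongrightarrow> x" by simp
      moreover have "isCont f x"
        using smooth_differentiable[OF schwartz_smooth[OF f]] differentiable_imp_continuous_within by blast
      ultimately have "(\<lambda>n. f (x + e n *\<^sub>R z)) \<longlonglongrightarrow> f x" by (rule isCont_tendsto_compose[rotated])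
      then show "(\<lambda>n. gauss z * f (x + e n *\<^sub>R z)) \<longlonglongrightarrow> gauss z * f x" by (intro tendsto_intros)
    qed
    show "AE z in lborel. norm (gauss z * f (x + e n *\<^sub>R z)) \<le> cmod (gauss z) * B" for n
      by (intro AE_I2) (auto simp: norm_mult intro!: mult_left_mono B)
  qed auto
  then have "(\<lambda>n. ?c * (LINT z|lborel. gauss z * f (x + e n *\<^sub>R z))) \<longlonglongrightarrow> ?c * (LINT z|lborel. gauss (z::'a) * f x)"
    by (intro tendsto_intros)
  then have "(\<lambda>n. LINT \<xi>|lborel. g n \<xi> * ft \<sigma> f \<xi>) \<longlonglongrightarrow> ?c * (?c * f x)"
    unfolding I by (simp add: integral_gauss)
  from LIMSEQ_unique[OF lim1 this] have "ft (- \<sigma>) (ft \<sigma> f) x = ?c * ?c * f x"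
    by (simp only: mult.assoc)
  also have "?c * ?c = of_real ((2 * pi) ^ DIM('a))"
    unfolding of_real_mult[symmetric] power_mult_distrib[symmetric] real_sqrt_mult_self by simp
  finally show ?thesis .
qed

abbreviation two_pi_pow :: "'a::euclidean_space itself \<Rightarrow> complex" where
  "two_pi_pow a \<equiv> of_real ((2 * pi) ^ DIM('a))"

lemma schwartz_fourier: "f \<in> schwartz \<Longrightarrow> fourier f \<in> schwartz"
  by (simp add: fourier_eq_ft schwartz_ft)

lemma schwartz_inv_fourier: "f \<in> schwartz \<Longrightarrow> inv_fourier f \<in> schwartz"
  unfolding inv_fourier_eq_ft
  using schwartz_cmult[OF schwartz_ft[of f 1], of "inverse (two_pi_pow TYPE('a))"]
  by (simp add: divide_inverse mult.commute)

lemma inv_fourier_fourier: "f \<in> schwartz \<Longrightarrow> inv_fourier (fourier f) = f"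
  using ft_inversion[of f "-1"] by (simp add: fun_eq_iff fourier_eq_ft inv_fourier_eq_ft)

lemma fourier_inv_fourier: "f \<in> schwartz \<Longrightarrow> fourier (inv_fourier f) = f"
proof
  fix x :: 'a assume f: "f \<in> schwartz"
  have "fourier (inv_fourier f) x = ft (-1) (\<lambda>x. inverse (two_pi_pow TYPE('a)) * ft 1 f x) x"
    unfolding fourier_eq_ft inv_fourier_eq_ft by (simp add: divide_inverse mult.commute)
  also have "\<dots> = inverse (two_pi_pow TYPE('a)) * (two_pi_pow TYPE('a) * f x)"
    unfolding ft_cmult using ft_inversion[OF f, of 1 x] by simp
  also have "\<dots> = f x"
  proof -
    have *: "inverse z * (z * w) = w" if "z \<noteq> 0" for z w :: complex using that by simp
    show ?thesis by (rule *) simp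
  qed
  finally show "fourier (inv_fourier f) x = f x" .
qed

text \<open>The multiplication formula moves the inverse transform onto \<open>fourier g\<close>,
  where inversion undoes it.\<close>

lemma inv_fourier_pair:
  fixes f g :: "'a::euclidean_space \<Rightarrow> complex"
  assumes "f \<in> schwartz" "g \<in> schwartz"
  shows "(LINT x|lborel. inv_fourier f x * fourier g x) = (LINT \<xi>|lborel. f \<xi> * g \<xi>)"
proof -
  have "(LINT x|lborel. inv_fourier f x * fourier g x)
      = (LINT x|lborel. ft 1 f x * fourier g x) / two_pi_pow TYPE('a)"
    unfolding inv_fourier_eq_ft by (simp flip: integral_divide_zero)
  also have "(LINT x|lborel. ft 1 f x * fourier g x) = (LINT x|lborel. f x * ft 1 (fourier g) x)"
    by (intro ft_pair schwartz_integrable schwartz_fourier assms)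
  also have "\<dots> = (LINT x|lborel. (f x * g x) * two_pi_pow TYPE('a))"
    using ft_inversion[OF assms(2), of "-1"] by (simp add: fourier_eq_ft mult_ac)
  finally show ?thesis by simp
qed


section \<open>Tempered distributions and polynomials\<close>

lemma tempered_iff:
  "u \<in> vcarrier tempered \<longleftrightarrow> on_schwartz u = u \<and>
     (\<forall>f\<in>schwartz. \<forall>g\<in>schwartz. u (\<lambda>x. f x + g x) = u f + u g) \<and>
     (\<forall>c. \<forall>f\<in>schwartz. u (\<lambda>x. c * f x) = c * u f) \<and>
     (\<exists>K N. \<forall>f\<in>schwartz. norm (u f) \<le> K * schwartz_norm N f)"
  by (simp add: tempered_def)

lemma tempered_add: "vadd tempered u v = (\<lambda>f. u f + v f)"
  and tempered_scale: "vscale tempered c u = (\<lambda>f. c * u f)"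
  and tempered_sub: "vsub tempered u v = (\<lambda>f. u f - v f)"
  by (simp_all add: tempered_def vsub_def)

lemma temperedI:
  assumes "\<And>f. f \<notin> schwartz \<Longrightarrow> u f = 0"
    and "\<And>f g. \<lbrakk>f \<in> schwartz; g \<in> schwartz\<rbrakk> \<Longrightarrow> u (\<lambda>x. f x + g x) = u f + u g"
    and "\<And>c f. f \<in> schwartz \<Longrightarrow> u (\<lambda>x. c * f x) = c * u f"
    and "\<And>f. f \<in> schwartz \<Longrightarrow> norm (u f) \<le> K * schwartz_norm N f"
  shows "u \<in> vcarrier tempered"
  unfolding tempered_iff
proof (intro conjI ballI allI)
  show "on_schwartz u = u" using assms(1) by (auto simp: on_schwartz_def)
  show "\<exists>K N. \<forall>f\<in>schwartz. norm (u f) \<le> K * schwartz_norm N f" using assms(4) by blast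
qed (use assms in auto)

lemma
  assumes "u \<in> vcarrier tempered"
  shows tempered_outside: "f \<notin> schwartz \<Longrightarrow> u f = 0"
    and tempered_plus: "\<lbrakk>f \<in> schwartz; g \<in> schwartz\<rbrakk> \<Longrightarrow> u (\<lambda>x. f x + g x) = u f + u g"
    and tempered_mult: "f \<in> schwartz \<Longrightarrow> u (\<lambda>x. c * f x) = c * u f"
proof -
  have *: "on_schwartz u = u"
    "\<And>f g. \<lbrakk>f \<in> schwartz; g \<in> schwartz\<rbrakk> \<Longrightarrow> u (\<lambda>x. f x + g x) = u f + u g"
    "\<And>c f. f \<in> schwartz \<Longrightarrow> u (\<lambda>x. c * f x) = c * u f"
    using assms unfolding tempered_iff by auto
  show "u f = 0" if "f \<notin> schwartz"
    using fun_cong[OF *(1), of f] that by (simp add: on_schwartz_def)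
qed (use assms in \<open>auto simp: tempered_iff\<close>)

lemma tempered_diff:
  assumes u: "u \<in> vcarrier tempered" and f: "f \<in> schwartz" and g: "g \<in> schwartz"
  shows "u (\<lambda>x. f x - g x) = u f - u g"
  using tempered_plus[OF u f schwartz_cmult[OF g, of "-1"]] tempered_mult[OF u g, of "-1"] by simp

lemma tempered_bound:
  assumes "u \<in> vcarrier tempered"
  obtains K N where "K \<ge> 0" "\<And>f. f \<in> schwartz \<Longrightarrow> norm (u f) \<le> K * schwartz_norm N f"
proof -
  obtain K N where K: "\<And>f. f \<in> schwartz \<Longrightarrow> norm (u f) \<le> K * schwartz_norm N f"
    using assms unfolding tempered_iff by blast
  have "norm (u f) \<le> max K 0 * schwartz_norm N f" if "f \<in> schwartz" for f
    using mult_right_mono[OF max.cobounded1[of K 0] schwartz_norm_nonneg[OF that, of N]]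
    by (rule order_trans[OF K[OF that]])
  then show ?thesis using that[of "max K 0" N] by simp
qed

lemma tempered_cvector_space: "cvector_space tempered"
proof
  have "(\<lambda>_. 0) \<in> vcarrier tempered" by (rule temperedI[of _ 0]) auto
  then show "vcarrier tempered \<noteq> {}" by blast
  fix u v :: "'a functional" and c
  assume u: "u \<in> vcarrier tempered"
  obtain K N where K: "K \<ge> 0" "\<And>f. f \<in> schwartz \<Longrightarrow> norm (u f) \<le> K * schwartz_norm N f"
    using tempered_bound[OF u] by blast
  show "vscale tempered c u \<in> vcarrier tempered"
    unfolding tempered_scale
  proof (rule temperedI)
    show "norm (c * u f) \<le> (norm c * K) * schwartz_norm N f" if "f \<in> schwartz" for f
      using K(2)[OF that] by (simp add: norm_mult mult.assoc mult_left_mono)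
  qed (simp_all add: tempered_outside[OF u] tempered_plus[OF u] tempered_mult[OF u] algebra_simps)
  assume v: "v \<in> vcarrier tempered"
  obtain L M where L: "L \<ge> 0" "\<And>f. f \<in> schwartz \<Longrightarrow> norm (v f) \<le> L * schwartz_norm M f"
    using tempered_bound[OF v] by blast
  show "vadd tempered u v \<in> vcarrier tempered"
    unfolding tempered_add
  proof (rule temperedI)
    fix f :: "'a \<Rightarrow> complex" assume f: "f \<in> schwartz"
    have "norm (u f + v f) \<le> K * schwartz_norm N f + L * schwartz_norm M f"
      using K(2)[OF f] L(2)[OF f] by (intro norm_triangle_le) auto
    also have "\<dots> \<le> K * schwartz_norm (max N M) f + L * schwartz_norm (max N M) f"
      using K(1) L(1) f by (intro add_mono mult_left_mono schwartz_norm_mono) auto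
    finally show "norm (u f + v f) \<le> (K + L) * schwartz_norm (max N M) f" by (simp add: algebra_simps)
  qed (simp_all add: tempered_outside[OF u] tempered_plus[OF u] tempered_mult[OF u]
      tempered_outside[OF v] tempered_plus[OF v] tempered_mult[OF v] algebra_simps)
qed (simp_all add: tempered_add tempered_scale algebra_simps)

lemma distr_of_apply: "f \<in> schwartz \<Longrightarrow> distr_of g f = (LINT x|lborel. g x * f x)"
  by (simp add: distr_of_def on_schwartz_def)

lemma distr_of_outside: "f \<notin> schwartz \<Longrightarrow> distr_of g f = 0"
  by (simp add: distr_of_def on_schwartz_def)

lemma distr_of_add:
  assumes "\<And>f. f \<in> schwartz \<Longrightarrow> integrable lborel (\<lambda>x. g x * f x)"
    and "\<And>f. f \<in> schwartz \<Longrightarrow> integrable lborel (\<lambda>x. h x * f x)"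
  shows "distr_of (\<lambda>x. g x + h x) f = distr_of g f + distr_of h f"
  using assms by (cases "f \<in> schwartz") (simp_all add: distr_of_apply distr_of_outside distrib_right)

lemma distr_of_cmult: "distr_of (\<lambda>x. c * g x) f = c * distr_of g f"
  by (cases "f \<in> schwartz") (simp_all add: distr_of_apply distr_of_outside mult.assoc)

lemma growth_integrable:
  fixes f g :: "'a::euclidean_space \<Rightarrow> complex"
  assumes "g \<in> borel_measurable borel" "\<And>x. cmod (g x) \<le> B * (1 + norm x) ^ M" "f \<in> schwartz"
  shows "integrable lborel (\<lambda>x. g x * f x)"
proof -
  obtain A where "schwartz_bound (M + DIM('a) + 2) 0 A f" using schwartz_boundE[OF assms(3)] by blast
  with assms show ?thesis using schwartz_mult_growth(1) schwartz_smooth by blast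
qed

lemma growth_distr_bound:
  fixes f g :: "'a::euclidean_space \<Rightarrow> complex"
  assumes g: "g \<in> borel_measurable borel" "\<And>x. cmod (g x) \<le> B * (1 + norm x) ^ M"
    and f: "f \<in> schwartz"
  shows "cmod (LINT x|lborel. g x * f x)
    \<le> (B * integral\<^sup>L lborel (weight :: 'a \<Rightarrow> real)) * schwartz_norm (M + DIM('a) + 2) f"
proof -
  have "schwartz_bound (M + DIM('a) + 2) 0 (schwartz_norm (M + DIM('a) + 2) f) f"
    by (rule schwartz_bound_mono[OF schwartz_bound_norm[OF f]]) auto
  then have "(LINT x|lborel. cmod (g x * f x))
      \<le> B * schwartz_norm (M + DIM('a) + 2) f * integral\<^sup>L lborel (weight :: 'a \<Rightarrow> real)"
    using g schwartz_smooth[OF f] by (intro schwartz_mult_growth(2))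
  from order_trans[OF integral_norm_bound this] show ?thesis by (simp only: mult_ac)
qed

lemma distr_of_tempered:
  fixes g :: "'a::euclidean_space \<Rightarrow> complex"
  assumes "g \<in> borel_measurable borel" "\<And>x. cmod (g x) \<le> B * (1 + norm x) ^ M"
  shows "distr_of g \<in> vcarrier tempered"
proof (rule temperedI)
  show "norm (distr_of g f)
      \<le> (B * integral\<^sup>L lborel (weight :: 'a \<Rightarrow> real)) * schwartz_norm (M + DIM('a) + 2) f"
    if "f \<in> schwartz" for f
    using growth_distr_bound[OF assms that] that by (simp add: distr_of_apply)
  note int = growth_integrable[OF assms]
  show "distr_of g (\<lambda>x. f x + h x) = distr_of g f + distr_of g h"
    if "f \<in> schwartz" "h \<in> schwartz" for f h
    using that int by (simp add: distr_of_apply schwartz_add distrib_left)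
  show "distr_of g (\<lambda>x. c * f x) = c * distr_of g f" if "f \<in> schwartz" for f c
    using that by (simp add: distr_of_apply schwartz_cmult mult.left_commute[of _ c])
qed (rule distr_of_outside)

section \<open>Polynomials as tempered distributions\<close>

lemma real_polynomial_growth:
  fixes p :: "'a::euclidean_space \<Rightarrow> real"
  assumes "real_polynomial_function p"
  shows "\<exists>B M. \<forall>x. \<bar>p x\<bar> \<le> B * (1 + norm x) ^ M"
  using assms
proof induction
  case (linear p)
  obtain K where K: "K > 0" "\<And>x. norm (p x) \<le> norm x * K" using bounded_linear.pos_bounded[OF linear] by blast
  have "\<bar>p x\<bar> \<le> K * (1 + norm x) ^ 1" for x using K(1) K(2)[of x] by (simp add: algebra_simps)
  then show ?case by blast
next
  case (const c)
  have "\<bar>c\<bar> \<le> \<bar>c\<bar> * (1 + norm (x::'a)) ^ 0" for x by simp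
  then show ?case by blast
next
  case (add p q)
  then obtain B M C N where *: "\<And>x. \<bar>p x\<bar> \<le> B * (1 + norm x) ^ M" "\<And>x. \<bar>q x\<bar> \<le> C * (1 + norm x) ^ N"
    by blast
  have BC: "0 \<le> B" "0 \<le> C" using order_trans[OF abs_ge_zero *(1)[of 0]] order_trans[OF abs_ge_zero *(2)[of 0]] by auto
  have "\<bar>p x + q x\<bar> \<le> (B + C) * (1 + norm x) ^ (M + N)" for x
  proof -
    have "\<bar>p x + q x\<bar> \<le> B * (1 + norm x) ^ M + C * (1 + norm x) ^ N" using *[of x] by linarith
    also have "\<dots> \<le> B * (1 + norm x) ^ (M + N) + C * (1 + norm x) ^ (M + N)"
      using BC by (intro add_mono mult_left_mono power_increasing) auto
    finally show ?thesis by (simp add: algebra_simps)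
  qed
  then show ?case by blast
next
  case (mult p q)
  then obtain B M C N where *: "\<And>x. \<bar>p x\<bar> \<le> B * (1 + norm x) ^ M" "\<And>x. \<bar>q x\<bar> \<le> C * (1 + norm x) ^ N"
    by blast
  have "\<bar>p x * q x\<bar> \<le> (B * C) * (1 + norm x) ^ (M + N)" for x
    using mult_mono[OF *(1)[of x] *(2)[of x]] order_trans[OF abs_ge_zero *(1)[of x]]
    by (simp add: abs_mult power_add mult_ac)
  then show ?case by blast
qed

lemma polynomial_parts:
  fixes P :: "'a::euclidean_space \<Rightarrow> complex"
  assumes "polynomial_function P"
  shows "real_polynomial_function (\<lambda>x. Re (P x))" "real_polynomial_function (\<lambda>x. Im (P x))"
  using assms bounded_linear_Re bounded_linear_Im unfolding polynomial_function_def o_def by blast+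

lemma polynomial_function_of_real:
  assumes "real_polynomial_function p" shows "polynomial_function (\<lambda>x. complex_of_real (p x))"
  unfolding polynomial_function_def o_def
proof (intro allI impI)
  fix f :: "complex \<Rightarrow> real" assume f: "bounded_linear f"
  interpret bounded_linear f by fact
  have "f (complex_of_real (p x)) = p x * f 1" for x using scaleR[of "p x" 1] by (simp add: scaleR_conv_of_real)
  then show "real_polynomial_function (\<lambda>x. f (complex_of_real (p x)))"
    using assms by (simp add: real_polynomial_function.intros)
qed

lemma polynomial_function_cmult_complex:
  fixes P :: "'a::euclidean_space \<Rightarrow> complex"
  assumes "polynomial_function P" shows "polynomial_function (\<lambda>x. c * P x)"
  unfolding polynomial_function_def o_def
proof (intro allI impI)
  fix f :: "complex \<Rightarrow> real" assume "bounded_linear f"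
  then have "bounded_linear (\<lambda>z. f (c * z))"
    by (rule bounded_linear_compose) (rule bounded_linear_mult_right)
  then show "real_polynomial_function (\<lambda>x. f (c * P x))"
    using assms unfolding polynomial_function_def o_def by blast
qed

lemma polynomial_growth:
  fixes P :: "'a::euclidean_space \<Rightarrow> complex"
  assumes P: "polynomial_function P"
  obtains B M where "P \<in> borel_measurable borel" "\<And>x. cmod (P x) \<le> B * (1 + norm x) ^ M"
proof -
  obtain B M where B: "\<And>x. \<bar>Re (P x)\<bar> \<le> B * (1 + norm x) ^ M"
    using real_polynomial_growth[OF polynomial_parts(1)[OF P]] by blast
  obtain C N where C: "\<And>x. \<bar>Im (P x)\<bar> \<le> C * (1 + norm x) ^ N"
    using real_polynomial_growth[OF polynomial_parts(2)[OF P]] by blast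
  have BC: "0 \<le> B" "0 \<le> C" using order_trans[OF abs_ge_zero B[of 0]] order_trans[OF abs_ge_zero C[of 0]] by auto
  show ?thesis
  proof
    show "P \<in> borel_measurable borel"
      by (intro borel_measurable_continuous_onI continuous_on_polymonial_function P)
    fix x
    have "cmod (P x) \<le> B * (1 + norm x) ^ M + C * (1 + norm x) ^ N"
      using cmod_le[of "P x"] B[of x] C[of x] by linarith
    also have "\<dots> \<le> B * (1 + norm x) ^ (M + N) + C * (1 + norm x) ^ (M + N)"
      using BC by (intro add_mono mult_left_mono power_increasing) auto
    finally show "cmod (P x) \<le> (B + C) * (1 + norm x) ^ (M + N)" by (simp add: algebra_simps)
  qed
qed

lemma polynomial_integrable:
  assumes "polynomial_function P" "f \<in> schwartz"
  shows "integrable lborel (\<lambda>x. P x * f x)"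
  using polynomial_growth[OF assms(1)] growth_integrable assms(2) by metis

lemma polynomial_distrs_subspace:
  "csubspace tempered (polynomial_distrs :: 'a::euclidean_space functional set)"
  unfolding csubspace_def
proof (intro conjI ballI allI)
  show "(polynomial_distrs :: 'a functional set) \<subseteq> vcarrier tempered"
  proof
    fix u :: "'a functional" assume "u \<in> polynomial_distrs"
    then obtain P where P: "polynomial_function P" "u = distr_of P" by (auto simp: polynomial_distrs_def)
    obtain B M where "P \<in> borel_measurable borel" "\<And>x. cmod (P x) \<le> B * (1 + norm x) ^ M"
      using polynomial_growth[OF P(1)] by blast
    then show "u \<in> vcarrier tempered" unfolding P by (rule distr_of_tempered)
  qed
  show "(polynomial_distrs :: 'a functional set) \<noteq> {}" using polynomial_function_const by (auto simp: polynomial_distrs_def)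
  fix u v :: "'a functional" and c
  assume "u \<in> polynomial_distrs"
  then obtain P where P: "polynomial_function P" "u = distr_of P" by (auto simp: polynomial_distrs_def)
  have "vscale tempered c u = distr_of (\<lambda>x. c * P x)"
    unfolding P tempered_scale by (simp add: fun_eq_iff distr_of_cmult)
  then show "vscale tempered c u \<in> polynomial_distrs"
    using polynomial_function_cmult_complex[OF P(1)] by (auto simp: polynomial_distrs_def)
  assume "v \<in> polynomial_distrs"
  then obtain Q where Q: "polynomial_function Q" "v = distr_of Q" by (auto simp: polynomial_distrs_def)
  have "vadd tempered u v = distr_of (\<lambda>x. P x + Q x)"
    unfolding P Q tempered_add using P(1) Q(1) by (simp add: fun_eq_iff distr_of_add polynomial_integrable)
  then show "vadd tempered u v \<in> polynomial_distrs"
    using polynomial_function_add[OF P(1) Q(1)] by (auto simp: polynomial_distrs_def)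
qed

section \<open>Polynomials against transforms of functions vanishing near the origin\<close>

lemma ft_sum:
  assumes "\<And>i. i \<in> I \<Longrightarrow> integrable lborel (f i)"
  shows "ft \<sigma> (\<lambda>x. \<Sum>i\<in>I. f i x) \<xi> = (\<Sum>i\<in>I. ft \<sigma> (f i) \<xi>)"
  unfolding ft_def using assms by (simp add: sum_distrib_left ft_integrable)

text \<open>The frequency-side test functions that do not see polynomials, whose Fourier transforms
  are supported at the origin. Products with the symbol of a dyadic block are of this kind.\<close>

definition schwartz_off_zero :: "('a::euclidean_space \<Rightarrow> complex) set" where
  "schwartz_off_zero = {f \<in> schwartz. \<exists>r>0. \<forall>x. norm x < r \<longrightarrow> f x = 0}"

lemma pd_off_zero:
  assumes f: "f \<in> schwartz_off_zero" and b: "b \<in> Basis"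
  shows "pd b f \<in> schwartz_off_zero"
proof -
  obtain r where r: "r > 0" "\<And>x. norm x < r \<Longrightarrow> f x = 0" and fS: "f \<in> schwartz"
    using f by (auto simp: schwartz_off_zero_def)
  have "pd b f x = 0" if "norm x < r" for x
  proof (rule pd_eq)
    have "open {x::'a. norm x < r}" by (intro open_Collect_less continuous_intros)
    with has_derivative_const show "(f has_derivative (\<lambda>_. 0)) (at x)"
      by (rule has_derivative_transform_within_open) (use that r in auto)
  qed
  then show ?thesis using schwartz_pd[OF fS b] r(1) by (auto simp: schwartz_off_zero_def)
qed

lemma off_zero_add:
  assumes "f \<in> schwartz_off_zero" "g \<in> schwartz_off_zero"
  shows "(\<lambda>x. f x + g x) \<in> schwartz_off_zero"
proof -
  obtain r where r: "r > 0" "\<And>x. norm x < r \<Longrightarrow> f x = 0" using assms by (auto simp: schwartz_off_zero_def)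
  obtain s where s: "s > 0" "\<And>x. norm x < s \<Longrightarrow> g x = 0" using assms by (auto simp: schwartz_off_zero_def)
  show ?thesis
    using assms r s unfolding schwartz_off_zero_def
    by (auto intro!: schwartz_add exI[of _ "min r s"])
qed

lemma off_zero_cmult: "f \<in> schwartz_off_zero \<Longrightarrow> (\<lambda>x. c * f x) \<in> schwartz_off_zero"
  by (auto simp: schwartz_off_zero_def schwartz_cmult)

lemma off_zero_sum:
  "(\<And>i. i \<in> I \<Longrightarrow> f i \<in> schwartz_off_zero) \<Longrightarrow> (\<lambda>x. \<Sum>i\<in>I. f i x) \<in> schwartz_off_zero"
proof (induction I rule: infinite_finite_induct)
  case empty
  show ?case by (auto simp: schwartz_off_zero_def schwartz_zero intro: exI[of _ 1])
next
  case (infinite A)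
  then show ?case by (auto simp: schwartz_off_zero_def schwartz_zero intro: exI[of _ 1])
qed (simp add: off_zero_add)

text \<open>Multiplication by a polynomial on one side is a differential operator with constant
  coefficients on the other, and such an operator preserves vanishing near the origin. The induction
  follows the generation of polynomials, so only linear forms require a computation.\<close>

lemma real_polynomial_mult_ft:
  fixes p :: "'a::euclidean_space \<Rightarrow> real"
  assumes "real_polynomial_function p" "f \<in> schwartz_off_zero"
  shows "\<exists>g\<in>schwartz_off_zero. \<forall>x. of_real (p x) * fourier f x = fourier g x"
  using assms
proof (induction arbitrary: f)
  case (linear p)
  interpret bounded_linear p by fact
  have f: "f \<in> schwartz" using linear.prems by (simp add: schwartz_off_zero_def)
  have pb: "pd b f \<in> schwartz_off_zero" if "b \<in> Basis" for b using pd_off_zero linear.prems that by blast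
  define g where "g x = (\<Sum>b\<in>Basis. (- \<i> * of_real (p b)) * pd b f x)" for x
  have "g \<in> schwartz_off_zero" unfolding g_def by (intro off_zero_sum off_zero_cmult pb)
  moreover have "of_real (p x) * fourier f x = fourier g x" for x
  proof -
    have "fourier g x = (\<Sum>b\<in>Basis. (- \<i> * of_real (p b)) * ft (-1) (pd b f) x)"
      unfolding fourier_eq_ft g_def using schwartz_pd[OF f]
      by (subst ft_sum) (auto intro!: integrable_mult_right schwartz_integrable schwartz_cmult simp: ft_cmult[symmetric])
    also have "\<dots> = (\<Sum>b\<in>Basis. of_real ((x \<bullet> b) * p b)) * fourier f x"
      unfolding fourier_eq_ft sum_distrib_right by (intro sum.cong) (auto simp: ft_pd[OF f] mult_ac)
    also have "(\<Sum>b\<in>Basis. of_real ((x \<bullet> b) * p b)) = of_real (p x)"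
    proof -
      have eq: "p x = (\<Sum>b\<in>Basis. (x \<bullet> b) * p b)"
        using sum[of "\<lambda>b. (x \<bullet> b) *\<^sub>R b" Basis] scaleR by (simp add: euclidean_representation)
      show ?thesis unfolding eq by simp
    qed
    finally show ?thesis by simp
  qed
  ultimately show ?case by blast
next
  case (const c)
  then show ?case
    by (intro bexI[of _ "\<lambda>x. of_real c * f x"]) (auto simp: fourier_eq_ft ft_cmult off_zero_cmult)
next
  case (add p q)
  obtain g where g: "g \<in> schwartz_off_zero" "\<And>x. of_real (p x) * fourier f x = fourier g x" using add by blast
  obtain h where h: "h \<in> schwartz_off_zero" "\<And>x. of_real (q x) * fourier f x = fourier h x" using add by blast
  have "integrable lborel g" "integrable lborel h"
    using g h by (auto simp: schwartz_off_zero_def schwartz_integrable)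
  then have "of_real (p x + q x) * fourier f x = fourier (\<lambda>x. g x + h x) x" for x
    using g(2)[of x] h(2)[of x] by (simp add: distrib_right fourier_eq_ft ft_add)
  then show ?case using off_zero_add[OF g(1) h(1)] by blast
next
  case (mult p q)
  obtain g where g: "g \<in> schwartz_off_zero" "\<And>x. of_real (q x) * fourier f x = fourier g x" using mult by blast
  obtain h where h: "h \<in> schwartz_off_zero" "\<And>x. of_real (p x) * fourier g x = fourier h x"
    using mult.IH(1)[OF g(1)] by blast
  have "of_real (p x * q x) * fourier f x = fourier h x" for x
    using g(2)[of x] h(2)[of x] by (simp add: mult.assoc)
  then show ?case using h(1) by blast
qed

lemma integral_fourier: "f \<in> schwartz \<Longrightarrow> (LINT x|lborel. fourier f x) = of_real ((2 * pi) ^ DIM('a)) * f (0::'a::euclidean_space)"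
  using ft_inversion[of f "-1" 0] by (simp add: fourier_eq_ft ft_def[of 1])

text \<open>Once the polynomial has been absorbed into the transform, inversion at the origin
  evaluates the integral as a multiple of the value at 0 of a function that vanishes near 0.\<close>

lemma integral_polynomial_fourier:
  fixes P :: "'a::euclidean_space \<Rightarrow> complex"
  assumes P: "polynomial_function P" and f: "f \<in> schwartz_off_zero"
  shows "(LINT x|lborel. P x * fourier f x) = 0"
proof -
  have *: "(LINT x|lborel. of_real (p x) * fourier f x) = 0" if p: "real_polynomial_function p" for p
  proof -
    obtain g where g: "g \<in> schwartz_off_zero" "\<And>x. of_real (p x) * fourier f x = fourier g x"
      using real_polynomial_mult_ft[OF p f] by blast
    then have "(LINT x|lborel. of_real (p x) * fourier f x) = of_real ((2 * pi) ^ DIM('a)) * g 0"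
      by (simp add: integral_fourier schwartz_off_zero_def)
    also have "g 0 = 0" using g(1) by (auto simp: schwartz_off_zero_def)
    finally show ?thesis by simp
  qed
  have F: "fourier f \<in> schwartz" using f by (simp add: schwartz_off_zero_def schwartz_fourier)
  have i: "integrable lborel (\<lambda>x. of_real (p x) * fourier f x)" if "real_polynomial_function p" for p
    using polynomial_integrable[OF polynomial_function_of_real[OF that] F] .
  have "(LINT x|lborel. P x * fourier f x)
      = (LINT x|lborel. of_real (Re (P x)) * fourier f x + \<i> * (of_real (Im (P x)) * fourier f x))"
    by (subst complex_eq) (simp add: algebra_simps)
  also have "\<dots> = 0"
    using i[OF polynomial_parts(1)[OF P]] i[OF polynomial_parts(2)[OF P]]
      *[OF polynomial_parts(1)[OF P]] *[OF polynomial_parts(2)[OF P]]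
    by (subst Bochner_Integration.integral_add) (auto intro: integrable_mult_right)
  finally show ?thesis .
qed


section \<open>Littlewood--Paley blocks\<close>

lemma iter_partial_zero_open:
  fixes f :: "'a::euclidean_space \<Rightarrow> complex"
  assumes "open U" "\<And>x. x \<in> U \<Longrightarrow> f x = 0"
  shows "x \<in> U \<Longrightarrow> iter_partial bs f x = 0"
proof (induction bs arbitrary: x)
  case (Cons b bs)
  have "(iter_partial bs f has_derivative (\<lambda>_. 0)) (at x)"
    by (rule has_derivative_transform_within_open[OF has_derivative_const assms(1) Cons.prems])
      (simp add: Cons.IH)
  then show ?case by (simp add: pd_eq)
qed (simp add: assms)

locale cutoff =
  fixes chi :: "'a::euclidean_space \<Rightarrow> real"
  assumes cutoff: "lp_cutoff chi"
begin

lemma chi_smooth: "smooth chi"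
  using cutoff unfolding lp_cutoff_def by (elim conjE)

lemma chi_far:
  assumes "norm x > 2" shows "chi x = 0"
proof (rule ccontr)
  assume "chi x \<noteq> 0"
  then have "x \<in> closure {x. chi x \<noteq> 0}" using closure_subset[of "{x. chi x \<noteq> 0}"] by auto
  moreover have "closure {x. chi x \<noteq> 0} \<subseteq> cball 0 2" using cutoff unfolding lp_cutoff_def by (elim conjE)
  ultimately have "x \<in> cball 0 2" by blast
  then show False using assms by simp
qed

lemma chi_near_open: obtains U where "open U" "cball 0 1 \<subseteq> U" "\<And>x. x \<in> U \<Longrightarrow> chi x = 1"
proof -
  have "\<exists>U. open U \<and> cball 0 1 \<subseteq> U \<and> (\<forall>x\<in>U. chi x = 1)" using cutoff unfolding lp_cutoff_def by (elim conjE)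
  then show ?thesis using that by blast
qed

lemma chi_near:
  assumes "norm x \<le> 1" shows "chi x = 1"
proof -
  obtain U where "cball 0 1 \<subseteq> U" "\<And>x. x \<in> U \<Longrightarrow> chi x = 1" using chi_near_open by metis
  moreover have "x \<in> cball 0 1" using assms by simp
  ultimately show ?thesis by blast
qed

lemma chi_nonneg: "0 \<le> chi x"
proof (cases "x = 0")
  case False
  then have n: "norm (sgn x) = 1" by (simp add: norm_sgn)
  have "\<forall>e. norm e = 1 \<longrightarrow> antimono_on {0..} (\<lambda>r. chi (r *\<^sub>R e))"
    using cutoff unfolding lp_cutoff_def by (elim conjE)
  with n have "antimono_on {0..} (\<lambda>r. chi (r *\<^sub>R sgn x))" by blast
  \<comment> \<open>The comparison point on the ray through \<open>x\<close> is at least as far out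
    as \<open>x\<close> and lies outside the support, so monotonicity bounds \<open>chi x\<close>
    below by 0.\<close>
  then have "chi (max (norm x) 3 *\<^sub>R sgn x) \<le> chi (norm x *\<^sub>R sgn x)"
    by (auto simp: monotone_on_def)
  moreover have "chi (max (norm x) 3 *\<^sub>R sgn x) = 0" using n by (intro chi_far) (simp add: abs_if)
  ultimately show ?thesis using False by (simp add: sgn_div_norm)
qed (simp add: chi_near)

text \<open>For \<open>t > 0\<close> the function lives on the ball of radius 2/t and equals 1 on
  the ball of radius 1/t, so a large \<open>t\<close> means low frequencies.\<close>

definition cut :: "real \<Rightarrow> 'a \<Rightarrow> complex" where
  "cut t \<xi> = of_real (chi (t *\<^sub>R \<xi>))"

lemma cut_smooth: "smooth (cut t)"
  using smooth_of_real[OF smooth_affine[OF chi_smooth, of t 0]] by (simp add: cut_def[abs_def])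

lemma cut_scale: "cut t (r *\<^sub>R \<xi>) = cut (t * r) \<xi>"
  by (simp add: cut_def)

lemma cut_near: "\<bar>t\<bar> * norm \<xi> \<le> 1 \<Longrightarrow> cut t \<xi> = 1"
  by (simp add: cut_def chi_near)

lemma cut_far: "\<bar>t\<bar> * norm \<xi> > 2 \<Longrightarrow> cut t \<xi> = 0"
  by (simp add: cut_def chi_far)

lemma cut_schwartz:
  assumes "t \<noteq> 0" shows "cut t \<in> schwartz"
proof (rule schwartz_compact_support[OF cut_smooth])
  show "cut t x = 0" if "norm x > 2 / \<bar>t\<bar>" for x
    using that assms by (intro cut_far) (simp add: field_simps)
qed

definition phi :: "int \<Rightarrow> 'a \<Rightarrow> complex" where
  "phi m \<xi> = of_real (lp_phi chi ((2 powi (- m)) *\<^sub>R \<xi>))"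

lemma phi_eq: "phi m \<xi> = cut (2 powi (- m)) \<xi> - cut (2 * 2 powi (- m)) \<xi>"
  by (simp add: phi_def lp_phi_def cut_def)

lemma phi_schwartz: "phi m \<in> schwartz"
  using schwartz_add[OF cut_schwartz[of "2 powi (- m)"] schwartz_cmult[OF cut_schwartz[of "2 * 2 powi (- m)"], of "-1"]]
  by (simp add: phi_eq[abs_def])

lemma phi_mult_off_zero:
  assumes "f \<in> schwartz" shows "(\<lambda>\<xi>. phi m \<xi> * f \<xi>) \<in> schwartz_off_zero"
proof -
  have "phi m \<xi> = 0" if "norm \<xi> < 1 / (2 * 2 powi (- m))" for \<xi>
  proof -
    have "2 * 2 powi (- m) * norm \<xi> < (1::real)" using that by (simp add: field_simps)
    moreover have "2 powi (- m) * norm \<xi> \<le> 2 * 2 powi (- m) * norm \<xi>" by (simp add: mult_right_mono)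
    ultimately show ?thesis by (simp add: phi_eq cut_near abs_mult)
  qed
  then have "\<forall>\<xi>. norm \<xi> < 1 / (2 * 2 powi (- m)) \<longrightarrow> phi m \<xi> * f \<xi> = 0" by simp
  moreover have "1 / (2 * 2 powi (- m)) > (0::real)" by simp
  ultimately have "\<exists>r>0. \<forall>\<xi>. norm \<xi> < r \<longrightarrow> phi m \<xi> * f \<xi> = 0" by blast
  then show ?thesis
    unfolding schwartz_off_zero_def using schwartz_mult'[OF phi_schwartz assms] by simp
qed

lemma phi_mult_schwartz: "f \<in> schwartz \<Longrightarrow> (\<lambda>\<xi>. phi m \<xi> * f \<xi>) \<in> schwartz"
  by (intro schwartz_mult' phi_schwartz)

text \<open>By duality the three operators defining a block act on the test function in the reverse
  order. Everything about blocks is read off from this formula.\<close>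

lemma dyadic_block_apply:
  "dyadic_block chi m u f = (if f \<in> schwartz then u (fourier (\<lambda>\<xi>. phi m \<xi> * inv_fourier f \<xi>)) else 0)"
  unfolding dyadic_block_def fourier_multiplier_def inv_fourier_distr_def mult_distr_def
    fourier_distr_def on_schwartz_def
  using phi_mult_schwartz[OF schwartz_inv_fourier, of f m]
  by (auto simp: schwartz_inv_fourier phi_def)

lemma dyadic_block_polynomial: "u \<in> polynomial_distrs \<Longrightarrow> dyadic_block chi m u = (\<lambda>f. 0)"
proof
  fix f assume "u \<in> polynomial_distrs"
  then obtain P where P: "polynomial_function P" "u = distr_of P" by (auto simp: polynomial_distrs_def)
  show "dyadic_block chi m u f = 0"
    using integral_polynomial_fourier[OF P(1) phi_mult_off_zero[OF schwartz_inv_fourier]]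
    by (simp add: dyadic_block_apply P distr_of_apply schwartz_fourier phi_mult_schwartz schwartz_inv_fourier)
qed

lemma dyadic_block_add: "dyadic_block chi m (\<lambda>f. u f + v f) = (\<lambda>f. dyadic_block chi m u f + dyadic_block chi m v f)"
  and dyadic_block_scale: "dyadic_block chi m (\<lambda>f. c * u f) = (\<lambda>f. c * dyadic_block chi m u f)"
  and dyadic_block_diff: "dyadic_block chi m (\<lambda>f. u f - v f) = (\<lambda>f. dyadic_block chi m u f - dyadic_block chi m v f)"
  by (auto simp: dyadic_block_apply)

end

interpretation TP: csubspace_of "tempered :: 'a::euclidean_space functional cspace" polynomial_distrs
  by (intro csubspace_of.intro csubspace_of_axioms.intro tempered_cvector_space polynomial_distrs_subspace)

context cutoff begin

text \<open>Members of a class differ by polynomials, which blocks annihilate, so the image of the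
  class is a singleton and \<open>the_elem\<close> is legitimate.\<close>

lemma dyadic_block_class_coset:
  "dyadic_block_class chi m (coset tempered polynomial_distrs u) = dyadic_block chi m u"
proof -
  have "dyadic_block chi m ` coset tempered polynomial_distrs u = {dyadic_block chi m u}"
    unfolding coset_def image_image tempered_sub dyadic_block_diff
    using TP.C_zero by (auto simp: dyadic_block_polynomial)
  then show ?thesis by (simp add: dyadic_block_class_def)
qed

text \<open>The difference vanishes for \<open>norm \<xi> < R\<close>, and outside this ball one
  additional order of decay of \<open>f\<close> is worth the factor 1/R. Derivatives of the rescaled
  cut-off do not grow because \<open>R \<ge> 1\<close>.\<close>

lemma cut_approx_unit:
  assumes f: "f \<in> schwartz"
  shows "\<exists>D. \<forall>R\<ge>1. schwartz_bound M M (D / R) (\<lambda>\<xi>. f \<xi> - cut (1 / R) \<xi> * f \<xi>)"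
proof -
  define h where "h \<xi> = 1 + (-1) * cut 1 \<xi>" for \<xi>
  have hs: "smooth h" unfolding h_def by (intro smooth_add smooth_const smooth_cmult cut_smooth)
  obtain A where A: "schwartz_bound 0 M A (cut 1)" using schwartz_boundE[OF cut_schwartz] by (metis one_neq_zero)
  have one: "schwartz_bound 0 n 1 (\<lambda>\<xi>::'a. 1)" for n
  proof (induction n)
    case (Suc n)
    have "schwartz_bound 0 n 0 (\<lambda>x::'a. 0)"
      using schwartz_bound_cmult[OF Suc smooth_const, of 0] by simp
    then have "schwartz_bound 0 n 1 (\<lambda>x::'a. 0)" by (rule schwartz_bound_mono) auto
    then show ?case using Suc by (simp add: schwartz_bound_Suc schwartz_bound_0 pd_eq[OF has_derivative_const])
  qed (simp add: schwartz_bound_0)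
  have hb: "schwartz_bound 0 M (1 + A) h"
    using schwartz_bound_add[OF one schwartz_bound_cmult[OF A cut_smooth, of "-1"] smooth_const smooth_cmult[OF cut_smooth]]
    by (simp add: h_def[abs_def])
  have A1: "1 + A \<ge> 0" using hb by (rule schwartz_bound_nonneg)
  obtain B where B: "schwartz_bound (Suc M) M B f" using schwartz_boundE[OF f] by blast
  have B0: "B \<ge> 0" using B by (rule schwartz_bound_nonneg)
  have fs: "smooth f" using f by (rule schwartz_smooth)
  define D where "D = 2 ^ M * (1 + A) * B"
  have D0: "D \<ge> 0" using A1 B0 by (simp add: D_def)
  have "schwartz_bound M M (D / R) (\<lambda>\<xi>. f \<xi> - cut (1 / R) \<xi> * f \<xi>)" if R: "R \<ge> 1" for R
    unfolding schwartz_bound_def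
  proof (intro ballI impI allI)
    fix bs :: "'a list" and \<xi> :: 'a assume bs: "bs \<in> lists Basis" "length bs \<le> M"
    let ?h = "\<lambda>\<xi>. h ((1 / R) *\<^sub>R \<xi> + 0)"
    have eq: "(\<lambda>\<xi>. f \<xi> - cut (1 / R) \<xi> * f \<xi>) = (\<lambda>\<xi>. ?h \<xi> * f \<xi>)"
      using R by (simp add: h_def fun_eq_iff algebra_simps cut_scale)
    show "(1 + norm \<xi>) ^ M * cmod (iter_partial bs (\<lambda>\<xi>. f \<xi> - cut (1 / R) \<xi> * f \<xi>) \<xi>) \<le> D / R"
    proof (cases "norm \<xi> < R")
      case True
      have "open {x::'a. norm x < R}" by (intro open_Collect_less continuous_intros)
      then have "iter_partial bs (\<lambda>\<xi>. f \<xi> - cut (1 / R) \<xi> * f \<xi>) \<xi> = 0"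
        by (rule iter_partial_zero_open) (use True R in \<open>auto simp: cut_near field_simps\<close>)
      then show ?thesis using D0 R by simp
    next
      case False
      let ?w = "1 + norm \<xi>"
      have "cmod (iter_partial bs (\<lambda>\<xi>. ?h \<xi> * f \<xi>) \<xi>) \<le> 2 ^ length bs * (1 + A) * (B / ?w ^ Suc M)"
      proof (rule iter_partial_mult_bound[OF smooth_affine[OF hs] fs _ _ bs])
        fix cs :: "'a list" assume cs: "cs \<in> lists Basis" "length cs \<le> M"
        have "cmod (iter_partial cs ?h \<xi>) = (1 / R) ^ length cs * cmod (iter_partial cs h ((1 / R) *\<^sub>R \<xi> + 0))"
          using R by (subst iter_partial_affine[OF hs cs(1)]) (simp add: norm_mult norm_power norm_divide)
        also have "\<dots> \<le> 1 * cmod (iter_partial cs h ((1 / R) *\<^sub>R \<xi> + 0))"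
          using R by (intro mult_right_mono power_le_one) auto
        also have "\<dots> \<le> 1 + A" using hb cs unfolding schwartz_bound_def by auto
        finally show "cmod (iter_partial cs ?h \<xi>) \<le> 1 + A" .
        have "?w ^ Suc M * cmod (iter_partial cs f \<xi>) \<le> B" using B cs unfolding schwartz_bound_def by blast
        then show "cmod (iter_partial cs f \<xi>) \<le> B / ?w ^ Suc M"
          by (simp add: field_simps add_pos_nonneg)
      qed
      also have "\<dots> \<le> 2 ^ M * (1 + A) * (B / ?w ^ Suc M)"
        using A1 B0 bs by (intro mult_right_mono power_increasing) auto
      finally have "?w ^ M * cmod (iter_partial bs (\<lambda>\<xi>. ?h \<xi> * f \<xi>) \<xi>)
          \<le> ?w ^ M * (2 ^ M * (1 + A) * (B / ?w ^ Suc M))" by (intro mult_left_mono) auto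
      also have "\<dots> = D / ?w"
      proof -
        have "w ^ M * (X * (B / w ^ Suc M)) = X * B / w" if "w > 0" for w X :: real
          using that by (simp add: field_simps)
        then show ?thesis unfolding D_def by (simp add: add_pos_nonneg)
      qed
      also have "\<dots> \<le> D / R" using False D0 R by (intro divide_left_mono) (auto simp: add_pos_nonneg)
      finally show ?thesis unfolding eq .
    qed
  qed
  then show ?thesis by blast
qed

text \<open>A Taylor estimate run downwards from order \<open>M + 1\<close>, where the derivatives
  are merely bounded. Each lower derivative vanishes at the origin, so the mean value inequality on
  the ball of radius \<open>norm \<xi>\<close> gains one power of \<open>norm \<xi>\<close>. The
  operator norm is estimated by the sum over the basis, whence the factor \<open>DIM('a)\<close> in
  each step.\<close>

lemma vanishing_order_bound:
  fixes f :: "'a \<Rightarrow> complex"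
  assumes f: "f \<in> schwartz"
    and zero: "\<And>bs. \<lbrakk>bs \<in> lists Basis; length bs \<le> M\<rbrakk> \<Longrightarrow> iter_partial bs f 0 = 0"
  shows "j \<le> Suc M \<Longrightarrow> \<exists>D\<ge>0. \<forall>bs\<in>lists Basis. length bs = Suc M - j \<longrightarrow>
    (\<forall>\<xi>. cmod (iter_partial bs f \<xi>) \<le> D * norm \<xi> ^ j)"
proof (induction j)
  case 0
  obtain B where B: "schwartz_bound 0 (Suc M) B f" using schwartz_boundE[OF f] by blast
  have "\<forall>bs\<in>lists Basis. length bs = Suc M - 0 \<longrightarrow> (\<forall>\<xi>. cmod (iter_partial bs f \<xi>) \<le> B * norm \<xi> ^ 0)"
    using B unfolding schwartz_bound_def by simp
  then show ?case using schwartz_bound_nonneg[OF B] by blast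
next
  case (Suc j)
  then obtain D where D: "D \<ge> 0" "\<And>bs \<xi>. \<lbrakk>bs \<in> lists Basis; length bs = Suc M - j\<rbrakk>
      \<Longrightarrow> cmod (iter_partial bs f \<xi>) \<le> D * norm \<xi> ^ j" by (meson Suc_leD)
  have "cmod (iter_partial bs f \<xi>) \<le> (DIM('a) * D) * norm \<xi> ^ Suc j"
    if bs: "bs \<in> lists Basis" "length bs = Suc M - Suc j" for bs \<xi>
  proof -
    let ?g = "iter_partial bs f"
    have d: "?g differentiable (at x)" for x
      using schwartz_smooth[OF f] bs unfolding smooth_def by blast
    have "norm (?g \<xi> - ?g 0) \<le> (DIM('a) * D * norm \<xi> ^ j) * norm (\<xi> - 0)"
    proof (rule differentiable_bound[where S = "cball 0 (norm \<xi>)"])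
      fix x :: 'a assume x: "x \<in> cball 0 (norm \<xi>)"
      show "(?g has_derivative frechet_derivative ?g (at x)) (at x within cball 0 (norm \<xi>))"
        using d[of x] by (simp add: frechet_derivative_works has_derivative_at_withinI)
      have "bounded_linear (frechet_derivative ?g (at x))"
        using d[of x] frechet_derivative_works has_derivative_bounded_linear by blast
      then have "onorm (frechet_derivative ?g (at x)) \<le> (\<Sum>b\<in>Basis. norm (frechet_derivative ?g (at x) b))"
        by (rule onorm_componentwise)
      also have "\<dots> \<le> (\<Sum>b\<in>(Basis::'a set). D * norm \<xi> ^ j)"
      proof (rule sum_mono)
        fix b :: 'a assume b: "b \<in> Basis"
        have "cmod (iter_partial (b # bs) f x) \<le> D * norm x ^ j"
          using b bs Suc.prems by (intro D) auto
        also have "\<dots> \<le> D * norm \<xi> ^ j" using x D(1) by (intro mult_left_mono power_mono) auto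
        finally show "norm (frechet_derivative ?g (at x) b) \<le> D * norm \<xi> ^ j" by simp
      qed
      finally show "onorm (frechet_derivative ?g (at x)) \<le> DIM('a) * D * norm \<xi> ^ j" by (simp add: mult_ac)
    qed auto
    moreover have "?g 0 = 0" using zero bs by simp
    ultimately show ?thesis by (simp add: mult_ac)
  qed
  then show ?case using D(1) by (intro exI[of _ "DIM('a) * D"]) auto
qed

text \<open>In the rescaled variable \<open>\<eta> = T \<xi>\<close>, which stays in the ball of
  radius 2, all derivatives of \<open>f (\<eta> / T)\<close> up to order \<open>M\<close> are of
  size T^(-M-1): an order not spent on differentiation yields a power of \<open>norm \<xi>\<close>
  instead. Scaling back costs at most T^M, and the factor 1/T remains.\<close>

lemma cut_vanishing:
  fixes f :: "'a \<Rightarrow> complex"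
  assumes f: "f \<in> schwartz"
    and zero: "\<And>bs. \<lbrakk>bs \<in> lists Basis; length bs \<le> M\<rbrakk> \<Longrightarrow> iter_partial bs f 0 = 0"
  shows "\<exists>D. \<forall>T\<ge>1. schwartz_bound M M (D / T) (\<lambda>\<xi>. cut T \<xi> * f \<xi>)"
proof -
  obtain A where A: "schwartz_bound 0 M A (cut 1)" using schwartz_boundE[OF cut_schwartz] by (metis one_neq_zero)
  have A0: "A \<ge> 0" using A by (rule schwartz_bound_nonneg)
  have fs: "smooth f" using f by (rule schwartz_smooth)
  have "\<exists>E. \<forall>j\<in>{..Suc M}. E j \<ge> 0 \<and> (\<forall>bs\<in>lists Basis. length bs = Suc M - j \<longrightarrow>
    (\<forall>\<xi>. cmod (iter_partial bs f \<xi>) \<le> E j * norm \<xi> ^ j))"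
    using vanishing_order_bound[OF f zero] by (intro bchoice) blast
  then obtain E where E: "\<And>j. j \<le> Suc M \<Longrightarrow> E j \<ge> 0"
    "\<And>j bs \<xi>. \<lbrakk>j \<le> Suc M; bs \<in> lists Basis; length bs = Suc M - j\<rbrakk>
       \<Longrightarrow> cmod (iter_partial bs f \<xi>) \<le> E j * norm \<xi> ^ j"
    by (metis atMost_iff)
  define F where "F = (\<Sum>j\<le>Suc M. E j)"
  have F: "E j \<le> F" if "j \<le> Suc M" for j
    unfolding F_def using that E(1) by (intro member_le_sum) auto
  have F0: "F \<ge> 0" using F[of 0] E(1)[of 0] by simp
  \<comment> \<open>3^M bounds the weight where \<open>norm \<xi> \<le> 2\<close>, 2^M comes from
    the Leibniz rule, \<open>A\<close> from the cut-off, and 2^(M+1) from the powers of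
    \<open>norm \<eta> \<le> 2\<close>.\<close>
  define D where "D = 3 ^ M * (2 ^ M * A * (F * 2 ^ Suc M))"
  have D0: "D \<ge> 0" using A0 F0 by (simp add: D_def)
  have "schwartz_bound M M (D / T) (\<lambda>\<xi>. cut T \<xi> * f \<xi>)" if T: "T \<ge> 1" for T
    unfolding schwartz_bound_def
  proof (intro ballI impI allI)
    fix bs :: "'a list" and \<xi> :: 'a assume bs: "bs \<in> lists Basis" "length bs \<le> M"
    show "(1 + norm \<xi>) ^ M * cmod (iter_partial bs (\<lambda>\<xi>. cut T \<xi> * f \<xi>) \<xi>) \<le> D / T"
    proof (cases "T * norm \<xi> > 2")
      case True
      have "open {x::'a. T * norm x > 2}" by (intro open_Collect_less continuous_intros)
      then have "iter_partial bs (\<lambda>\<xi>. cut T \<xi> * f \<xi>) \<xi> = 0"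
        by (rule iter_partial_zero_open) (use True T in \<open>auto simp: cut_far\<close>)
      then show ?thesis using D0 T by simp
    next
      case False
      define \<eta> where "\<eta> = T *\<^sub>R \<xi>"
      have \<eta>: "norm \<eta> \<le> 2" using False T by (simp add: \<eta>_def)
      let ?f = "\<lambda>\<eta>. f ((1 / T) *\<^sub>R \<eta> + 0)"
      let ?g = "\<lambda>\<eta>. cut 1 \<eta> * ?f \<eta>"
      have gs: "smooth ?g" by (intro smooth_mult cut_smooth smooth_affine fs)
      have eq: "(\<lambda>\<xi>. cut T \<xi> * f \<xi>) = (\<lambda>\<xi>. ?g (T *\<^sub>R \<xi> + 0))"
        using T by (simp add: fun_eq_iff cut_scale)
      have g: "cmod (iter_partial bs ?g \<eta>) \<le> 2 ^ length bs * A * (F * 2 ^ Suc M / T ^ Suc M)"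
      proof (rule iter_partial_mult_bound[OF cut_smooth smooth_affine[OF fs] _ _ bs])
        fix cs :: "'a list" assume cs: "cs \<in> lists Basis" "length cs \<le> M"
        show "cmod (iter_partial cs (cut 1) \<eta>) \<le> A" using A cs unfolding schwartz_bound_def by force
        define j where "j = Suc M - length cs"
        have j: "j \<le> Suc M" "length cs = Suc M - j" "length cs + j = Suc M" using cs by (auto simp: j_def)
        have "cmod (iter_partial cs ?f \<eta>) = (1 / T) ^ length cs * cmod (iter_partial cs f ((1 / T) *\<^sub>R \<eta> + 0))"
          using T by (subst iter_partial_affine[OF fs cs(1)]) (simp add: norm_mult norm_power norm_divide)
        also have "\<dots> \<le> (1 / T) ^ length cs * (E j * norm ((1 / T) *\<^sub>R \<eta> + 0) ^ j)"
          using T by (intro mult_left_mono E(2) j cs) auto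
        also have "\<dots> \<le> (1 / T) ^ length cs * (F * (2 / T) ^ j)"
          using T \<eta> F[OF j(1)] F0 E(1)[OF j(1)]
          by (intro mult_left_mono mult_mono power_mono) (auto simp: divide_right_mono)
        also have "\<dots> = F * 2 ^ j / T ^ Suc M"
          using T by (simp add: power_divide power_add[symmetric] j(3) del: power_Suc)
        also have "\<dots> \<le> F * 2 ^ Suc M / T ^ Suc M"
          using T F0 j by (intro divide_right_mono mult_left_mono power_increasing) auto
        finally show "cmod (iter_partial cs ?f \<eta>) \<le> F * 2 ^ Suc M / T ^ Suc M" .
      qed
      also have "\<dots> \<le> 2 ^ M * A * (F * 2 ^ Suc M / T ^ Suc M)"
        using A0 F0 bs T by (intro mult_right_mono power_increasing) auto
      finally have g: "cmod (iter_partial bs ?g \<eta>) \<le> 2 ^ M * A * (F * 2 ^ Suc M / T ^ Suc M)" .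
      have n3: "1 + norm \<xi> \<le> 3"
      proof -
        have "1 * norm \<xi> \<le> T * norm \<xi>" using T by (intro mult_right_mono) auto
        then show ?thesis using False by simp
      qed
      have "cmod (iter_partial bs (\<lambda>\<xi>. cut T \<xi> * f \<xi>) \<xi>) = T ^ length bs * cmod (iter_partial bs ?g \<eta>)"
        unfolding eq using T
        by (subst iter_partial_affine[OF gs bs(1)]) (simp add: norm_mult norm_power \<eta>_def)
      also have "\<dots> \<le> T ^ M * (2 ^ M * A * (F * 2 ^ Suc M / T ^ Suc M))"
        using g T bs by (intro mult_mono power_increasing) auto
      finally have "(1 + norm \<xi>) ^ M * cmod (iter_partial bs (\<lambda>\<xi>. cut T \<xi> * f \<xi>) \<xi>)
          \<le> 3 ^ M * (T ^ M * (2 ^ M * A * (F * 2 ^ Suc M / T ^ Suc M)))"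
        using n3 by (intro mult_mono power_mono) auto
      also have "\<dots> = D / T" using T by (simp add: D_def field_simps)
      finally show ?thesis .
    qed
  qed
  then show ?thesis by blast
qed

end

section \<open>Distributions with Fourier transform supported at the origin\<close>

lemma iter_partial_ft:
  fixes f :: "'a::euclidean_space \<Rightarrow> complex"
  shows "\<lbrakk>f \<in> schwartz; bs \<in> lists Basis\<rbrakk>
    \<Longrightarrow> iter_partial bs (ft 1 f) \<xi> = ft 1 (\<lambda>x. \<i> ^ length bs * of_real (\<Prod>b\<leftarrow>bs. x \<bullet> b) * f x) \<xi>"
proof (induction bs arbitrary: f rule: rev_induct)
  case (snoc b bs)
  then have "iter_partial (bs @ [b]) (ft 1 f) \<xi> = iter_partial bs (ft 1 (\<lambda>x. \<i> * of_real 1 * (of_real (x \<bullet> b) * f x))) \<xi>"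
    by (simp add: iter_partial_snoc pd_ft)
  also have "\<dots> = ft 1 (\<lambda>x. \<i> ^ length bs * of_real (\<Prod>b\<leftarrow>bs. x \<bullet> b) * (\<i> * of_real 1 * (of_real (x \<bullet> b) * f x))) \<xi>"
    using snoc.prems by (intro snoc.IH schwartz_cmult schwartz_coord_mult) auto
  finally show ?case by (simp add: mult_ac)
qed simp

lemma real_polynomial_prod_list: "real_polynomial_function (\<lambda>x::'a::euclidean_space. \<Prod>b\<leftarrow>bs. x \<bullet> b)"
  by (induction bs) (auto intro!: real_polynomial_function.intros(2,4)
      real_polynomial_function.intros(1)[OF bounded_linear_inner_left])

text \<open>A derivative of the inverse transform at the origin is a moment of \<open>f\<close>,
  that is, its pairing with a monomial up to a constant. Vanishing conditions at the origin thus
  become conditions given by polynomial functionals.\<close>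

lemma iter_partial_inv_fourier_0:
  assumes bs: "bs \<in> lists (Basis :: 'a::euclidean_space set)"
  shows "\<exists>l. l \<in> (polynomial_distrs :: 'a functional set) \<and>
    (\<forall>f\<in>schwartz. l f = 0 \<longrightarrow> iter_partial bs (inv_fourier f) 0 = 0)"
proof (intro exI conjI ballI impI)
  let ?P = "\<lambda>x::'a. \<i> ^ length bs * complex_of_real (\<Prod>b\<leftarrow>bs. x \<bullet> b)"
  show "distr_of ?P \<in> polynomial_distrs"
    unfolding polynomial_distrs_def
    using polynomial_function_cmult_complex[OF polynomial_function_of_real[OF real_polynomial_prod_list]] by blast
  fix f :: "'a \<Rightarrow> complex" assume f: "f \<in> schwartz" and 0: "distr_of ?P f = 0"
  have "inv_fourier f = (\<lambda>x. inverse (two_pi_pow TYPE('a)) * ft 1 f x)"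
    by (simp add: inv_fourier_eq_ft divide_inverse mult.commute)
  then have "iter_partial bs (inv_fourier f) 0 = inverse (two_pi_pow TYPE('a)) * iter_partial bs (ft 1 f) 0"
    using iter_partial_cmult[OF smooth_ft[OF f] bs] by metis
  also have "iter_partial bs (ft 1 f) 0 = distr_of ?P f"
    unfolding iter_partial_ft[OF f bs] by (simp add: ft_def distr_of_apply f)
  finally show "iter_partial bs (inv_fourier f) 0 = 0" using 0 by simp
qed

text \<open>Linear algebra: a functional that vanishes on the common kernel of finitely many
  functionals is a linear combination of them, hence a polynomial if they all are. In the induction,
  a \<open>g\<close> killed by \<open>L\<close> but not by \<open>l0\<close> determines the
  coefficient of \<open>l0\<close>; if there is none, \<open>l0\<close> adds no condition.\<close>

lemma kernel_intersection_polynomial: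
  fixes L :: "'a::euclidean_space functional set"
  assumes "finite L" "L \<subseteq> polynomial_distrs"
  shows "\<lbrakk>w \<in> vcarrier tempered; \<And>f. \<lbrakk>f \<in> schwartz; \<forall>l\<in>L. l f = 0\<rbrakk> \<Longrightarrow> w f = 0\<rbrakk>
    \<Longrightarrow> w \<in> polynomial_distrs"
  using assms
proof (induction L arbitrary: w rule: finite_induct)
  case empty
  have "w f = 0" for f using empty(2)[of f] tempered_outside[OF empty(1)] by (cases "f \<in> schwartz") auto
  then have "w = vscale tempered 0 w" by (simp add: tempered_scale fun_eq_iff)
  then show ?case using TP.C_zero TP.scale_zero[OF empty(1)] by metis
next
  case (insert l0 L)
  have l0: "l0 \<in> polynomial_distrs" and lt: "\<And>l. l \<in> insert l0 L \<Longrightarrow> l \<in> vcarrier tempered"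
    using insert.prems TP.C_carrier by auto
  show ?case
  proof (cases "\<exists>g\<in>schwartz. (\<forall>l\<in>L. l g = 0) \<and> l0 g \<noteq> 0")
    case True
    then obtain g where g: "g \<in> schwartz" "\<And>l. l \<in> L \<Longrightarrow> l g = 0" "l0 g \<noteq> 0" by blast
    define k where "k = vscale tempered (w g / l0 g) l0"
    have k: "k \<in> polynomial_distrs" unfolding k_def using TP.C_scale l0 by blast
    have "vsub tempered w k \<in> polynomial_distrs"
    proof (rule insert.IH)
      show "vsub tempered w k \<in> vcarrier tempered"
        by (rule TP.sub_closed[OF insert.prems(1) TP.C_carrier[OF k]])
      fix f :: "'a \<Rightarrow> complex" assume f: "f \<in> schwartz" "\<forall>l\<in>L. l f = 0"
      \<comment> \<open>The projection of \<open>f\<close> along \<open>g\<close> onto the kernel of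
        \<open>l0\<close>; it remains in the kernels of the members of \<open>L\<close>.\<close>
      define h where "h x = f x - (l0 f / l0 g) * g x" for x
      have h: "h \<in> schwartz" unfolding h_def
        using schwartz_add[OF f(1) schwartz_cmult[OF g(1), of "- (l0 f / l0 g)"]] by simp
      have eval: "l h = l f - (l0 f / l0 g) * l g" if "l \<in> vcarrier tempered" for l
        unfolding h_def using tempered_diff[OF that f(1) schwartz_cmult[OF g(1)]] tempered_mult[OF that g(1)] by (simp only:)
      have "l h = 0" if l: "l \<in> insert l0 L" for l
        using eval[OF lt[OF l]] l f(2) g by auto
      then have "w h = 0" using insert.prems(2)[OF h] by blast
      then show "vsub tempered w k f = 0"
        using eval[OF insert.prems(1)] by (simp add: tempered_sub k_def tempered_scale)
    qed (use insert.prems in auto)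
    then have "vadd tempered (vsub tempered w k) k \<in> polynomial_distrs" using k TP.C_add by blast
    then show ?thesis using TP.sub_add_cancel[OF insert.prems(1) TP.C_carrier[OF k]] by simp
  next
    case False
    show ?thesis
      by (rule insert.IH[OF insert.prems(1)]) (use insert.prems False in auto)
  qed
qed

context cutoff begin

text \<open>A distribution whose Fourier transform is supported at the origin is a polynomial: by
  telescoping, \<open>u (fourier (cut T * f))\<close> does not depend on the dyadic number \<open>T\<close>, and it tends to
  \<open>u (fourier f)\<close> for \<open>T \<rightarrow> 0\<close> and to \<open>0\<close> for \<open>T \<rightarrow> \<infinity>\<close> if \<open>f\<close> vanishes to high order at \<open>0\<close>.\<close>

theorem blocks_zero_imp_polynomial:
  assumes u: "u \<in> vcarrier tempered" and blocks: "\<And>m. dyadic_block chi m u = (\<lambda>f. 0)"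
  shows "u \<in> polynomial_distrs"
proof -
  \<comment> \<open>Evaluating the block at \<open>fourier f\<close> cancels the inverse transform
    inside the block, so every Schwartz function is reached on the frequency side.\<close>
  have z: "u (fourier (\<lambda>\<xi>. phi m \<xi> * f \<xi>)) = 0" if f: "f \<in> schwartz" for m f
    using fun_cong[OF blocks, of m "fourier f"] f
    by (simp add: dyadic_block_apply schwartz_fourier inv_fourier_fourier)
  obtain K N where K: "K \<ge> 0" "\<And>f. f \<in> schwartz \<Longrightarrow> norm (u f) \<le> K * schwartz_norm N f"
    using tempered_bound[OF u] by blast
  \<comment> \<open>\<open>M\<close> is the order of a seminorm on the frequency side that dominates
    \<open>u\<close>; it is also the order to which \<open>f\<close> has to vanish at the origin
    below.\<close>
  obtain C M where C: "\<And>f A. \<lbrakk>f \<in> schwartz; schwartz_bound M M A f\<rbrakk>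
      \<Longrightarrow> schwartz_bound N N (C * A) (ft (-1) (f :: 'a \<Rightarrow> complex))"
    using schwartz_bound_ft[of "-1" N N, where 'a = 'a] by auto
  have ub: "norm (u (fourier f)) \<le> K * C * A" if "f \<in> schwartz" "schwartz_bound M M A f" for f A
  proof -
    have "norm (u (fourier f)) \<le> K * schwartz_norm N (fourier f)" using that by (intro K(2) schwartz_fourier)
    also have "\<dots> \<le> K * (C * A)"
      using K(1) C[OF that] unfolding fourier_eq_ft by (intro mult_left_mono schwartz_norm_le)
    finally show ?thesis by (simp add: mult.assoc)
  qed
  have fd: "u (fourier (\<lambda>x. f x - g x)) = u (fourier f) - u (fourier g)"
    if "f \<in> schwartz" "g \<in> schwartz" for f g
  proof -
    have "fourier (\<lambda>x. f x - g x) = (\<lambda>x. fourier f x - fourier g x)"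
      using that ft_add[of f "\<lambda>x. -1 * g x" "-1"] ft_cmult[of "-1" "-1" g]
      by (simp add: fun_eq_iff fourier_eq_ft schwartz_integrable)
    then show ?thesis using tempered_diff[OF u] that by (simp add: schwartz_fourier)
  qed
  have cf: "(\<lambda>\<xi>. cut t \<xi> * f \<xi>) \<in> schwartz" if "t \<noteq> 0" "f \<in> schwartz" for t f
    using that by (intro schwartz_mult' cut_schwartz)
  have zero: "u (fourier f) = 0"
    if f: "f \<in> schwartz" and van: "\<And>bs. \<lbrakk>bs \<in> lists Basis; length bs \<le> M\<rbrakk> \<Longrightarrow> iter_partial bs f 0 = 0" for f
  proof -
    define a where "a t = u (fourier (\<lambda>\<xi>. cut t \<xi> * f \<xi>))" for t
    have "a (2 powi (- m)) = a (2 * 2 powi (- m))" for m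
      using z[OF f, of m] fd[OF cf[OF _ f] cf[OF _ f], of "2 powi (- m)" "2 * 2 powi (- m)"]
      unfolding phi_eq by (simp add: a_def left_diff_distrib)
    note step = this
    have up: "a (2 ^ n) = a 1" for n
    proof (induction n)
      case (Suc n) then show ?case using step[of "- int n"] by (simp add: power_int_of_nat)
    qed simp
    have dn: "a (1 / 2 ^ n) = a 1" for n
    proof (induction n)
      case (Suc n)
      have "a (1 / 2 ^ Suc n) = a (2 * (1 / 2 ^ Suc n))"
        using step[of "int (Suc n)"] by (simp add: power_int_minus power_int_of_nat inverse_eq_divide del: of_nat_Suc power_Suc)
      also have "2 * (1 / 2 ^ Suc n) = (1 / 2 ^ n :: real)" by simp
      finally show ?case using Suc by simp
    qed simp
    have inf: "(\<lambda>n. D / 2 ^ n) \<longlonglongrightarrow> 0" for D :: real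
      using tendsto_mult_right_zero[OF LIMSEQ_power_zero[of "1/2 :: real"], of D] by (simp add: power_one_over)
    obtain D where D: "\<And>T. T \<ge> 1 \<Longrightarrow> schwartz_bound M M (D / T) (\<lambda>\<xi>. cut T \<xi> * f \<xi>)"
      using cut_vanishing[OF f van] by blast
    have "norm (a 1) \<le> K * C * (D / 2 ^ n)" for n
      using ub[OF cf[OF _ f] D, of "2 ^ n"] up[of n] by (simp add: a_def)
    moreover have "(\<lambda>n. K * C * (D / 2 ^ n)) \<longlonglongrightarrow> 0" by (intro tendsto_mult_right_zero inf)
    ultimately have "norm (a 1) \<le> 0" by (intro LIMSEQ_le_const[of _ 0]) auto
    then have a1: "a 1 = 0" by simp
    obtain E where E: "\<And>R. R \<ge> 1 \<Longrightarrow> schwartz_bound M M (E / R) (\<lambda>\<xi>. f \<xi> - cut (1 / R) \<xi> * f \<xi>)"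
      using cut_approx_unit[OF f] by blast
    have "norm (u (fourier f)) \<le> K * C * (E / 2 ^ n)" for n
    proof -
      have "(\<lambda>\<xi>. f \<xi> - cut (1 / 2 ^ n) \<xi> * f \<xi>) \<in> schwartz"
        using schwartz_add[OF f schwartz_cmult[OF cf[OF _ f, of "1 / 2 ^ n"], of "-1"]] by simp
      from ub[OF this E] fd[OF f cf[OF _ f, of "1 / 2 ^ n"]] dn[of n] a1
      show ?thesis by (simp add: a_def)
    qed
    moreover have "(\<lambda>n. K * C * (E / 2 ^ n)) \<longlonglongrightarrow> 0" by (intro tendsto_mult_right_zero inf)
    ultimately have "norm (u (fourier f)) \<le> 0" by (intro LIMSEQ_le_const[of _ 0]) auto
    then show ?thesis by simp
  qed
  \<comment> \<open>Vanishing to order \<open>M\<close> is imposed by finitely many polynomial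
    functionals, so \<open>u\<close> vanishes on the intersection of finitely many kernels.\<close>
  let ?S = "{bs \<in> lists (Basis :: 'a set). length bs \<le> M}"
  have "\<exists>l. \<forall>bs\<in>?S. l bs \<in> polynomial_distrs \<and>
      (\<forall>f\<in>schwartz. l bs f = 0 \<longrightarrow> iter_partial bs (inv_fourier f) (0::'a) = 0)"
    by (intro bchoice) (blast intro: iter_partial_inv_fourier_0)
  then obtain l where l: "\<And>bs. bs \<in> ?S \<Longrightarrow> l bs \<in> polynomial_distrs"
    "\<And>bs f. \<lbrakk>bs \<in> ?S; f \<in> schwartz; l bs f = 0\<rbrakk> \<Longrightarrow> iter_partial bs (inv_fourier f) 0 = 0" by blast
  show ?thesis
  proof (rule kernel_intersection_polynomial[of "l ` ?S", OF _ _ u])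
    show "finite (l ` ?S)" by (intro finite_imageI finite_short_lists)
    show "l ` ?S \<subseteq> polynomial_distrs" using l(1) by blast
    fix f assume f: "f \<in> schwartz" "\<forall>k\<in>l ` ?S. k f = 0"
    have "u (fourier (inv_fourier f)) = 0"
      by (rule zero) (use f l(2) in \<open>auto simp: schwartz_inv_fourier\<close>)
    then show "u f = 0" using f by (simp add: fourier_inv_fourier)
  qed
qed

end


section \<open>Lebesgue norms of distributions\<close>

lemma exponent_cases:
  fixes p :: ereal
  assumes "1 \<le> p"
  obtains (fin) q where "p = ereal q" "1 \<le> q" | (inf) "p = \<infinity>"
  using assms by (cases p) (auto simp: one_ereal_def)

text \<open>The root and the detour through \<open>enn2real\<close> in the definition are removed
  here once, so that later estimates compare integrals of q-th powers.\<close>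

lemma Lp_norm_le_iff:
  assumes q: "1 \<le> q" and A: "0 \<le> A"
  shows "Lp_norm (ereal q) g \<le> ennreal A \<longleftrightarrow>
    (\<integral>\<^sup>+ x. ennreal (norm (g x) powr q) \<partial>lborel) \<le> ennreal (A powr q)"
proof -
  define I where "I = (\<integral>\<^sup>+ x. ennreal (norm (g x) powr q) \<partial>lborel)"
  have L: "Lp_norm (ereal q) g = (if I = \<infinity> then \<infinity> else ennreal (enn2real I powr (1 / q)))"
    by (simp add: Lp_norm_def I_def Let_def)
  show ?thesis
  proof (cases I)
    case (real r)
    have "r powr (1 / q) \<le> A \<longleftrightarrow> r \<le> A powr q"
    proof
      assume "r powr (1 / q) \<le> A"
      then have "(r powr (1 / q)) powr q \<le> A powr q" using q by (intro powr_mono2) auto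
      then show "r \<le> A powr q" using q real by (simp add: powr_powr)
    next
      assume "r \<le> A powr q"
      then have "r powr (1 / q) \<le> (A powr q) powr (1 / q)" using q real by (intro powr_mono2) auto
      then show "r powr (1 / q) \<le> A" using q A by (simp add: powr_powr)
    qed
    then show ?thesis using real A L unfolding I_def[symmetric] by (simp add: ennreal_le_iff)
  next
    case top
    then show ?thesis using L unfolding I_def[symmetric] by (simp add: top_unique)
  qed
qed

lemma Lp_norm_infinity_le_iff:
  assumes [measurable]: "g \<in> borel_measurable borel" and A: "0 \<le> A"
  shows "Lp_norm \<infinity> g \<le> ennreal A \<longleftrightarrow> (AE x in lborel. norm (g x) \<le> A)"
proof -
  have "Lp_norm \<infinity> g = esssup lborel (\<lambda>x. ennreal (norm (g x)))" by (simp add: Lp_norm_def)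
  moreover have "esssup lborel (\<lambda>x. ennreal (norm (g x))) \<le> ennreal A \<longleftrightarrow>
      (AE x in lborel. ennreal (norm (g x)) \<le> ennreal A)"
  proof
    assume le: "esssup lborel (\<lambda>x. ennreal (norm (g x))) \<le> ennreal A"
    show "AE x in lborel. ennreal (norm (g x)) \<le> ennreal A"
      using esssup_AE[of "\<lambda>x. ennreal (norm (g x))" lborel] by eventually_elim (rule order_trans[OF _ le])
  qed (intro esssup_I, auto)
  ultimately show ?thesis using A by (simp add: ennreal_le_iff)
qed

lemma powr_convex_combination:
  fixes x y :: real
  assumes "0 \<le> x" "0 \<le> y" "0 \<le> a" "0 \<le> b" "a + b = 1" and q: "1 \<le> q"
  shows "(a * x + b * y) powr q \<le> a * x powr q + b * y powr q"
proof (cases "x = 0 \<or> y = 0")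
  case True
  \<comment> \<open>If one argument is zero, the claim reduces to \<open>t powr q \<le> t\<close>
    for \<open>t\<close> between 0 and 1.\<close>
  have le: "(t * z) powr q \<le> t * z powr q" if "0 \<le> t" "t \<le> 1" "0 \<le> z" for t z :: real
  proof -
    have "t powr q \<le> t powr 1" if "t > 0" using that \<open>t \<le> 1\<close> q by (intro powr_mono') auto
    then have "t powr q \<le> t" using \<open>0 \<le> t\<close> by (cases "t = 0") auto
    then show ?thesis using that by (simp add: powr_mult mult_right_mono)
  qed
  show ?thesis using True le[of a x] le[of b y] assms by auto
next
  case False
  have a: "a = 1 - b" using assms by simp
  show ?thesis
    using convex_onD[OF powr_convex[OF q], of b x y] False assms(1-4) unfolding a by simp
qed

text \<open>Minkowski's inequality: for \<open>A > \<parallel>g\<parallel>\<close> and \<open>B > \<parallel>h\<parallel>\<close> write \<open>g + h\<close> as \<open>A + B\<close> times a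
  convex combination of \<open>g / A\<close> and \<open>h / B\<close>.\<close>

lemma Lp_norm_add_le:
  fixes g h :: "'a::euclidean_space \<Rightarrow> complex"
  assumes [measurable]: "g \<in> borel_measurable borel" "h \<in> borel_measurable borel" and p: "1 \<le> p"
    and A: "A > 0" "Lp_norm p g \<le> ennreal A" and B: "B > 0" "Lp_norm p h \<le> ennreal B"
  shows "Lp_norm p (\<lambda>x. g x + h x) \<le> ennreal (A + B)"
  using p
proof (cases rule: exponent_cases)
  case inf
  have "AE x in lborel. norm (g x) \<le> A" "AE x in lborel. norm (h x) \<le> B"
    using A B unfolding inf by (simp_all add: Lp_norm_infinity_le_iff)
  then have "AE x in lborel. norm (g x + h x) \<le> A + B"
    by eventually_elim (rule norm_triangle_mono)
  then show ?thesis unfolding inf using A B by (subst Lp_norm_infinity_le_iff) auto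
next
  case (fin q)
  define a b where "a = A / (A + B)" and "b = B / (A + B)"
  have ab: "a \<ge> 0" "b \<ge> 0" "a + b = 1" using A B by (auto simp: a_def b_def simp flip: add_divide_distrib)
  have pt: "norm (g x + h x) powr q
      \<le> (A + B) powr q * (a * A powr - q) * norm (g x) powr q + (A + B) powr q * (b * B powr - q) * norm (h x) powr q"
    for x
  proof -
    have "norm (g x + h x) \<le> (A + B) * (a * (norm (g x) / A) + b * (norm (h x) / B))"
    proof -
      have "A + B \<noteq> 0" using A B by linarith
      then have "(A + B) * (a * (s / A) + b * (t / B)) = s + t" for s t
        using A B unfolding a_def b_def distrib_left by simp
      then show ?thesis using norm_triangle_ineq[of "g x" "h x"] by simp
    qed
    then have "norm (g x + h x) powr q \<le> ((A + B) * (a * (norm (g x) / A) + b * (norm (h x) / B))) powr q"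
      using fin by (intro powr_mono2) auto
    also have "\<dots> = (A + B) powr q * (a * (norm (g x) / A) + b * (norm (h x) / B)) powr q"
      by (rule powr_mult)
    also have "(a * (norm (g x) / A) + b * (norm (h x) / B)) powr q
        \<le> a * (norm (g x) / A) powr q + b * (norm (h x) / B) powr q"
      using A B ab fin by (intro powr_convex_combination; simp)
    also have "(norm (g x) / A) powr q = A powr - q * norm (g x) powr q"
      using A by (simp add: powr_divide powr_minus_divide)
    also have "(norm (h x) / B) powr q = B powr - q * norm (h x) powr q"
      using B by (simp add: powr_divide powr_minus_divide)
    finally show ?thesis using A B by (simp add: mult_left_mono algebra_simps)
  qed
  have G: "(\<integral>\<^sup>+ x. ennreal (norm (g x) powr q) \<partial>lborel) \<le> ennreal (A powr q)"
    using A(2) unfolding fin using A fin by (subst (asm) Lp_norm_le_iff) auto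
  have H: "(\<integral>\<^sup>+ x. ennreal (norm (h x) powr q) \<partial>lborel) \<le> ennreal (B powr q)"
    using B(2) unfolding fin using B fin by (subst (asm) Lp_norm_le_iff) auto
  let ?u = "(A + B) powr q * (a * A powr - q)" and ?v = "(A + B) powr q * (b * B powr - q)"
  have uv: "?u \<ge> 0" "?v \<ge> 0" using ab by auto
  have "(\<integral>\<^sup>+ x. ennreal (norm (g x + h x) powr q) \<partial>lborel)
      \<le> (\<integral>\<^sup>+ x. ennreal ?u * ennreal (norm (g x) powr q) + ennreal ?v * ennreal (norm (h x) powr q) \<partial>lborel)"
    using pt uv by (intro nn_integral_mono) (simp add: ennreal_leI flip: ennreal_mult ennreal_plus)
  also have "\<dots> = ennreal ?u * (\<integral>\<^sup>+ x. ennreal (norm (g x) powr q) \<partial>lborel)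
      + ennreal ?v * (\<integral>\<^sup>+ x. ennreal (norm (h x) powr q) \<partial>lborel)"
    by (simp add: nn_integral_add nn_integral_cmult)
  also have "\<dots> \<le> ennreal ?u * ennreal (A powr q) + ennreal ?v * ennreal (B powr q)"
    by (intro add_mono mult_left_mono G H) auto
  also have "\<dots> = ennreal (?u * A powr q + ?v * B powr q)"
    using uv by (simp flip: ennreal_mult ennreal_plus)
  also have "?u * A powr q = (A + B) powr q * a" using A by (simp add: powr_minus)
  also have "?v * B powr q = (A + B) powr q * b" using B by (simp add: powr_minus)
  also have "(A + B) powr q * a + (A + B) powr q * b = (A + B) powr q"
    using ab(3) by (simp flip: distrib_left)
  finally show ?thesis unfolding fin using A B fin by (subst Lp_norm_le_iff) auto
qed

lemma Lp_norm_cmult_le: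
  fixes g :: "'a::euclidean_space \<Rightarrow> complex"
  assumes [measurable]: "g \<in> borel_measurable borel" and p: "1 \<le> p"
    and A: "A \<ge> 0" "Lp_norm p g \<le> ennreal A"
  shows "Lp_norm p (\<lambda>x. c * g x) \<le> ennreal (cmod c * A)"
  using p
proof (cases rule: exponent_cases)
  case inf
  have "AE x in lborel. norm (g x) \<le> A" using A unfolding inf by (simp add: Lp_norm_infinity_le_iff)
  then have "AE x in lborel. norm (c * g x) \<le> cmod c * A"
    by eventually_elim (simp add: norm_mult mult_left_mono)
  then show ?thesis unfolding inf using A by (subst Lp_norm_infinity_le_iff) auto
next
  case (fin q)
  have G: "(\<integral>\<^sup>+ x. ennreal (norm (g x) powr q) \<partial>lborel) \<le> ennreal (A powr q)"
    using A(2) unfolding fin using A fin by (subst (asm) Lp_norm_le_iff) auto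
  have "(\<integral>\<^sup>+ x. ennreal (norm (c * g x) powr q) \<partial>lborel)
      = (\<integral>\<^sup>+ x. ennreal (cmod c powr q) * ennreal (norm (g x) powr q) \<partial>lborel)"
    by (simp add: norm_mult powr_mult flip: ennreal_mult)
  also have "\<dots> \<le> ennreal (cmod c powr q) * ennreal (A powr q)"
    by (simp add: nn_integral_cmult mult_left_mono G)
  also have "\<dots> = ennreal ((cmod c * A) powr q)" using A by (simp add: powr_mult flip: ennreal_mult)
  finally show ?thesis unfolding fin using A fin by (subst Lp_norm_le_iff) auto
qed

text \<open>The number d/p, with value 0 for infinite \<open>p\<close>: the exponent with which the
  L^p norm scales under dilations.\<close>

definition lp_dim :: "'a::euclidean_space itself \<Rightarrow> ereal \<Rightarrow> real" where
  "lp_dim _ p = (if p = \<infinity> then 0 else DIM('a) / real_of_ereal p)"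

text \<open>One constant that bounds both the sup norm and the L^1 norm controls every L^p norm,
  since the q-th power of \<open>norm (g x)\<close> is at most C^(q-1) times
  \<open>norm (g x)\<close>. The change of variables supplies the power of \<open>r\<close>.\<close>

lemma Lp_norm_dilation:
  fixes g :: "'a::euclidean_space \<Rightarrow> complex"
  assumes [measurable]: "g \<in> borel_measurable borel" and p: "1 \<le> p"
    and C: "C > 0" "\<And>x. norm (g x) \<le> C" "(\<integral>\<^sup>+x. ennreal (norm (g x)) \<partial>lborel) \<le> ennreal C"
    and r: "r > 0"
  shows "Lp_norm p (\<lambda>x. g (r *\<^sub>R x)) \<le> ennreal (C * r powr (- lp_dim TYPE('a) p))"
  using p
proof (cases rule: exponent_cases)
  case inf
  then show ?thesis using C r by (simp add: Lp_norm_infinity_le_iff lp_dim_def)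
next
  case (fin q)
  have "(\<integral>\<^sup>+ x. ennreal (norm (g (r *\<^sub>R x)) powr q) \<partial>lborel)
      = ennreal (\<bar>1 / r\<bar> ^ DIM('a)) * (\<integral>\<^sup>+ x. ennreal (norm (g (r *\<^sub>R (0 + (1 / r) *\<^sub>R x))) powr q) \<partial>lborel)"
    using r by (intro lborel_nn_integral_affine) auto
  also have "\<dots> = ennreal (\<bar>1 / r\<bar> ^ DIM('a)) * (\<integral>\<^sup>+ x. ennreal (norm (g x) powr q) \<partial>lborel)"
    using r by simp
  also have "\<dots> \<le> ennreal (\<bar>1 / r\<bar> ^ DIM('a)) * (\<integral>\<^sup>+ x. ennreal (C powr (q - 1)) * ennreal (norm (g x)) \<partial>lborel)"
  proof (intro mult_left_mono nn_integral_mono)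
    fix x
    have "norm (g x) powr q \<le> C powr (q - 1) * norm (g x)"
    proof (cases "g x = 0")
      case False
      then have "norm (g x) powr q = norm (g x) powr (q - 1) * norm (g x)" by (simp add: powr_diff)
      also have "\<dots> \<le> C powr (q - 1) * norm (g x)" using fin C by (intro mult_right_mono powr_mono2) auto
      finally show ?thesis .
    qed simp
    then show "ennreal (norm (g x) powr q) \<le> ennreal (C powr (q - 1)) * ennreal (norm (g x))"
      by (simp add: ennreal_leI flip: ennreal_mult)
  qed simp
  also have "\<dots> \<le> ennreal (\<bar>1 / r\<bar> ^ DIM('a)) * (ennreal (C powr (q - 1)) * ennreal C)"
    by (simp add: nn_integral_cmult mult_left_mono C)
  also have "\<dots> = ennreal ((1 / r) powr DIM('a) * (C powr (q - 1) * C))"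
    using r C by (simp add: powr_realpow flip: ennreal_mult)
  also have "(1 / r) powr DIM('a) * (C powr (q - 1) * C) = (C * r powr (- lp_dim TYPE('a) p)) powr q"
    using r C fin by (simp add: lp_dim_def powr_mult powr_powr powr_diff powr_divide powr_minus_divide)
  finally show ?thesis unfolding fin using C fin by (subst Lp_norm_le_iff) auto
qed

text \<open>A substitute for Hoelder's inequality that only uses
  \<open>w \<le> \<lambda> + \<lambda> powr (1 - q) * w powr q\<close>.\<close>

lemma Lp_duality:
  fixes W v :: "'a::euclidean_space \<Rightarrow> complex"
  assumes W[measurable]: "W \<in> borel_measurable borel" and p: "1 \<le> p"
    and N: "N > 0" "Lp_norm p W \<le> ennreal N"
    and v: "integrable lborel v" "\<And>x. norm (v x) \<le> C * r powr DIM('a)" "(LINT x|lborel. norm (v x)) \<le> C"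
    and r: "r > 0"
  shows "integrable lborel (\<lambda>x. W x * v x)"
    and "norm (LINT x|lborel. W x * v x) \<le> 2 * C * r powr lp_dim TYPE('a) p * N"
proof -
  have [measurable]: "v \<in> borel_measurable borel" using v by auto
  have C: "C \<ge> 0" using v(3) by (rule order_trans[rotated]) simp
  \<comment> \<open>One majorant serves both for the integrability and for the bound; only its form
    depends on whether \<open>p\<close> is finite.\<close>
  have "\<exists>F. integrable lborel F \<and> (AE x in lborel. norm (W x * v x) \<le> F x) \<and>
      (LINT x|lborel. F x) \<le> 2 * C * r powr lp_dim TYPE('a) p * N"
    using p
  proof (cases rule: exponent_cases)
    case inf
    have "AE x in lborel. norm (W x) \<le> N" using N unfolding inf by (simp add: Lp_norm_infinity_le_iff)
    then have "AE x in lborel. norm (W x * v x) \<le> N * norm (v x)"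
      by eventually_elim (simp add: norm_mult mult_right_mono)
    moreover have "(LINT x|lborel. N * norm (v x)) \<le> N * C" using N v(3) by simp
    moreover have "N * C \<le> 2 * C * r powr lp_dim TYPE('a) p * N"
      using N C r inf by (simp add: lp_dim_def mult.commute)
    ultimately show ?thesis using v(1) by (intro exI[of _ "\<lambda>x. N * norm (v x)"]) auto
  next
    case (fin q)
    define d where "d = real DIM('a)"
    \<comment> \<open>The parameter that balances the two parts of the majorant: each of them then
      integrates to at most \<open>l * C\<close>, which explains the factor 2 in the bound.\<close>
    define l where "l = N * r powr (d / q)"
    have l: "l > 0" using N r by (simp add: l_def)
    have G: "(\<integral>\<^sup>+ x. ennreal (norm (W x) powr q) \<partial>lborel) \<le> ennreal (N powr q)"
      using N(2) unfolding fin using N fin by (subst (asm) Lp_norm_le_iff) auto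
    have Wi: "integrable lborel (\<lambda>x. norm (W x) powr q)"
      using G by (intro integrableI_bounded) (auto simp: top.not_eq_extremum intro: le_less_trans)
    have Wq: "(LINT x|lborel. norm (W x) powr q) \<le> N powr q"
      by (rule integral_real_bounded) (use G in auto)
    define F where "F x = l * norm (v x) + l powr (1 - q) * (C * r powr d) * norm (W x) powr q" for x
    have pt: "norm (W x) \<le> l + l powr (1 - q) * norm (W x) powr q" for x
    proof (cases "norm (W x) \<le> l")
      case False
      then have pos: "norm (W x) > 0" using l by linarith
      have "norm (W x) = norm (W x) powr (1 - q) * norm (W x) powr q"
        using pos by (simp flip: powr_add)
      also have "\<dots> \<le> l powr (1 - q) * norm (W x) powr q"
        using False l fin by (intro mult_right_mono powr_mono2') auto
      finally show ?thesis using l by linarith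
    qed (use l in \<open>simp add: add_increasing2\<close>)
    have bd: "norm (W x * v x) \<le> F x" for x
    proof -
      have "norm (W x * v x) \<le> (l + l powr (1 - q) * norm (W x) powr q) * norm (v x)"
        unfolding norm_mult by (intro mult_right_mono pt) auto
      also have "\<dots> = l * norm (v x) + l powr (1 - q) * norm (W x) powr q * norm (v x)"
        by (simp add: algebra_simps)
      also have "\<dots> \<le> l * norm (v x) + l powr (1 - q) * norm (W x) powr q * (C * r powr d)"
        using v(2)[of x] by (intro add_left_mono mult_left_mono) (auto simp: d_def)
      finally show ?thesis by (simp add: F_def mult_ac)
    qed
    have Fi: "integrable lborel F"
      unfolding F_def using v(1) Wi by (intro Bochner_Integration.integrable_add integrable_mult_right integrable_norm)
    have "(LINT x|lborel. F x) = l * (LINT x|lborel. norm (v x)) + l powr (1 - q) * (C * r powr d) * (LINT x|lborel. norm (W x) powr q)"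
      unfolding F_def using v(1) Wi by simp
    also have "\<dots> \<le> l * C + l powr (1 - q) * (C * r powr d) * N powr q"
      using l v(3) C Wq by (intro add_mono mult_left_mono) auto
    also have "l powr (1 - q) * (C * r powr d) * N powr q = l * C"
    proof -
      have "l powr (1 - q) = l * (N powr - q * r powr - d)"
        using l N r fin unfolding powr_diff l_def
        by (simp add: powr_mult powr_powr powr_minus field_simps)
      then show ?thesis using N r by (simp add: powr_minus field_simps)
    qed
    finally have "(LINT x|lborel. F x) \<le> 2 * C * r powr lp_dim TYPE('a) p * N"
      by (simp add: l_def lp_dim_def fin d_def mult_ac)
    then show ?thesis using Fi bd by (intro exI[of _ F]) auto
  qed
  then obtain F where F: "integrable lborel F" "AE x in lborel. norm (W x * v x) \<le> F x"
      "(LINT x|lborel. F x) \<le> 2 * C * r powr lp_dim TYPE('a) p * N" by blast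
  show i: "integrable lborel (\<lambda>x. W x * v x)"
    by (rule Bochner_Integration.integrable_bound[OF F(1)]) (use F(2) in \<open>auto elim!: eventually_mono intro: order_trans[OF _ abs_ge_self]\<close>)
  have "norm (LINT x|lborel. W x * v x) \<le> (LINT x|lborel. norm (W x * v x))" by (rule integral_norm_bound)
  also have "\<dots> \<le> (LINT x|lborel. F x)" by (intro integral_mono_AE integrable_norm i F)
  finally show "norm (LINT x|lborel. W x * v x) \<le> 2 * C * r powr lp_dim TYPE('a) p * N" using F(3) by linarith
qed

lemma schwartz_dilation_bounds:
  fixes f :: "'a::euclidean_space \<Rightarrow> complex"
  assumes f: "f \<in> schwartz"
  obtains C where "C > 0" "\<And>x. norm (f x) \<le> C" "(LINT x|lborel. norm (f x)) \<le> C"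
proof -
  obtain B where "schwartz_bound 0 0 B f" using schwartz_boundE[OF f] by blast
  then have B: "norm (f x) \<le> B" for x by (simp add: schwartz_bound_0)
  show ?thesis
    by (rule that[of "max 1 (max B (LINT x|lborel. norm (f x)))"]) (auto intro: order_trans[OF B])
qed

lemma Lp_schwartz_integrable:
  assumes "W \<in> borel_measurable borel" "1 \<le> p" "Lp_norm p W < \<infinity>" "f \<in> schwartz"
  shows "integrable lborel (\<lambda>x. W x * f x)"
proof -
  obtain C where C: "C > 0" "\<And>x. norm (f x) \<le> C" "(LINT x|lborel. norm (f x)) \<le> C"
    using schwartz_dilation_bounds[OF assms(4)] by blast
  have "Lp_norm p W \<le> ennreal (enn2real (Lp_norm p W) + 1)"
    using assms(3) by (cases "Lp_norm p W") (auto simp: ennreal_leI)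
  moreover have "enn2real (Lp_norm p W) + 1 > 0" by (simp add: add_nonneg_pos)
  ultimately show ?thesis
    using Lp_duality(1)[OF assms(1,2) _ _ schwartz_integrable[OF assms(4)], of _ C 1] C by simp
qed

section \<open>The L^p norm of a distribution\<close>

lemma distr_Lp_norm_le: "\<lbrakk>g \<in> borel_measurable borel; distr_of g = u; Lp_norm p g \<le> b\<rbrakk> \<Longrightarrow> distr_Lp_norm p u \<le> b"
  unfolding distr_Lp_norm_def by (rule order_trans[OF INF_lower]) auto

lemma distr_Lp_norm_approx:
  assumes "distr_Lp_norm p u < \<infinity>" "e > 0"
  obtains g where "g \<in> borel_measurable borel" "distr_of g = u"
    "Lp_norm p g \<le> ennreal (enn2real (distr_Lp_norm p u) + e)"
proof -
  obtain a where a: "distr_Lp_norm p u = ennreal a" "a \<ge> 0" using assms(1) by (cases "distr_Lp_norm p u") auto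
  then have "distr_Lp_norm p u < ennreal (a + e)" using assms(2) by (simp add: ennreal_lessI)
  then obtain g where "g \<in> borel_measurable lborel" "distr_of g = u" "Lp_norm p g < ennreal (a + e)"
    unfolding distr_Lp_norm_def INF_less_iff by auto
  then show ?thesis using that[of g] a by (simp add: less_imp_le)
qed

lemma distr_Lp_norm_add:
  assumes p: "1 \<le> p"
  shows "distr_Lp_norm p (\<lambda>f. u f + v f) \<le> distr_Lp_norm p u + distr_Lp_norm p v"
proof (rule ennreal_le_epsilon)
  fix e :: real assume fin: "distr_Lp_norm p u + distr_Lp_norm p v < top" and e: "e > 0"
  let ?a = "enn2real (distr_Lp_norm p u)" and ?b = "enn2real (distr_Lp_norm p v)"
  have e2: "e/2 > 0" using e by simp
  have fu: "distr_Lp_norm p u < \<infinity>" and fv: "distr_Lp_norm p v < \<infinity>" using fin by auto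
  obtain g where g: "g \<in> borel_measurable borel" "distr_of g = u" "Lp_norm p g \<le> ennreal (?a + e/2)"
    using distr_Lp_norm_approx[OF fu e2] by blast
  obtain h where h: "h \<in> borel_measurable borel" "distr_of h = v" "Lp_norm p h \<le> ennreal (?b + e/2)"
    using distr_Lp_norm_approx[OF fv e2] by blast
  have pos: "?a + e/2 > 0" "?b + e/2 > 0" using e by (auto simp: add_nonneg_pos)
  have lt: "Lp_norm p g < \<infinity>" "Lp_norm p h < \<infinity>" using g h by (auto intro: le_less_trans)
  have "distr_Lp_norm p (\<lambda>f. u f + v f) \<le> ennreal ((?a + e/2) + (?b + e/2))"
  proof (rule distr_Lp_norm_le)
    show "(\<lambda>x. g x + h x) \<in> borel_measurable borel" using g h by simp
    show "distr_of (\<lambda>x. g x + h x) = (\<lambda>f. u f + v f)"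
      using g h lt p by (auto simp: fun_eq_iff distr_of_add Lp_schwartz_integrable)
    show "Lp_norm p (\<lambda>x. g x + h x) \<le> ennreal ((?a + e/2) + (?b + e/2))"
      by (rule Lp_norm_add_le[OF g(1) h(1) p pos(1) g(3) pos(2) h(3)])
  qed
  also have "\<dots> = distr_Lp_norm p u + distr_Lp_norm p v + ennreal e"
    using fu fv e by (cases "distr_Lp_norm p u"; cases "distr_Lp_norm p v") (auto simp flip: ennreal_plus)
  finally show "distr_Lp_norm p (\<lambda>f. u f + v f) \<le> distr_Lp_norm p u + distr_Lp_norm p v + ennreal e" .
qed

lemma distr_Lp_norm_scale:
  assumes p: "1 \<le> p" and fin: "distr_Lp_norm p u < \<infinity>"
  shows "distr_Lp_norm p (\<lambda>f. c * u f) \<le> ennreal (cmod c) * distr_Lp_norm p u"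
proof (rule ennreal_le_epsilon)
  fix e :: real assume e: "e > 0"
  let ?a = "enn2real (distr_Lp_norm p u)" and ?e = "e / (cmod c + 1)"
  have c: "cmod c + 1 > 0" by (simp add: add_nonneg_pos)
  then have e': "?e > 0" using e by simp
  obtain g where g: "g \<in> borel_measurable borel" "distr_of g = u" "Lp_norm p g \<le> ennreal (?a + ?e)"
    using distr_Lp_norm_approx[OF fin e'] by blast
  have "distr_Lp_norm p (\<lambda>f. c * u f) \<le> ennreal (cmod c * (?a + ?e))"
    using g e' by (intro distr_Lp_norm_le[of "\<lambda>x. c * g x"] Lp_norm_cmult_le p)
      (auto simp: fun_eq_iff distr_of_cmult)
  also have "\<dots> \<le> ennreal (cmod c * ?a + e)"
    using c e by (intro ennreal_leI) (simp add: distrib_left field_simps)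
  also have "\<dots> = ennreal (cmod c) * distr_Lp_norm p u + ennreal e"
    using fin e by (cases "distr_Lp_norm p u") (auto simp flip: ennreal_plus ennreal_mult)
  finally show "distr_Lp_norm p (\<lambda>f. c * u f) \<le> ennreal (cmod c) * distr_Lp_norm p u + ennreal e" .
qed

text \<open>The assumptions on \<open>f\<close> are those satisfied by r^d F(r x): the L^1 norm does
  not depend on \<open>r\<close> and the sup norm is of order r^d, so the norm in the dual exponent
  is of order r^(d/p). The infimum over representing functions is approached by one that is optimal
  up to an error proportional to \<open>e\<close>.\<close>

lemma distr_Lp_duality:
  fixes f :: "'a::euclidean_space \<Rightarrow> complex"
  assumes p: "1 \<le> p" and fin: "distr_Lp_norm p u < \<infinity>" and f: "f \<in> schwartz"
    and C: "\<And>x. norm (f x) \<le> C * r powr DIM('a)" "(LINT x|lborel. norm (f x)) \<le> C" and r: "r > 0"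
  shows "norm (u f) \<le> 2 * C * r powr lp_dim TYPE('a) p * enn2real (distr_Lp_norm p u)"
proof (rule field_le_epsilon)
  fix e :: real assume e: "e > 0"
  let ?a = "enn2real (distr_Lp_norm p u)" and ?K = "2 * C * r powr lp_dim TYPE('a) p"
  have "C \<ge> 0" using C(2) by (rule order_trans[rotated]) simp
  then have K: "?K \<ge> 0" by simp
  then have K1: "?K + 1 > 0" by linarith
  have e': "e / (?K + 1) > 0" using e K1 by simp
  obtain g where g: "g \<in> borel_measurable borel" "distr_of g = u" "Lp_norm p g \<le> ennreal (?a + e / (?K + 1))"
    using distr_Lp_norm_approx[OF fin e'] by blast
  have pos: "?a + e / (?K + 1) > 0" using e' by (simp add: add_nonneg_pos)
  have "norm (u f) \<le> ?K * (?a + e / (?K + 1))"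
    using Lp_duality(2)[OF g(1) p pos g(3) schwartz_integrable[OF f] C r] f
    unfolding g(2)[symmetric] by (simp add: distr_of_apply)
  also have "\<dots> \<le> ?K * ?a + e" using K K1 e by (simp add: distrib_left pos_divide_le_eq mult_left_mono)
  finally show "norm (u f) \<le> ?K * ?a + e" .
qed

lemma distr_Lp_norm_zero_imp:
  assumes p: "1 \<le> p" and z: "distr_Lp_norm p u = 0" and f: "f \<in> schwartz"
  shows "u f = 0"
proof -
  obtain C where C: "C > 0" "\<And>x. norm (f x) \<le> C" "(LINT x|lborel. norm (f x)) \<le> C"
    using schwartz_dilation_bounds[OF f] by blast
  show ?thesis using distr_Lp_duality[OF p _ f, of u C 1] C z by simp
qed


section \<open>Taylor remainders and test functions\<close>

lemma polynomial_function_coord: "polynomial_function (\<lambda>x::'a::euclidean_space. x \<bullet> b)"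
  by (rule polynomial_function_bounded_linear) (rule bounded_linear_inner_left)

lemma inner_power_integrable:
  fixes f :: "'a::euclidean_space \<Rightarrow> complex"
  assumes "f \<in> schwartz"
  shows "integrable lborel (\<lambda>\<xi>. of_real ((x \<bullet> \<xi>) ^ j) * f \<xi>)"
proof (rule growth_integrable[OF _ _ assms])
  fix \<xi>
  have "\<bar>x \<bullet> \<xi>\<bar> ^ j \<le> (norm x * (1 + norm \<xi>)) ^ j"
    using Cauchy_Schwarz_ineq2[of x \<xi>] mult_left_mono[of "norm \<xi>" "1 + norm \<xi>" "norm x"]
    by (intro power_mono) auto
  then show "cmod (of_real ((x \<bullet> \<xi>) ^ j)) \<le> norm x ^ j * (1 + norm \<xi>) ^ j"
    by (simp add: norm_power power_mult_distrib)
qed measurable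

text \<open>Expanding one factor of the power in coordinates pulls a coordinate of \<open>x\<close>
  out of the integral and multiplies \<open>f\<close> by a coordinate of \<open>\<xi>\<close>, so
  the induction runs over all Schwartz functions.\<close>

lemma polynomial_moment:
  fixes f :: "'a::euclidean_space \<Rightarrow> complex"
  shows "f \<in> schwartz \<Longrightarrow> polynomial_function (\<lambda>x. LINT \<xi>|lborel. of_real ((x \<bullet> \<xi>) ^ j) * f \<xi>)"
proof (induction j arbitrary: f)
  case (Suc j)
  have "(LINT \<xi>|lborel. of_real ((x \<bullet> \<xi>) ^ Suc j) * f \<xi>)
      = (\<Sum>b\<in>Basis. (x \<bullet> b) *\<^sub>R (LINT \<xi>|lborel. of_real ((x \<bullet> \<xi>) ^ j) * (of_real (\<xi> \<bullet> b) * f \<xi>)))" for x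
  proof -
    have eq: "of_real ((x \<bullet> \<xi>) ^ Suc j) * f \<xi>
        = (\<Sum>b\<in>Basis. (x \<bullet> b) *\<^sub>R (of_real ((x \<bullet> \<xi>) ^ j) * (of_real (\<xi> \<bullet> b) * f \<xi>)))" for \<xi>
    proof -
      have "complex_of_real ((x \<bullet> \<xi>) ^ Suc j) * f \<xi> = of_real (\<Sum>b\<in>Basis. (x \<bullet> b) * (\<xi> \<bullet> b)) * (of_real ((x \<bullet> \<xi>) ^ j) * f \<xi>)"
        unfolding power_Suc euclidean_inner[of x \<xi>, symmetric] by simp
      then show ?thesis
        unfolding of_real_sum sum_distrib_right by (simp add: scaleR_conv_of_real mult_ac)
    qed
    have i: "integrable lborel (\<lambda>\<xi>. (x \<bullet> b) *\<^sub>R (of_real ((x \<bullet> \<xi>) ^ j) * (of_real (\<xi> \<bullet> b) * f \<xi>)))"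
      if "b \<in> Basis" for b
      by (intro integrable_scaleR_right inner_power_integrable schwartz_coord_mult Suc.prems that)
    show ?thesis
      unfolding eq by (subst Bochner_Integration.integral_sum, erule i) (simp only: integral_scaleR_right)
  qed
  then show ?case
    using Suc by (auto intro!: polynomial_function_sum polynomial_function_mult polynomial_function_coord schwartz_coord_mult)
qed simp

text \<open>The exponential is expanded under the integral: its partial sums integrate to the
  moments of \<open>f\<close>, which form \<open>T\<close>, and its remainder is controlled by the
  absolute moment of order \<open>Suc n\<close>.\<close>

lemma inv_fourier_taylor:
  fixes f :: "'a::euclidean_space \<Rightarrow> complex"
  assumes f: "f \<in> schwartz"
  obtains T C where "polynomial_function T" "C \<ge> 0"
    "\<And>x. norm (inv_fourier f x - T x) \<le> C * norm x ^ Suc n"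
proof
  let ?I = "two_pi_pow TYPE('a)"
  define m where "m j x = (LINT \<xi>|lborel. of_real ((x \<bullet> \<xi>) ^ j) * f \<xi>)" for j x
  define T where "T x = (\<Sum>j\<le>n. (\<i> ^ j / fact j / ?I) * m j x)" for x
  define C where "C = (LINT \<xi>|lborel. norm \<xi> ^ Suc n * cmod (f \<xi>)) / (2 * pi) ^ DIM('a)"
  show "polynomial_function T"
    unfolding T_def m_def by (intro polynomial_function_sum polynomial_function_cmult_complex polynomial_moment f) auto
  show "C \<ge> 0" unfolding C_def by (intro divide_nonneg_nonneg integral_nonneg_AE) auto
  have "(\<lambda>\<xi>::'a. complex_of_real (norm \<xi> ^ Suc n)) \<in> borel_measurable borel" by measurable
  from growth_integrable[OF this _ f, of 1 "Suc n"]
  have "integrable lborel (\<lambda>\<xi>. complex_of_real (norm \<xi> ^ Suc n) * f \<xi>)"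
    by (simp add: norm_power norm_mult mult_mono power_mono del: power_Suc of_real_power)
  from integrable_norm[OF this] have Ni: "integrable lborel (\<lambda>\<xi>. norm \<xi> ^ Suc n * cmod (f \<xi>))"
    by (simp add: norm_mult norm_power)
  fix x :: 'a
  have mi: "integrable lborel (\<lambda>\<xi>. of_real ((x \<bullet> \<xi>) ^ j) * f \<xi>)" for j by (rule inner_power_integrable[OF f])
  have ei: "integrable lborel (\<lambda>\<xi>. cis (1 * (\<xi> \<bullet> x)) * f \<xi>)" by (intro ft_integrable schwartz_integrable f)
  let ?p = "\<lambda>\<xi>. \<Sum>j\<le>n. (\<i> * of_real (\<xi> \<bullet> x)) ^ j / fact j"
  have peq: "?p \<xi> * f \<xi> = (\<Sum>j\<le>n. (\<i> ^ j / fact j) * (of_real ((x \<bullet> \<xi>) ^ j) * f \<xi>))" for \<xi>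
    unfolding sum_distrib_right by (intro sum.cong) (auto simp: power_mult_distrib inner_commute)
  have pi': "integrable lborel (\<lambda>\<xi>. ?p \<xi> * f \<xi>)"
    unfolding peq by (intro Bochner_Integration.integrable_sum integrable_mult_right mi)
  have Teq: "T x = (LINT \<xi>|lborel. ?p \<xi> * f \<xi>) / ?I"
    unfolding peq T_def m_def using mi
    by (simp add: Bochner_Integration.integral_sum sum_divide_distrib)
  have "inv_fourier f x - T x = (LINT \<xi>|lborel. cis (1 * (\<xi> \<bullet> x)) * f \<xi> - ?p \<xi> * f \<xi>) / ?I"
    unfolding inv_fourier_eq_ft Teq ft_def diff_divide_distrib[symmetric]
    by (subst Bochner_Integration.integral_diff[OF ei pi']) simp
  then have eq: "norm (inv_fourier f x - T x) = cmod (LINT \<xi>|lborel. cis (1 * (\<xi> \<bullet> x)) * f \<xi> - ?p \<xi> * f \<xi>) / (2 * pi) ^ DIM('a)"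
    by (simp only: norm_divide norm_of_real) simp
  have "cmod (LINT \<xi>|lborel. cis (1 * (\<xi> \<bullet> x)) * f \<xi> - ?p \<xi> * f \<xi>)
      \<le> (LINT \<xi>|lborel. cmod (cis (1 * (\<xi> \<bullet> x)) * f \<xi> - ?p \<xi> * f \<xi>))" by (rule integral_norm_bound)
  also have "\<dots> \<le> (LINT \<xi>|lborel. norm x ^ Suc n * (norm \<xi> ^ Suc n * cmod (f \<xi>)))"
  proof (intro integral_mono integrable_norm Bochner_Integration.integrable_diff ei pi' integrable_mult_right Ni)
    fix \<xi>
    have "cmod (cis (1 * (\<xi> \<bullet> x)) - ?p \<xi>) \<le> \<bar>\<xi> \<bullet> x\<bar> ^ Suc n / fact (Suc n)"
      using iexp_approx1[of "\<xi> \<bullet> x" n] by (simp add: cis_conv_exp)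
    also have "\<dots> \<le> \<bar>\<xi> \<bullet> x\<bar> ^ Suc n / 1" by (intro divide_left_mono fact_ge_1) auto
    also have "\<dots> \<le> (norm \<xi> * norm x) ^ Suc n"
      using Cauchy_Schwarz_ineq2[of \<xi> x] by (simp add: power_mono del: power_Suc)
    finally have "cmod (cis (1 * (\<xi> \<bullet> x)) - ?p \<xi>) * cmod (f \<xi>) \<le> (norm \<xi> * norm x) ^ Suc n * cmod (f \<xi>)"
      by (rule mult_right_mono) simp
    then show "cmod (cis (1 * (\<xi> \<bullet> x)) * f \<xi> - ?p \<xi> * f \<xi>) \<le> norm x ^ Suc n * (norm \<xi> ^ Suc n * cmod (f \<xi>))"
      unfolding left_diff_distrib[symmetric] norm_mult power_mult_distrib
      by (simp only: mult.assoc[symmetric] mult.commute[of "norm \<xi> ^ Suc n" "norm x ^ Suc n"])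
  qed
  also have "\<dots> = norm x ^ Suc n * (LINT \<xi>|lborel. norm \<xi> ^ Suc n * cmod (f \<xi>))"
    by (rule integral_mult_right_zero)
  finally have "norm (inv_fourier f x - T x)
      \<le> norm x ^ Suc n * (LINT \<xi>|lborel. norm \<xi> ^ Suc n * cmod (f \<xi>)) / (2 * pi) ^ DIM('a)"
    unfolding eq by (rule divide_right_mono) simp
  then show "norm (inv_fourier f x - T x) \<le> C * norm x ^ Suc n"
    by (simp only: C_def times_divide_eq_left times_divide_eq_right mult.commute)
qed

context cutoff begin

text \<open>A bump in the thin annulus outside the unit ball where \<open>chi\<close> is still \<open>1\<close>: only one
  dyadic block sees it.\<close>

lemma bump_exists:
  obtains G where "G \<in> schwartz" "(LINT \<xi>|lborel. G \<xi>) \<noteq> 0"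
    "\<And>\<xi>. G \<xi> \<noteq> 0 \<Longrightarrow> 1 < norm \<xi> \<and> norm \<xi> \<le> 2 \<and> chi \<xi> = 1"
proof -
  obtain U where U: "open U" "cball 0 1 \<subseteq> U" "\<And>x. x \<in> U \<Longrightarrow> chi x = 1" using chi_near_open by metis
  obtain b :: 'a where b: "b \<in> Basis" using nonempty_Basis by blast
  then have nb: "norm b = 1" by simp
  then have "b \<in> U" using U(2) by auto
  then obtain e where e: "e > 0" "ball b e \<subseteq> U" using U(1) open_contains_ball by blast
  \<comment> \<open>The bump is supported within 2d of \<open>c\<close>, and \<open>c\<close> has
    norm 1 + 4d. So the support has norm at least 1 + 2d, and it stays within 6d < e of
    \<open>b\<close>, hence inside \<open>U\<close>; \<open>8 * d \<le> 1\<close> keeps the norm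
    below 2.\<close>
  define d where "d = min e 1 / 8"
  have d: "d > 0" "8 * d \<le> e" "8 * d \<le> 1" using e by (auto simp: d_def)
  define c where "c = (1 + 4 * d) *\<^sub>R b"
  define G where "G \<xi> = cut 1 ((1 / d) *\<^sub>R \<xi> + (- (1 / d)) *\<^sub>R c)" for \<xi>
  have arg: "(1 / d) *\<^sub>R \<xi> + (- (1 / d)) *\<^sub>R c = (1 / d) *\<^sub>R (\<xi> - c)" for \<xi> by (simp add: scaleR_diff_right)
  have supp: "norm (\<xi> - c) \<le> 2 * d" if "G \<xi> \<noteq> 0" for \<xi>
  proof (rule ccontr)
    assume "\<not> norm (\<xi> - c) \<le> 2 * d"
    moreover have "norm ((1 / d) *\<^sub>R (\<xi> - c)) = norm (\<xi> - c) / d" using d unfolding norm_scaleR by simp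
    ultimately have "2 < \<bar>1\<bar> * norm ((1 / d) *\<^sub>R (\<xi> - c))" using d by (simp only:) (simp add: field_simps)
    then have "G \<xi> = 0" unfolding G_def arg by (rule cut_far)
    then show False using that by simp
  qed
  have nc: "norm c = 1 + 4 * d" using nb d by (simp add: c_def)
  have GS: "G \<in> schwartz"
  proof (rule schwartz_compact_support)
    show "smooth G" unfolding G_def by (rule smooth_affine[OF cut_smooth])
    show "G \<xi> = 0" if "norm \<xi> > 3" for \<xi>
      using supp[of \<xi>] nc d that norm_triangle_sub[of \<xi> c] by fastforce
  qed
  show ?thesis
  proof (rule that[OF GS])
    fix \<xi> assume "G \<xi> \<noteq> 0"
    note s = supp[OF this]
    have "norm c \<le> norm \<xi> + norm (\<xi> - c)" using norm_triangle_sub[of c \<xi>] by (simp add: norm_minus_commute)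
    then have 1: "1 < norm \<xi>" using s nc d by linarith
    have 2: "norm \<xi> \<le> 2" using norm_triangle_sub[of \<xi> c] s nc d by linarith
    have "c - b = (4 * d) *\<^sub>R b" by (simp add: c_def algebra_simps)
    then have "norm (c - b) = 4 * d" using nb d by simp
    then have "norm (\<xi> - b) \<le> 6 * d" using s norm_triangle_ineq[of "\<xi> - c" "c - b"] by simp
    then have "dist b \<xi> < e" using d by (simp add: dist_norm norm_minus_commute)
    then have "chi \<xi> = 1" using e(2) U(3) by (auto simp: mem_ball)
    then show "1 < norm \<xi> \<and> norm \<xi> \<le> 2 \<and> chi \<xi> = 1" using 1 2 by simp
  next
    define r where "r \<xi> = chi ((1 / d) *\<^sub>R (\<xi> - c))" for \<xi>
    have Gr: "G = (\<lambda>\<xi>. complex_of_real (r \<xi>))" unfolding fun_eq_iff G_def arg r_def cut_def by simp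
    have "integrable lborel (\<lambda>\<xi>. Re (G \<xi>))" by (intro integrable_Re schwartz_integrable GS)
    then have ri: "integrable lborel r" by (simp add: Gr)
    \<comment> \<open>The bump equals 1 on the ball of radius \<open>d\<close> about
      \<open>c\<close> and is nonnegative everywhere, so its integral is at least the volume of that
      ball.\<close>
    have "(LINT \<xi>|lborel. indicator (ball c d) \<xi>) \<le> (LINT \<xi>|lborel. r \<xi>)"
    proof (intro integral_mono ri)
      show "integrable lborel (indicator (ball c d) :: 'a \<Rightarrow> real)"
        by (intro integrable_real_indicator) (auto simp: emeasure_ball less_imp_le[OF d(1)])
      show "indicator (ball c d) \<xi> \<le> r \<xi>" for \<xi>
      proof (cases "\<xi> \<in> ball c d")
        case True
        then have "norm (\<xi> - c) < d" by (simp add: dist_norm norm_minus_commute)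
        moreover have "norm ((1 / d) *\<^sub>R (\<xi> - c)) = norm (\<xi> - c) / d" using d unfolding norm_scaleR by simp
        ultimately have "norm ((1 / d) *\<^sub>R (\<xi> - c)) \<le> 1" using d by (simp only:) simp
        then have "r \<xi> = 1" unfolding r_def by (rule chi_near)
        then show ?thesis using True by simp
      qed (simp add: r_def chi_nonneg)
    qed
    moreover have "(LINT \<xi>|lborel. indicator (ball c d) \<xi>) > (0::real)"
      using d(1) content_ball_pos[of d c] by simp
    ultimately have "(LINT \<xi>|lborel. r \<xi>) \<noteq> 0" by linarith
    then show "(LINT \<xi>|lborel. G \<xi>) \<noteq> 0" unfolding Gr by simp
  qed
qed

section \<open>Low frequencies of elements of S'_h\<close>

lemma tempered_h_iff:
  "u \<in> tempered_h chi \<longleftrightarrow> u \<in> vcarrier tempered \<and>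
     (\<forall>f\<in>schwartz. ((\<lambda>t. u (fourier (\<lambda>\<xi>. cut t \<xi> * f \<xi>))) \<longlongrightarrow> 0) at_top)"
proof -
  have cf: "(\<lambda>\<xi>. cut t \<xi> * f \<xi>) \<in> schwartz" if "f \<in> schwartz" for t f
  \<comment> \<open>\<open>cut 0\<close> is the constant 1, which is not a Schwartz function, so
    this value of \<open>t\<close> is treated apart.\<close>
  proof (cases "t = 0")
    case True
    then show ?thesis using that by (simp add: cut_near)
  qed (intro schwartz_mult' cut_schwartz that)
  have "mult_distr (\<lambda>\<xi>. complex_of_real (chi (t *\<^sub>R \<xi>))) (fourier_distr u) f = u (fourier (\<lambda>\<xi>. cut t \<xi> * f \<xi>))"
    if "f \<in> schwartz" for t f
    using that cf[OF that, of t] by (simp add: mult_distr_def fourier_distr_def on_schwartz_def cut_def)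
  then show ?thesis unfolding tempered_h_def by simp
qed

lemma tempered_h_add: "\<lbrakk>u \<in> tempered_h chi; v \<in> tempered_h chi\<rbrakk> \<Longrightarrow> vadd tempered u v \<in> tempered_h chi"
  unfolding tempered_h_iff by (auto simp: TP.add_closed) (simp add: tempered_add tendsto_add_zero)

lemma tempered_h_scale: "u \<in> tempered_h chi \<Longrightarrow> vscale tempered c u \<in> tempered_h chi"
  unfolding tempered_h_iff by (auto simp: TP.scale_closed) (simp add: tempered_scale tendsto_mult_right_zero)

text \<open>The symbol \<open>phi (- int k)\<close> is the difference of the cut-offs at scales 2^k
  and 2^(k+1). The definition of S'_h needs one fixed test function; \<open>cut 1\<close> serves,
  since multiplying by it leaves \<open>cut t\<close> unchanged for
  \<open>t \<ge> 2\<close>.\<close>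

lemma tempered_h_phi:
  assumes "u \<in> tempered_h chi"
  shows "(\<lambda>k. u (fourier (phi (- int k)))) \<longlonglongrightarrow> 0"
proof -
  have u: "u \<in> vcarrier tempered" and
    lim: "((\<lambda>t. u (fourier (\<lambda>\<xi>. cut t \<xi> * cut 1 \<xi>))) \<longlongrightarrow> 0) at_top"
    using assms cut_schwartz[of 1] by (auto simp: tempered_h_iff)
  have eq: "(\<lambda>\<xi>. cut t \<xi> * cut 1 \<xi>) = cut t" if "t \<ge> 2" for t
  proof
    fix \<xi>
    show "cut t \<xi> * cut 1 \<xi> = cut t \<xi>"
    proof (cases "norm \<xi> \<le> 1")
      case True then show ?thesis by (simp add: cut_near)
    next
      case False
      then have "2 * 1 < t * norm \<xi>" using that by (intro mult_le_less_imp_less) auto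
      then show ?thesis using that by (simp add: cut_far)
    qed
  qed
  have "\<forall>\<^sub>F t in at_top. u (fourier (\<lambda>\<xi>. cut t \<xi> * cut 1 \<xi>)) = u (fourier (cut t))"
    using eventually_ge_at_top[of 2] by eventually_elim (simp add: eq)
  from Lim_transform_eventually[OF lim this] have L: "((\<lambda>t. u (fourier (cut t))) \<longlongrightarrow> 0) at_top" .
  have p2: "filterlim (\<lambda>k. 2 ^ k :: real) at_top sequentially"
    by (rule filterlim_at_top_mono[OF filterlim_real_sequentially])
      (intro always_eventually allI less_imp_le of_nat_less_two_power)
  have p3: "filterlim (\<lambda>k. 2 * 2 ^ k :: real) at_top sequentially"
    by (rule filterlim_tendsto_pos_mult_at_top[OF tendsto_const _ p2]) simp
  have "(\<lambda>k. u (fourier (cut (2 ^ k))) - u (fourier (cut (2 * 2 ^ k)))) \<longlonglongrightarrow> 0 - 0"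
    by (intro tendsto_diff filterlim_compose[OF L p2] filterlim_compose[OF L p3])
  moreover have "u (fourier (phi (- int k))) = u (fourier (cut (2 ^ k))) - u (fourier (cut (2 * 2 ^ k)))" for k
  proof -
    have S: "cut (2 ^ k) \<in> schwartz" "cut (2 * 2 ^ k) \<in> schwartz" by (intro cut_schwartz; simp)+
    have "fourier (phi (- int k)) = (\<lambda>x. fourier (cut (2 ^ k)) x - fourier (cut (2 * 2 ^ k)) x)"
      using S ft_add[of "cut (2 ^ k)" "\<lambda>x. -1 * cut (2 * 2 ^ k) x" "-1"] ft_cmult[of "-1" "-1" "cut (2 * 2 ^ k)"]
      by (simp add: fun_eq_iff fourier_eq_ft schwartz_integrable phi_eq[abs_def] power_int_of_nat)
    then show ?thesis using tempered_diff[OF u schwartz_fourier schwartz_fourier] S by simp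
  qed
  ultimately show ?thesis by simp
qed

end


section \<open>The Besov space is normed\<close>

locale besov_setting = cutoff chi for chi :: "'a::euclidean_space \<Rightarrow> real" +
  fixes s :: real and p :: ereal
  assumes p: "1 \<le> p" and s: "lp_dim TYPE('a) p \<le> s"
begin

abbreviation "polys \<equiv> polynomial_distrs :: 'a functional set"
abbreviation "cls \<equiv> coset tempered polys"
abbreviation "B \<equiv> besov chi s p"

text \<open>The Besov norm as a seminorm on distributions. It is constant on classes modulo
  polynomials, so estimates can be carried out on representatives.\<close>

definition block_norm :: "'a functional \<Rightarrow> ennreal" where
  "block_norm u = (SUP m. ennreal (2 powr (real_of_int m * s)) * distr_Lp_norm p (dyadic_block chi m u))"

lemma besov_enorm_cls: "besov_enorm chi s p (cls u) = block_norm u"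
  by (simp add: besov_enorm_def block_norm_def dyadic_block_class_coset)

lemma block_norm_ge: "ennreal (2 powr (real_of_int m * s)) * distr_Lp_norm p (dyadic_block chi m u) \<le> block_norm u"
  unfolding block_norm_def by (rule SUP_upper) simp

lemma block_finite:
  assumes "block_norm u < \<infinity>" shows "distr_Lp_norm p (dyadic_block chi m u) < \<infinity>"
proof (rule ccontr)
  assume "\<not> distr_Lp_norm p (dyadic_block chi m u) < \<infinity>"
  then have "distr_Lp_norm p (dyadic_block chi m u) = top"
    using top.not_eq_extremum[of "distr_Lp_norm p (dyadic_block chi m u)"] by auto
  then have "block_norm u = top" using block_norm_ge[of m u] by (simp add: ennreal_mult_top top_unique)
  then show False using assms by simp
qed

lemma block_norm_real_ge:
  assumes "block_norm u < \<infinity>"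
  shows "enn2real (distr_Lp_norm p (dyadic_block chi m u)) \<le> 2 powr (- real_of_int m * s) * enn2real (block_norm u)"
proof -
  obtain a where a: "distr_Lp_norm p (dyadic_block chi m u) = ennreal a" "a \<ge> 0"
    using block_finite[OF assms, of m] by (cases "distr_Lp_norm p (dyadic_block chi m u)") auto
  obtain b where b: "block_norm u = ennreal b" "b \<ge> 0" using assms by (cases "block_norm u") auto
  have "2 powr (real_of_int m * s) * a \<le> b"
    using block_norm_ge[of m u] a b by (simp add: ennreal_le_iff flip: ennreal_mult)
  then have "2 powr (- real_of_int m * s) * (2 powr (real_of_int m * s) * a) \<le> 2 powr (- real_of_int m * s) * b"
    by (intro mult_left_mono) auto
  then have "a \<le> 2 powr (- real_of_int m * s) * b"
    by (simp add: mult.assoc[symmetric] powr_add[symmetric])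
  then show ?thesis using a b by simp
qed

lemma block_norm_add: "block_norm (\<lambda>f. u f + v f) \<le> block_norm u + block_norm v"
  unfolding block_norm_def[of "\<lambda>f. u f + v f"]
proof (rule SUP_least)
  fix m
  let ?w = "ennreal (2 powr (real_of_int m * s))"
  have "?w * distr_Lp_norm p (dyadic_block chi m (\<lambda>f. u f + v f))
      \<le> ?w * (distr_Lp_norm p (dyadic_block chi m u) + distr_Lp_norm p (dyadic_block chi m v))"
    unfolding dyadic_block_add by (intro mult_left_mono distr_Lp_norm_add p) auto
  also have "\<dots> \<le> block_norm u + block_norm v"
    unfolding distrib_left by (intro add_mono block_norm_ge)
  finally show "?w * distr_Lp_norm p (dyadic_block chi m (\<lambda>f. u f + v f)) \<le> block_norm u + block_norm v" .
qed

lemma block_norm_scale: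
  assumes "block_norm u < \<infinity>"
  shows "block_norm (\<lambda>f. c * u f) \<le> ennreal (cmod c) * block_norm u"
  unfolding block_norm_def[of "\<lambda>f. c * u f"]
proof (rule SUP_least)
  fix m
  let ?w = "ennreal (2 powr (real_of_int m * s))"
  have "?w * distr_Lp_norm p (dyadic_block chi m (\<lambda>f. c * u f))
      \<le> ?w * (ennreal (cmod c) * distr_Lp_norm p (dyadic_block chi m u))"
    unfolding dyadic_block_scale by (intro mult_left_mono distr_Lp_norm_scale p block_finite assms) auto
  also have "\<dots> = ennreal (cmod c) * (?w * distr_Lp_norm p (dyadic_block chi m u))" by (simp add: mult_ac)
  also have "\<dots> \<le> ennreal (cmod c) * block_norm u" by (intro mult_left_mono block_norm_ge) auto
  finally show "?w * distr_Lp_norm p (dyadic_block chi m (\<lambda>f. c * u f)) \<le> ennreal (cmod c) * block_norm u" .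
qed

lemma block_norm_zero_imp:
  assumes u: "u \<in> vcarrier tempered" and z: "block_norm u = 0"
  shows "u \<in> polys"
proof (rule blocks_zero_imp_polynomial[OF u])
  fix m
  have "ennreal (2 powr (real_of_int m * s)) * distr_Lp_norm p (dyadic_block chi m u) = 0"
    using block_norm_ge[of m u] z by simp
  then have "distr_Lp_norm p (dyadic_block chi m u) = 0" by simp
  from distr_Lp_norm_zero_imp[OF p this]
  show "dyadic_block chi m u = (\<lambda>f. 0)" by (force simp: fun_eq_iff dyadic_block_apply)
qed

lemma B_carrier: "vcarrier B = cls ` {u \<in> vcarrier tempered. block_norm u < \<infinity>}"
  by (auto simp: besov_def tempered_mod_poly_def TP.quotient_carrier besov_enorm_cls)

lemma B_add: "\<lbrakk>u \<in> vcarrier tempered; v \<in> vcarrier tempered\<rbrakk> \<Longrightarrow> vadd B (cls u) (cls v) = cls (\<lambda>f. u f + v f)"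
  and B_scale: "u \<in> vcarrier tempered \<Longrightarrow> vscale B c (cls u) = cls (\<lambda>f. c * u f)"
  by (simp_all add: besov_def tempered_mod_poly_def TP.quotient_add TP.quotient_scale tempered_add tempered_scale)

lemma B_sub: "\<lbrakk>u \<in> vcarrier tempered; v \<in> vcarrier tempered\<rbrakk> \<Longrightarrow> vsub B (cls u) (cls v) = cls (\<lambda>f. u f - v f)"
  using B_add[of u "vscale tempered (-1) v"] TP.scale_closed[of v "-1"]
  by (simp add: vsub_def B_scale tempered_scale)

lemma B_norm: "vnorm B (cls u) = enn2real (block_norm u)"
  by (simp add: besov_def besov_enorm_cls)

lemma tempered_add_closed: "\<lbrakk>u \<in> vcarrier tempered; v \<in> vcarrier tempered\<rbrakk> \<Longrightarrow> (\<lambda>f. u f + v f) \<in> vcarrier tempered"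
  and tempered_scale_closed: "u \<in> vcarrier tempered \<Longrightarrow> (\<lambda>f. c * u f) \<in> vcarrier tempered"
  using TP.add_closed[of u v] TP.scale_closed[of u c]
  by (simp_all add: tempered_add tempered_scale)

lemma block_norm_add_finite:
  "\<lbrakk>block_norm u < \<infinity>; block_norm v < \<infinity>\<rbrakk> \<Longrightarrow> block_norm (\<lambda>f. u f + v f) < \<infinity>"
  by (rule le_less_trans[OF block_norm_add]) simp

lemma block_norm_scale_finite: "block_norm u < \<infinity> \<Longrightarrow> block_norm (\<lambda>f. c * u f) < \<infinity>"
  by (rule le_less_trans[OF block_norm_scale]) (auto simp: ennreal_mult_less_top)

lemma besov_csubspace: "csubspace tempered_mod_poly (vcarrier B)"
proof -
  have zero: "(\<lambda>_. 0) \<in> vcarrier tempered" using tempered_scale_closed[OF TP.zero_closed, of 0] by simp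
  have "distr_Lp_norm p (\<lambda>_::'a \<Rightarrow> complex. 0) = 0"
  proof -
    have "Lp_norm p (\<lambda>_::'a. 0::complex) \<le> ennreal 0"
      using p
    proof (cases rule: exponent_cases)
      case (fin q)
      then show ?thesis by (simp add: Lp_norm_def)
    next
      case inf
      show ?thesis unfolding inf by (subst Lp_norm_infinity_le_iff) auto
    qed
    moreover have "distr_of (\<lambda>_. 0) = (\<lambda>_::'a \<Rightarrow> complex. 0)"
      by (auto simp: distr_of_def on_schwartz_def)
    ultimately have "distr_Lp_norm p (\<lambda>_::'a \<Rightarrow> complex. 0) \<le> 0"
      by (intro distr_Lp_norm_le[of "\<lambda>_. 0"]) auto
    then show ?thesis by simp
  qed
  then have "block_norm (\<lambda>_. 0) = 0"
    by (simp add: block_norm_def dyadic_block_apply[abs_def])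
  then have "cls (\<lambda>_. 0) \<in> vcarrier B" using zero by (auto simp: B_carrier)
  moreover have "vadd tempered_mod_poly x y \<in> vcarrier B" if "x \<in> vcarrier B" "y \<in> vcarrier B" for x y
    using that B_add tempered_add_closed block_norm_add_finite unfolding B_carrier
    by (auto simp: besov_def intro!: imageI)
  moreover have "vscale tempered_mod_poly c x \<in> vcarrier B" if "x \<in> vcarrier B" for c x
    using that B_scale tempered_scale_closed block_norm_scale_finite unfolding B_carrier
    by (auto simp: besov_def intro!: imageI)
  ultimately show ?thesis unfolding csubspace_def by (auto simp: besov_def)
qed

lemma besov_cnormed_space: "cnormed_space B"
proof -
  have "cvector_space B"
    by (rule cvector_space_restrict[OF _ besov_csubspace])
      (simp_all add: tempered_mod_poly_def TP.quotient_cvector_space besov_def)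
  then interpret cvector_space B .
  show ?thesis
  proof
    fix x c assume "x \<in> vcarrier B"
    then obtain u where u: "u \<in> vcarrier tempered" "block_norm u < \<infinity>" "x = cls u" by (auto simp: B_carrier)
    show "0 \<le> vnorm B x" by (simp add: u B_norm)
    show "vnorm B (vscale B c x) \<le> cmod c * vnorm B x"
    proof -
      have "enn2real (block_norm (\<lambda>f. c * u f)) \<le> enn2real (ennreal (cmod c) * block_norm u)"
        using block_norm_scale[OF u(2)] u(2) by (intro enn2real_mono) (auto simp: ennreal_mult_less_top)
      then show ?thesis using u by (simp add: B_scale B_norm enn2real_mult)
    qed
    show "x = vscale B 0 x" if "vnorm B x = 0"
    proof -
      have "block_norm u = 0" using that u by (auto simp: B_norm enn2real_eq_0_iff)
      then have "u \<in> polys" by (rule block_norm_zero_imp[OF u(1)])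
      then show ?thesis
        using u tempered_scale_closed[OF u(1), of 0]
        by (simp add: B_scale TP.coset_eq_iff tempered_sub)
    qed
    fix y assume "y \<in> vcarrier B"
    then obtain v where v: "v \<in> vcarrier tempered" "block_norm v < \<infinity>" "y = cls v" by (auto simp: B_carrier)
    have "enn2real (block_norm (\<lambda>f. u f + v f)) \<le> enn2real (block_norm u + block_norm v)"
      using block_norm_add u v by (intro enn2real_mono) auto
    also have "\<dots> = enn2real (block_norm u) + enn2real (block_norm v)"
      using u v by (intro enn2real_plus) auto
    finally show "vnorm B (vadd B x y) \<le> vnorm B x + vnorm B y"
      using u v by (simp add: B_add B_norm)
  qed
qed

lemma besov_h_csubspace: "csubspace B (besov_h chi s p)"
proof -
  interpret cnormed_space B by (rule besov_cnormed_space)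
  \<comment> \<open>A class in \<open>besov_h\<close> is the class of its member in S'_h, which
    reduces closure under the operations to that of \<open>tempered_h\<close>.\<close>
  have rep: "x \<in> besov_h chi s p \<longleftrightarrow> (\<exists>u\<in>tempered_h chi. block_norm u < \<infinity> \<and> x = cls u)" for x
  proof
    assume "x \<in> besov_h chi s p"
    then obtain u where u: "x \<in> vcarrier B" "u \<in> x" "u \<in> tempered_h chi" by (auto simp: besov_h_def)
    then obtain v where v: "v \<in> vcarrier tempered" "x = cls v" by (auto simp: B_carrier)
    have "cls u = x" using u v TP.coset_mem_eq by metis
    moreover from this have "block_norm u < \<infinity>" using u(1) besov_enorm_cls[of u] by (simp add: besov_def)
    ultimately show "\<exists>u\<in>tempered_h chi. block_norm u < \<infinity> \<and> x = cls u" using u by blast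
  next
    assume "\<exists>u\<in>tempered_h chi. block_norm u < \<infinity> \<and> x = cls u"
    then obtain u where u: "u \<in> tempered_h chi" "block_norm u < \<infinity>" "x = cls u" by blast
    then have ut: "u \<in> vcarrier tempered" by (simp add: tempered_h_iff)
    then have "x \<in> vcarrier B" using u unfolding B_carrier by blast
    moreover have "u \<in> x" using TP.self_mem_coset[OF ut] u(3) by simp
    ultimately show "x \<in> besov_h chi s p" using u(1) unfolding besov_h_def by blast
  qed
  have th: "u \<in> vcarrier tempered" if "u \<in> tempered_h chi" for u using that by (simp add: tempered_h_iff)
  have "(\<lambda>_. 0) \<in> tempered_h chi"
    using tempered_scale_closed[OF TP.zero_closed, of 0] by (simp add: tempered_h_iff)
  moreover obtain u where "u \<in> vcarrier tempered" "block_norm u < \<infinity>"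
    using zero_closed by (auto simp: B_carrier)
  then have "block_norm (\<lambda>_. 0) < \<infinity>" using block_norm_scale_finite[of u 0] by simp
  ultimately have ne: "besov_h chi s p \<noteq> {}" using rep by blast
  show ?thesis
    unfolding csubspace_def
  proof (intro conjI ballI allI ne)
    show "besov_h chi s p \<subseteq> vcarrier B" by (auto simp: besov_h_def)
    fix x y c assume "x \<in> besov_h chi s p"
    then obtain u where u: "u \<in> tempered_h chi" "block_norm u < \<infinity>" "x = cls u" using rep by blast
    show "vscale B c x \<in> besov_h chi s p"
      using u tempered_h_scale[OF u(1), of c] block_norm_scale_finite[OF u(2), of c] th
      unfolding rep by (auto simp: B_scale tempered_scale)
    assume "y \<in> besov_h chi s p"
    then obtain v where v: "v \<in> tempered_h chi" "block_norm v < \<infinity>" "y = cls v" using rep by blast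
    show "vadd B x y \<in> besov_h chi s p"
      using u v tempered_h_add[OF u(1) v(1)] block_norm_add_finite[OF u(2) v(2)] th
      unfolding rep by (auto simp: B_add tempered_add)
  qed
qed

lemma besov_h_closure_closed: "closed_csubspace_of B (besov_h_closure chi s p)"
proof -
  interpret cnormed_space B by (rule besov_cnormed_space)
  show ?thesis
    by unfold_locales (simp add: besov_h_closure_def closed_subspace_closure besov_h_csubspace)
qed

text \<open>A fattened version of \<open>phi m\<close> that equals 1 on its support: the first
  cut-off is 1 where \<open>2 powi (- m) * norm \<xi> \<le> 2\<close>, and the second is 0 where
  that quantity exceeds 1/2.\<close>

definition eta :: "int \<Rightarrow> 'a \<Rightarrow> complex" where
  "eta m \<xi> = cut (2 powi (- m) / 2) \<xi> - cut (4 * 2 powi (- m)) \<xi>"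

lemma eta_schwartz: "eta m \<in> schwartz"
  using schwartz_add[OF cut_schwartz[of "2 powi (- m) / 2"] schwartz_cmult[OF cut_schwartz[of "4 * 2 powi (- m)"], of "-1"]]
  by (simp add: eta_def[abs_def])

lemma phi_eta: "phi m \<xi> * eta m \<xi> = phi m \<xi>"
proof -
  let ?t = "2 powi (- m) :: real"
  have t: "?t > 0" by simp
  consider "?t * norm \<xi> > 2" | "?t * norm \<xi> \<le> 1/2" | "1/2 < ?t * norm \<xi>" "?t * norm \<xi> \<le> 2" by linarith
  then show ?thesis
  proof cases
    case 1
    then have "phi m \<xi> = 0" unfolding phi_eq using t by (subst (1 2) cut_far) (auto simp: abs_mult)
    then show ?thesis by simp
  next
    case 2
    then have "phi m \<xi> = 0" unfolding phi_eq using t by (subst (1 2) cut_near) (auto simp: abs_mult)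
    then show ?thesis by simp
  next
    case 3
    moreover have "\<bar>?t / 2\<bar> * norm \<xi> = ?t * norm \<xi> / 2" "\<bar>4 * ?t\<bar> * norm \<xi> = 4 * (?t * norm \<xi>)"
      using t by (simp_all add: abs_mult)
    ultimately have "\<bar>?t / 2\<bar> * norm \<xi> \<le> 1" "\<bar>4 * ?t\<bar> * norm \<xi> > 2" by linarith+
    then have "eta m \<xi> = 1" unfolding eta_def by (simp only: cut_near cut_far) simp
    then show ?thesis by simp
  qed
qed

text \<open>Inserting \<open>eta m\<close> makes the pairing factor through a single block, so that
  the L^p bound on this block applies although nothing is known about the distribution
  itself.\<close>

lemma test_phi_eq_block: "u (fourier (phi m)) = dyadic_block chi m u (fourier (eta m))"
  by (simp add: dyadic_block_apply schwartz_fourier eta_schwartz inv_fourier_fourier phi_eta)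

lemma fourier_eta: "fourier (eta m) x = of_real ((2 powi m) ^ DIM('a)) * fourier (eta 0) ((2 powi m) *\<^sub>R x)"
proof -
  let ?r = "2 powi m :: real"
  have r: "?r > 0" by simp
  have e: "eta m (?r *\<^sub>R \<xi>) = eta 0 \<xi>" for \<xi>
    using r by (simp add: eta_def cut_scale power_int_minus mult.assoc)
  have [measurable]: "eta m \<in> borel_measurable borel" by (rule schwartz_measurable[OF eta_schwartz])
  have [measurable]: "(\<lambda>\<xi>. cis (- (\<xi> \<bullet> x))) \<in> borel_measurable borel"
    by (intro borel_measurable_continuous_onI continuous_intros)
  have "fourier (eta m) x = \<bar>?r\<bar> ^ DIM('a) *\<^sub>R (LINT \<xi>|lborel. cis (- ((0 + ?r *\<^sub>R \<xi>) \<bullet> x)) * eta m (0 + ?r *\<^sub>R \<xi>))"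
    unfolding fourier_def using r by (intro lborel_integral_affine) auto
  also have "\<dots> = of_real (?r ^ DIM('a)) * fourier (eta 0) (?r *\<^sub>R x)"
    using r by (simp add: e fourier_def scaleR_conv_of_real)
  finally show ?thesis .
qed

text \<open>The Bernstein-type step: the transform of \<open>eta m\<close> is an L^1-normalised
  dilate by r = 2^m of a fixed Schwartz function, so duality gives the factor 2^(md/p), and the
  block contributes 2^(-ms).\<close>

lemma test_phi_bound:
  obtains C where "C > 0" "\<And>u m. block_norm u < \<infinity> \<Longrightarrow>
    norm (u (fourier (phi m))) \<le> C * 2 powr (real_of_int m * (lp_dim TYPE('a) p - s)) * enn2real (block_norm u)"
proof -
  obtain C where C: "C > 0" "\<And>x. norm (fourier (eta 0) x) \<le> C" "(LINT x|lborel. norm (fourier (eta 0) x)) \<le> C"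
    using schwartz_dilation_bounds[OF schwartz_fourier[OF eta_schwartz]] by blast
  show ?thesis
  proof (rule that[of "2 * C"])
    fix u :: "'a functional" and m :: int assume u: "block_norm u < \<infinity>"
    define r where "r = (2 powi m :: real)"
    have r: "r > 0" by (simp add: r_def)
    have rp: "r powr t = 2 powr (real_of_int m * t)" for t
      by (simp add: r_def powr_powr flip: powr_real_of_int')
    have [measurable]: "fourier (eta 0) \<in> borel_measurable borel"
      by (intro schwartz_measurable schwartz_fourier eta_schwartz)
    have "(LINT x|lborel. norm (fourier (eta m) x)) = r ^ DIM('a) * (LINT x|lborel. norm (fourier (eta 0) (0 + r *\<^sub>R x)))"
      using r by (simp add: fourier_eta[of m] norm_mult norm_power r_def[symmetric])
    also have "\<dots> = (LINT x|lborel. norm (fourier (eta 0) x))"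
      using lborel_integral_affine[of "\<lambda>x. norm (fourier (eta 0) x)" r 0] r by simp
    finally have L1: "(LINT x|lborel. norm (fourier (eta m) x)) \<le> C" using C(3) by simp
    have Linf: "norm (fourier (eta m) x) \<le> C * r powr DIM('a)" for x
      using C(2)[of "r *\<^sub>R x"] r
      by (simp add: fourier_eta[of m] norm_mult norm_power r_def[symmetric] powr_realpow mult.commute mult_left_mono)
    have "norm (u (fourier (phi m))) \<le> 2 * C * r powr lp_dim TYPE('a) p * enn2real (distr_Lp_norm p (dyadic_block chi m u))"
      unfolding test_phi_eq_block
      by (rule distr_Lp_duality[OF p block_finite[OF u] schwartz_fourier[OF eta_schwartz] Linf L1 r])
    also have "\<dots> \<le> 2 * C * r powr lp_dim TYPE('a) p * (2 powr (- real_of_int m * s) * enn2real (block_norm u))"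
      using C r by (intro mult_left_mono block_norm_real_ge u) auto
    also have "\<dots> = 2 * C * 2 powr (real_of_int m * (lp_dim TYPE('a) p - s)) * enn2real (block_norm u)"
      by (simp add: rp powr_add[symmetric] algebra_simps)
    finally show "norm (u (fourier (phi m))) \<le> 2 * C * 2 powr (real_of_int m * (lp_dim TYPE('a) p - s)) * enn2real (block_norm u)" .
  qed (use C in simp)
qed

end


section \<open>The embedding\<close>

text \<open>The auxiliary choices in one place. The condition on \<open>n\<close> makes the Taylor
  remainder, of order 2^(-k(n+1)), decay faster than the amplitudes grow.\<close>

locale lacunary = besov_setting chi s p
  for chi :: "'a::euclidean_space \<Rightarrow> real" and s p +
  fixes G T :: "'a \<Rightarrow> complex" and C :: real and n :: nat
  assumes G: "G \<in> schwartz" and G_int: "(LINT \<xi>|lborel. G \<xi>) \<noteq> 0"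
    and G_supp: "\<And>\<xi>. G \<xi> \<noteq> 0 \<Longrightarrow> 1 < norm \<xi> \<and> norm \<xi> \<le> 2 \<and> chi \<xi> = 1"
    and n: "s - lp_dim TYPE('a) p \<le> real n"
    and T: "polynomial_function T" and C: "C \<ge> 0"
    and taylor: "\<And>x. norm (inv_fourier G x - T x) \<le> C * norm x ^ Suc n"
begin

definition amp :: "nat \<Rightarrow> real" where
  "amp k = 2 powr (real k * (s - lp_dim TYPE('a) p))"

definition wave :: "nat \<Rightarrow> 'a \<Rightarrow> complex" where
  "wave k x = inv_fourier G ((1 / 2 ^ k) *\<^sub>R x)"

definition jet :: "nat \<Rightarrow> 'a \<Rightarrow> complex" where
  "jet k x = T ((1 / 2 ^ k) *\<^sub>R x)"

text \<open>The Fourier transform of \<open>wave k\<close>; the normalisation keeps its integral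
  independent of \<open>k\<close>.\<close>

definition spike :: "nat \<Rightarrow> 'a \<Rightarrow> complex" where
  "spike k \<xi> = of_real ((2 ^ k) ^ DIM('a)) * G (2 ^ k *\<^sub>R \<xi>)"

text \<open>For \<open>s > d/p\<close> the series of the waves diverges; subtracting the Taylor polynomials makes it
  converge without changing the class modulo polynomials.\<close>

definition atom :: "nat \<Rightarrow> 'a functional" where
  "atom k f = of_real (amp k) * distr_of (\<lambda>x. wave k x - jet k x) f"

text \<open>The sum is taken separately for every test function. Outside the Schwartz space all
  terms vanish, so the value is 0 there, as the encoding of distributions demands.\<close>

definition series :: "(nat \<Rightarrow> complex) \<Rightarrow> 'a functional" where
  "series u f = (\<Sum>k. u k * atom k f)"

section \<open>Waves, their Taylor remainders and the convergence of the series\<close>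

lemma amp_ge_1: "amp k \<ge> 1"
  unfolding amp_def using s by (intro ge_one_powr_ge_zero) auto

lemma spike_schwartz: "spike k \<in> schwartz"
proof (rule schwartz_compact_support)
  show "smooth (spike k)"
    unfolding spike_def using smooth_cmult[OF smooth_affine[OF schwartz_smooth[OF G], of "2 ^ k" 0]] by simp
  show "spike k \<xi> = 0" if "norm \<xi> > 2" for \<xi>
  proof -
    have "1 * norm \<xi> \<le> 2 ^ k * norm \<xi>" by (intro mult_right_mono) auto
    then have "norm (2 ^ k *\<^sub>R \<xi>) > 2" using that by simp
    then show ?thesis using G_supp[of "2 ^ k *\<^sub>R \<xi>"] by (force simp: spike_def)
  qed
qed

lemma spike_supp: "spike k \<xi> \<noteq> 0 \<Longrightarrow> 1 < 2 ^ k * norm \<xi> \<and> 2 ^ k * norm \<xi> \<le> 2 \<and> cut (2 ^ k) \<xi> = 1"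
  using G_supp[of "2 ^ k *\<^sub>R \<xi>"] by (auto simp: spike_def cut_def)

lemma
  shows integral_spike: "(LINT \<xi>|lborel. spike k \<xi>) = (LINT \<xi>|lborel. G \<xi>)"
    and inv_fourier_spike: "inv_fourier (spike k) = wave k"
proof -
  have [measurable]: "G \<in> borel_measurable borel" by (rule schwartz_measurable[OF G])
  have "(LINT \<xi>|lborel. G \<xi>) = \<bar>2 ^ k\<bar> ^ DIM('a) *\<^sub>R (LINT \<xi>|lborel. G (0 + 2 ^ k *\<^sub>R \<xi>))"
    by (intro lborel_integral_affine) auto
  then show "(LINT \<xi>|lborel. spike k \<xi>) = (LINT \<xi>|lborel. G \<xi>)"
    by (simp add: spike_def scaleR_conv_of_real)
  have "(LINT \<xi>|lborel. cis (x \<bullet> \<xi>) * spike k \<xi>) = (LINT \<xi>|lborel. cis (((1 / 2 ^ k) *\<^sub>R x) \<bullet> \<xi>) * G \<xi>)" for x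
  proof -
    have [measurable]: "(\<lambda>\<xi>. cis (y \<bullet> \<xi>)) \<in> borel_measurable borel" for y :: 'a
      by (intro borel_measurable_continuous_onI continuous_intros)
    have m: "(\<lambda>\<xi>. cis (y \<bullet> \<xi>) * G \<xi>) \<in> borel_measurable borel" for y by measurable
    have "(LINT \<xi>|lborel. cis (((1 / 2 ^ k) *\<^sub>R x) \<bullet> \<xi>) * G \<xi>)
      = \<bar>2 ^ k\<bar> ^ DIM('a) *\<^sub>R (LINT \<xi>|lborel. cis (((1 / 2 ^ k) *\<^sub>R x) \<bullet> (0 + 2 ^ k *\<^sub>R \<xi>)) * G (0 + 2 ^ k *\<^sub>R \<xi>))"
      by (rule lborel_integral_affine[OF m]) simp
    also have "\<dots> = (LINT \<xi>|lborel. of_real ((2 ^ k) ^ DIM('a)) * (cis (x \<bullet> \<xi>) * G (2 ^ k *\<^sub>R \<xi>)))"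
      unfolding integral_mult_right_zero by (simp add: scaleR_conv_of_real)
    also have "\<dots> = (LINT \<xi>|lborel. cis (x \<bullet> \<xi>) * spike k \<xi>)" by (simp add: spike_def mult_ac)
    finally show ?thesis ..
  qed
  then show "inv_fourier (spike k) = wave k"
    unfolding fun_eq_iff inv_fourier_def wave_def by (simp only: simp_thms)
qed

lemma wave_schwartz: "wave k \<in> schwartz"
  using schwartz_inv_fourier[OF spike_schwartz] by (simp add: inv_fourier_spike)

lemma jet_polynomial: "polynomial_function (jet k)"
proof -
  have "polynomial_function (T \<circ> (\<lambda>x. (1 / 2 ^ k) *\<^sub>R x))"
    by (intro polynomial_function_compose T polynomial_function_bounded_linear bounded_linear_scaleR_right)
  then show ?thesis by (simp add: o_def jet_def[abs_def])
qed

lemma remainder_measurable: "(\<lambda>x. wave k x - jet k x) \<in> borel_measurable borel"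
  using schwartz_measurable[OF wave_schwartz] polynomial_growth[OF jet_polynomial]
  by (metis borel_measurable_diff)

lemma remainder_bound: "norm (wave k x - jet k x) \<le> C / (2 ^ k) ^ Suc n * (1 + norm x) ^ Suc n"
proof -
  have "norm (wave k x - jet k x) \<le> C * norm ((1 / 2 ^ k) *\<^sub>R x) ^ Suc n"
    unfolding wave_def jet_def by (rule taylor)
  also have "\<dots> = C / (2 ^ k) ^ Suc n * norm x ^ Suc n"
    by (simp add: power_divide del: power_Suc)
  also have "\<dots> \<le> C / (2 ^ k) ^ Suc n * (1 + norm x) ^ Suc n"
    using C by (intro mult_left_mono power_mono) auto
  finally show ?thesis .
qed

lemma distr_of_remainder:
  assumes "f \<in> schwartz"
  shows "distr_of (\<lambda>x. wave k x - jet k x) f = distr_of (wave k) f - distr_of (jet k) f"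
  using assms schwartz_integrable[OF schwartz_mult'[OF wave_schwartz assms, of k]] polynomial_integrable[OF jet_polynomial assms, of k]
  by (simp add: distr_of_apply left_diff_distrib)

text \<open>The amplitude is at most 2^(kn), so of the \<open>Suc n\<close> powers of 2^k provided
  by the Taylor remainder one is left over.\<close>

lemma amp_decay: "amp k / (2 ^ k) ^ Suc n \<le> (1 / 2) ^ k"
proof -
  have "amp k \<le> 2 powr (real k * real n)"
    unfolding amp_def using n by (intro powr_mono mult_left_mono) auto
  also have "\<dots> = (2 ^ k) ^ n" by (simp add: powr_realpow power_mult flip: of_nat_mult)
  finally have "amp k / (2 ^ k) ^ Suc n \<le> (2 ^ k) ^ n / (2 ^ k) ^ Suc n" by (rule divide_right_mono) simp
  also have "\<dots> = (1 / 2) ^ k" by (simp add: power_one_over field_simps)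
  finally show ?thesis .
qed

text \<open>One Schwartz seminorm works for all \<open>k\<close>, with a geometric factor; this
  yields both the convergence and the continuity of the series.\<close>

lemma atom_bound:
  obtains K N where "K \<ge> 0" "\<And>k f. f \<in> schwartz \<Longrightarrow> norm (atom k f) \<le> K * schwartz_norm N f * (1 / 2) ^ k"
proof -
  define I where "I = integral\<^sup>L lborel (weight :: 'a \<Rightarrow> real)"
  have I: "I \<ge> 0" unfolding I_def by (intro integral_nonneg_AE AE_I2 weight_nonneg)
  show ?thesis
  proof (rule that[of "C * I" "Suc n + DIM('a) + 2"])
    fix k and f :: "'a \<Rightarrow> complex" assume f: "f \<in> schwartz"
    let ?s = "schwartz_norm (Suc n + DIM('a) + 2) f"
    have "norm (distr_of (\<lambda>x. wave k x - jet k x) f) \<le> C / (2 ^ k) ^ Suc n * I * ?s"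
      using growth_distr_bound[OF remainder_measurable[of k] remainder_bound[of k] f]
      by (simp only: distr_of_apply[OF f] I_def)
    then have "amp k * norm (distr_of (\<lambda>x. wave k x - jet k x) f) \<le> amp k * (C / (2 ^ k) ^ Suc n * I * ?s)"
      using amp_ge_1[of k] by (intro mult_left_mono) auto
    also have "\<dots> = (C * I * ?s) * (amp k / (2 ^ k) ^ Suc n)" by simp
    also have "\<dots> \<le> (C * I * ?s) * (1 / 2) ^ k"
      using C I schwartz_norm_nonneg[OF f] by (intro mult_left_mono amp_decay) auto
    finally show "norm (atom k f) \<le> C * I * ?s * (1 / 2) ^ k"
      using amp_ge_1[of k] by (simp add: atom_def norm_mult)
  qed (use C I in simp)
qed

lemma atom_outside: "f \<notin> schwartz \<Longrightarrow> atom k f = 0"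
  by (simp add: atom_def distr_of_outside)

lemma
  assumes u: "\<And>k. norm (u k) \<le> U"
  shows series_summable: "summable (\<lambda>k. u k * atom k f)"
    and series_bound: "\<exists>K N. \<forall>f\<in>schwartz. norm (series u f) \<le> K * schwartz_norm N f"
proof -
  obtain K N where K: "K \<ge> 0" "\<And>k f. f \<in> schwartz \<Longrightarrow> norm (atom k f) \<le> K * schwartz_norm N f * (1 / 2) ^ k"
    using atom_bound by metis
  have U: "U \<ge> 0" using u[of 0] norm_ge_zero order_trans by blast
  have bd: "norm (u k * atom k f) \<le> U * K * schwartz_norm N f * (1 / 2) ^ k" if "f \<in> schwartz" for k f
  proof -
    have "norm (u k * atom k f) \<le> U * (K * schwartz_norm N f * (1 / 2) ^ k)"
      unfolding norm_mult using u U K(2)[OF that] by (intro mult_mono) auto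
    then show ?thesis by (simp add: mult.assoc)
  qed
  have sm: "summable (\<lambda>k. c * (1 / 2 :: real) ^ k)" for c by (intro summable_mult summable_geometric) simp
  show "summable (\<lambda>k. u k * atom k f)"
  proof (cases "f \<in> schwartz")
    case True
    show ?thesis by (rule summable_comparison_test'[where N = 0, OF sm]) (rule bd[OF True])
  qed (simp add: atom_outside)
  have "norm (series u f) \<le> (U * K * 2) * schwartz_norm N f" if f: "f \<in> schwartz" for f
  proof -
    have "norm (series u f) \<le> (\<Sum>k. U * K * schwartz_norm N f * (1 / 2) ^ k)"
      unfolding series_def by (rule norm_suminf_le[OF bd[OF f] sm])
    also have "\<dots> = U * K * schwartz_norm N f * 2"
      by (subst suminf_mult) (auto simp: suminf_geometric summable_geometric)
    finally show ?thesis by (simp add: mult_ac)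
  qed
  then show "\<exists>K N. \<forall>f\<in>schwartz. norm (series u f) \<le> K * schwartz_norm N f" by blast
qed

lemma atom_tempered: "atom k \<in> vcarrier tempered"
proof -
  have "distr_of (\<lambda>x. wave k x - jet k x) \<in> vcarrier tempered"
    by (rule distr_of_tempered[OF remainder_measurable remainder_bound])
  from tempered_scale_closed[OF this, of "of_real (amp k)"] show ?thesis by (simp add: atom_def[abs_def])
qed

lemma linf_iff: "u \<in> vcarrier linf \<longleftrightarrow> (\<exists>U. \<forall>k. norm (u k) \<le> U)"
  by (auto simp: linf_def bounded_iff)

lemma linf_summable: "u \<in> vcarrier linf \<Longrightarrow> summable (\<lambda>k. u k * atom k f)"
  using series_summable unfolding linf_iff by blast

lemma series_tempered:
  assumes u: "u \<in> vcarrier linf" shows "series u \<in> vcarrier tempered"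
proof -
  obtain U where U: "\<And>k. norm (u k) \<le> U" using u unfolding linf_iff by blast
  obtain K N where K: "\<And>f. f \<in> schwartz \<Longrightarrow> norm (series u f) \<le> K * schwartz_norm N f"
    using series_bound[where u = u, OF U] by blast
  note sm = linf_summable[OF u]
  show ?thesis
  proof (rule temperedI[OF _ _ _ K])
    show "series u f = 0" if "f \<notin> schwartz" for f using that by (simp add: series_def atom_outside)
    show "series u (\<lambda>x. f x + g x) = series u f + series u g" if "f \<in> schwartz" "g \<in> schwartz" for f g
      using suminf_add[OF sm sm, of f g] that
      by (simp add: series_def tempered_plus[OF atom_tempered] distrib_left)
    show "series u (\<lambda>x. c * f x) = c * series u f" if "f \<in> schwartz" for f c
      using suminf_mult[OF sm, of c f] that
      by (simp add: series_def tempered_mult[OF atom_tempered] mult.left_commute)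
  qed
qed

lemma series_add: "\<lbrakk>u \<in> vcarrier linf; v \<in> vcarrier linf\<rbrakk> \<Longrightarrow> series (\<lambda>k. u k + v k) = (\<lambda>f. series u f + series v f)"
  using suminf_add[OF linf_summable linf_summable] by (simp add: fun_eq_iff series_def distrib_right)

lemma series_scale: "u \<in> vcarrier linf \<Longrightarrow> series (\<lambda>k. c * u k) = (\<lambda>f. c * series u f)"
  using suminf_mult[OF linf_summable] by (simp add: fun_eq_iff series_def mult.assoc)

text \<open>On the spike, \<open>2 ^ k * norm \<xi>\<close> lies between 1 and 2 and the cut-off at
  scale 2^k is still 1. The two cut-offs in \<open>phi m\<close> are then 1 and 0 for
  \<open>m = - int k\<close> and agree for every other \<open>m\<close>. The delicate neighbour is
  \<open>m = - int k + 1\<close>: its second cut-off is the one at scale 2^k, and that it equals 1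
  is what the thinness of the annulus achieves.\<close>

lemma spike_phi: "spike k \<xi> * phi m \<xi> = (if m = - int k then spike k \<xi> else 0)"
proof (cases "spike k \<xi> = 0")
  case False
  define y where "y = 2 ^ k * norm \<xi>"
  have y: "1 < y" "y \<le> 2" and c1: "cut (2 ^ k) \<xi> = 1" using spike_supp[OF False] by (auto simp: y_def)
  \<comment> \<open>The offset from the one block that sees the spike: the cut-offs in
    \<open>phi m\<close> have the scales 2^(k+l) and 2^(k+l+1).\<close>
  define l where "l = - m - int k"
  have pw: "2 powi (- m) = (2 powi l * 2 ^ k :: real)"
    unfolding l_def power_int_of_nat[symmetric] by (subst power_int_add[symmetric]) auto
  have a: "\<bar>2 powi (- m)\<bar> * norm \<xi> = 2 powi l * y" "\<bar>2 * 2 powi (- m)\<bar> * norm \<xi> = 2 * (2 powi l * y)"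
    unfolding pw y_def by (simp_all add: abs_mult)
  consider "l = 0" | "l = -1" | "l \<le> -2" | "l \<ge> 1" by linarith
  then show ?thesis
  proof cases
    case 1
    then have m: "m = - int k" by (simp add: l_def)
    have "phi m \<xi> = 1 - 0"
      unfolding phi_eq using c1 a y 1 by (intro arg_cong2[where f = "(-)"] cut_far) (auto simp: m power_int_of_nat)
    then show ?thesis using m by simp
  next
    case 2
    then have m: "m = - int k + 1" by (simp add: l_def)
    have "2 * 2 powi (- m) = (2 ^ k :: real)" unfolding pw 2 by (simp add: power_int_minus)
    moreover have "cut (2 powi (- m)) \<xi> = 1"
      using a(1) y 2 by (intro cut_near) (simp add: power_int_minus)
    ultimately have "phi m \<xi> = 0" unfolding phi_eq using c1 by simp
    then show ?thesis using m by simp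
  next
    case 3
    then have "2 powi l \<le> (2 powi (-2) :: real)" by (intro power_int_increasing) auto
    then have le: "2 powi l \<le> (1/4 :: real)" by (simp add: power_int_minus)
    have "2 powi l * y \<le> 1/4 * 2" using le y by (intro mult_mono) auto
    then have "phi m \<xi> = 1 - 1"
      unfolding phi_eq using a by (intro arg_cong2[where f = "(-)"] cut_near) auto
    then show ?thesis using 3 by (auto simp: l_def)
  next
    case 4
    then have "2 powi 1 \<le> (2 powi l :: real)" by (intro power_int_increasing) auto
    then have le: "2 \<le> (2 powi l :: real)" by simp
    have "2 * 1 < 2 powi l * y" using le y by (intro mult_le_less_imp_less) auto
    then have "phi m \<xi> = 0 - 0"
      unfolding phi_eq using a by (intro arg_cong2[where f = "(-)"] cut_far) auto
    then show ?thesis using 4 by (auto simp: l_def)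
  qed
qed simp

lemma wave_pair: "\<lbrakk>f \<in> schwartz\<rbrakk> \<Longrightarrow> distr_of (wave k) (fourier f) = (LINT \<xi>|lborel. spike k \<xi> * f \<xi>)"
  using inv_fourier_pair[OF spike_schwartz] by (simp add: distr_of_apply schwartz_fourier flip: inv_fourier_spike)

text \<open>The subtracted polynomial is invisible because the block makes the test function vanish
  near the origin on the frequency side. For the wave, \<open>spike_phi\<close> decides between all
  and nothing.\<close>

lemma block_atom:
  "dyadic_block chi m (atom k) f = (if m = - int k then of_real (amp k) * distr_of (wave k) f else 0)"
proof (cases "f \<in> schwartz")
  case False
  then show ?thesis by (simp add: dyadic_block_apply distr_of_outside)
next
  case True
  let ?w = "\<lambda>\<xi>. phi m \<xi> * inv_fourier f \<xi>"
  have iS: "inv_fourier f \<in> schwartz" by (rule schwartz_inv_fourier[OF True])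
  have w: "?w \<in> schwartz" "?w \<in> schwartz_off_zero"
    by (rule phi_mult_schwartz[OF iS], rule phi_mult_off_zero[OF iS])
  have "distr_of (jet k) (fourier ?w) = 0"
    using integral_polynomial_fourier[OF jet_polynomial w(2)] by (simp add: distr_of_apply schwartz_fourier w)
  then have "atom k (fourier ?w) = of_real (amp k) * (LINT \<xi>|lborel. spike k \<xi> * ?w \<xi>)"
    by (simp add: atom_def distr_of_remainder schwartz_fourier w wave_pair)
  also have "(LINT \<xi>|lborel. spike k \<xi> * ?w \<xi>)
      = (if m = - int k then LINT \<xi>|lborel. spike k \<xi> * inv_fourier f \<xi> else 0)"
    unfolding mult.assoc[symmetric] spike_phi by simp
  also have "(LINT \<xi>|lborel. spike k \<xi> * inv_fourier f \<xi>) = distr_of (wave k) f"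
    using wave_pair[OF iS, of k] by (simp add: fourier_inv_fourier True)
  finally show ?thesis using True by (simp add: dyadic_block_apply)
qed

text \<open>A block only changes the test function, so it commutes with a series defined termwise,
  and at most one term survives.\<close>

lemma block_series:
  "dyadic_block chi m (series u) f =
    (if m \<le> 0 then u (nat (- m)) * (of_real (amp (nat (- m))) * distr_of (wave (nat (- m))) f) else 0)"
proof -
  have "dyadic_block chi m (series u) f = (\<Sum>k. u k * dyadic_block chi m (atom k) f)"
    by (simp add: dyadic_block_apply series_def)
  also have "\<dots> = (\<Sum>k\<in>{nat (- m)}. u k * dyadic_block chi m (atom k) f)"
    by (rule suminf_finite) (auto simp: block_atom)
  finally show ?thesis by (auto simp: block_atom)
qed

lemma block_norm_series:
  obtains K where "K \<ge> 0" "\<And>u U. (\<And>k. norm (u k) \<le> U) \<Longrightarrow> block_norm (series u) \<le> ennreal (K * U)"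
proof -
  obtain K where K: "K > 0" "\<And>x. norm (wave 0 x) \<le> K" "(LINT x|lborel. norm (wave 0 x)) \<le> K"
    using schwartz_dilation_bounds[OF wave_schwartz] by blast
  have [measurable]: "wave k \<in> borel_measurable borel" for k by (rule schwartz_measurable[OF wave_schwartz])
  have K': "(\<integral>\<^sup>+x. ennreal (norm (wave 0 x)) \<partial>lborel) \<le> ennreal K"
    using K(3) by (subst nn_integral_eq_integral) (auto intro!: integrable_norm schwartz_integrable wave_schwartz ennreal_leI)
  have L: "Lp_norm p (wave k) \<le> ennreal (K * (1 / 2 ^ k) powr (- lp_dim TYPE('a) p))" for k
  proof -
    have w0: "wave k = (\<lambda>x. wave 0 ((1 / 2 ^ k) *\<^sub>R x))" by (simp add: wave_def fun_eq_iff)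
    show ?thesis unfolding w0 by (rule Lp_norm_dilation[OF _ p K(1,2) K']) simp_all
  qed
  show ?thesis
  proof (rule that[of K])
    fix u :: "nat \<Rightarrow> complex" and U assume u: "\<And>k. norm (u k) \<le> U"
    have U: "U \<ge> 0" using u[of 0] norm_ge_zero order_trans by blast
    show "block_norm (series u) \<le> ennreal (K * U)"
      unfolding block_norm_def
    proof (rule SUP_least)
      fix m :: int
      let ?w = "ennreal (2 powr (real_of_int m * s))"
      define k where "k = nat (- m)"
      \<comment> \<open>The coefficient of the surviving wave; it is 0 for positive
        \<open>m\<close>, where no wave lives.\<close>
      define v where "v = (if m \<le> 0 then u k * of_real (amp k) else 0)"
      have "dyadic_block chi m (series u) = (\<lambda>f. v * distr_of (wave k) f)"
        by (auto simp: fun_eq_iff block_series k_def v_def)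
      then have "distr_Lp_norm p (dyadic_block chi m (series u)) \<le> ennreal (cmod v * (K * (1 / 2 ^ k) powr (- lp_dim TYPE('a) p)))"
        using L K by (intro distr_Lp_norm_le[of "\<lambda>x. v * wave k x"] Lp_norm_cmult_le p) (auto simp: fun_eq_iff distr_of_cmult)
      then have "?w * distr_Lp_norm p (dyadic_block chi m (series u))
          \<le> ?w * ennreal (cmod v * (K * (1 / 2 ^ k) powr (- lp_dim TYPE('a) p)))" by (intro mult_left_mono) auto
      also have "\<dots> = ennreal (2 powr (real_of_int m * s) * (cmod v * (K * (1 / 2 ^ k) powr (- lp_dim TYPE('a) p))))"
        using K by (simp flip: ennreal_mult)
      also have "\<dots> \<le> ennreal (K * U)"
      proof (rule ennreal_leI)
        show "2 powr (real_of_int m * s) * (cmod v * (K * (1 / 2 ^ k) powr (- lp_dim TYPE('a) p))) \<le> K * U"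
        proof (cases "m \<le> 0")
          case True
          have mk: "real_of_int m = - real k" using True by (simp add: k_def)
          have "1 / 2 ^ k = 2 powr (- real k)" by (simp add: powr_minus_divide powr_realpow)
          then have "(1 / 2 ^ k) powr (- lp_dim TYPE('a) p) = 2 powr (real k * lp_dim TYPE('a) p)"
            by (simp add: powr_powr)
          moreover have "2 powr (- (real k * s)) * (2 powr (real k * (s - lp_dim TYPE('a) p)) * 2 powr (real k * lp_dim TYPE('a) p)) = 1"
            by (simp add: algebra_simps flip: powr_add)
          ultimately have "2 powr (real_of_int m * s) * (amp k * (1 / 2 ^ k) powr (- lp_dim TYPE('a) p)) = 1"
            by (simp add: mk amp_def)
          moreover have "2 powr (real_of_int m * s) * (cmod v * (K * (1 / 2 ^ k) powr (- lp_dim TYPE('a) p)))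
              = K * cmod (u k) * (2 powr (real_of_int m * s) * (amp k * (1 / 2 ^ k) powr (- lp_dim TYPE('a) p)))"
            using True amp_ge_1[of k] by (simp add: v_def norm_mult)
          ultimately show ?thesis using u[of k] K by simp
        qed (use K U in \<open>simp add: v_def\<close>)
      qed
      finally show "?w * distr_Lp_norm p (dyadic_block chi m (series u)) \<le> ennreal (K * U)" .
    qed
  qed (use K in simp)
qed

text \<open>The block leaves only the k-th wave, and \<open>eta\<close> equals 1 on its spike, so
  the pairing is the integral of the spike, which does not depend on \<open>k\<close>.\<close>

lemma test_phi_series: "series u (fourier (phi (- int k))) = u k * (of_real (amp k) * (LINT \<xi>|lborel. G \<xi>))"
proof -
  have se: "spike k \<xi> * eta (- int k) \<xi> = spike k \<xi>" for \<xi>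
  proof (cases "spike k \<xi> = 0")
    case False
    then have "1 < 2 ^ k * norm \<xi>" "2 ^ k * norm \<xi> \<le> 2" using spike_supp by blast+
    moreover have "\<bar>2 powi (- (- int k)) / 2\<bar> * norm \<xi> = 2 ^ k * norm \<xi> / 2"
      "\<bar>4 * 2 powi (- (- int k))\<bar> * norm \<xi> = 4 * (2 ^ k * norm \<xi>)"
      by (simp_all add: abs_mult power_int_of_nat)
    ultimately have "\<bar>2 powi (- (- int k)) / 2\<bar> * norm \<xi> \<le> 1" "\<bar>4 * 2 powi (- (- int k))\<bar> * norm \<xi> > 2"
      by linarith+
    then have "eta (- int k) \<xi> = 1" unfolding eta_def by (simp only: cut_near cut_far) simp
    then show ?thesis by simp
  qed simp
  have "distr_of (wave k) (fourier (eta (- int k))) = (LINT \<xi>|lborel. G \<xi>)"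
    unfolding wave_pair[OF eta_schwartz] se integral_spike ..
  then show ?thesis by (simp add: test_phi_eq_block block_series)
qed

text \<open>The wave without its Taylor polynomial belongs to the same class. It lies in S'_h
  because its spectrum stays away from the origin: the cut-off at scale \<open>t\<close> vanishes on
  the spike as soon as t > 2^(k+1).\<close>

lemma atom_class_in_besov_h: "cls (series (\<lambda>i. if i = k then 1 else 0)) \<in> besov_h chi s p"
proof -
  let ?e = "\<lambda>i. if i = k then 1 else 0 :: complex"
  have e: "?e \<in> vcarrier linf" unfolding linf_iff by (intro exI[of _ 1]) auto
  define v where "v f = of_real (amp k) * distr_of (wave k) f" for f
  have "series ?e f = atom k f" for f
  proof -
    have "series ?e f = (\<Sum>i\<in>{k}. ?e i * atom i f)" unfolding series_def by (rule suminf_finite) auto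
    then show ?thesis by simp
  qed
  then have d: "series ?e f - v f = - of_real (amp k) * distr_of (jet k) f" for f
    by (cases "f \<in> schwartz") (simp_all add: atom_def v_def distr_of_remainder distr_of_outside algebra_simps)
  have "distr_of (jet k) \<in> polys" using jet_polynomial by (auto simp: polynomial_distrs_def)
  from TP.C_scale[OF this, of "- of_real (amp k)"]
  have dp: "vsub tempered (series ?e) v \<in> polys" by (simp add: tempered_sub tempered_scale d)
  obtain K where "\<And>x. norm (wave k x) \<le> K" using schwartz_dilation_bounds[OF wave_schwartz] by blast
  then have "distr_of (wave k) \<in> vcarrier tempered"
    by (intro distr_of_tempered[of _ K 0] schwartz_measurable wave_schwartz) simp
  from tempered_scale_closed[OF this, of "of_real (amp k)"] have vt: "v \<in> vcarrier tempered"
    by (simp add: v_def[abs_def])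
  have "v \<in> tempered_h chi"
    unfolding tempered_h_iff
  proof (intro conjI ballI vt)
    fix f :: "'a \<Rightarrow> complex" assume f: "f \<in> schwartz"
    have "v (fourier (\<lambda>\<xi>. cut t \<xi> * f \<xi>)) = 0" if t: "t > 2 * 2 ^ k" for t
    proof -
      have t0: "t > 0" using t by (rule less_trans[rotated]) simp
      have z: "spike k \<xi> * (cut t \<xi> * f \<xi>) = 0" for \<xi>
      proof (cases "spike k \<xi> = 0")
        case False
        then have "1 < 2 ^ k * norm \<xi>" using spike_supp by blast
        then have "2 < 2 * 2 ^ k * norm \<xi>" by simp
        also have "\<dots> \<le> t * norm \<xi>" using t by (intro mult_right_mono) auto
        finally show ?thesis using t0 by (simp add: cut_far)
      qed simp
      have "(\<lambda>\<xi>. cut t \<xi> * f \<xi>) \<in> schwartz" using t0 by (intro schwartz_mult' cut_schwartz f) simp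
      from wave_pair[OF this, of k] show ?thesis unfolding v_def z by simp
    qed
    then have "\<forall>\<^sub>F t in at_top. v (fourier (\<lambda>\<xi>. cut t \<xi> * f \<xi>)) = 0"
      using eventually_gt_at_top[of "2 * 2 ^ k"] by (rule eventually_mono[rotated])
    then show "((\<lambda>t. v (fourier (\<lambda>\<xi>. cut t \<xi> * f \<xi>))) \<longlongrightarrow> 0) at_top" by (rule tendsto_eventually)
  qed
  moreover have "v \<in> cls (series ?e)" using vt dp by (simp add: TP.mem_coset_iff series_tempered[OF e])
  moreover have "cls (series ?e) \<in> vcarrier B"
  proof -
    obtain K where K: "\<And>u U. (\<And>k. norm (u k) \<le> U) \<Longrightarrow> block_norm (series u) \<le> ennreal (K * U)"
      using block_norm_series by blast
    have "block_norm (series ?e) \<le> ennreal (K * 1)" by (rule K) simp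
    then have "block_norm (series ?e) < \<infinity>" by (rule le_less_trans) simp
    then show ?thesis using series_tempered[OF e] unfolding B_carrier by blast
  qed
  ultimately show ?thesis unfolding besov_h_def by blast
qed

section \<open>The embedding on bounded and on null sequences\<close>

abbreviation "J \<equiv> (\<lambda>u. cls (series u))"

lemma series_finite:
  assumes "u \<in> vcarrier linf" shows "block_norm (series u) < \<infinity>"
proof -
  obtain K where K: "\<And>u U. (\<And>k. norm (u k) \<le> U) \<Longrightarrow> block_norm (series u) \<le> ennreal (K * U)"
    using block_norm_series by blast
  have "block_norm (series u) \<le> ennreal (K * vnorm linf u)" by (rule K) (rule linf_norm_le[OF assms])
  then show ?thesis by (rule le_less_trans) simp
qed

lemma J_bounded: "\<exists>K\<ge>0. \<forall>u\<in>vcarrier linf. vnorm B (J u) \<le> K * vnorm linf u"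
proof -
  obtain K where K: "K \<ge> 0" "\<And>u U. (\<And>k. norm (u k) \<le> U) \<Longrightarrow> block_norm (series u) \<le> ennreal (K * U)"
    using block_norm_series by blast
  have "vnorm B (J u) \<le> K * vnorm linf u" if u: "u \<in> vcarrier linf" for u
  proof -
    have le: "block_norm (series u) \<le> ennreal (K * vnorm linf u)" by (rule K(2)) (rule linf_norm_le[OF u])
    have "vnorm linf u \<ge> 0" using linf_norm_le[OF u, of 0] norm_ge_zero order_trans by blast
    then show ?thesis using le K(1) unfolding B_norm by (intro enn2real_leI) auto
  qed
  then show ?thesis using K(1) by blast
qed

lemma J_linear: "linear_map linf B J"
proof -
  have "vadd linf x y = (\<lambda>k. x k + y k)" "vscale linf c x = (\<lambda>k. c * x k)" for x y c
    by (simp_all add: linf_def)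
  then show ?thesis
    unfolding linear_map_def using series_finite series_tempered
    by (auto simp: B_carrier B_add B_scale series_add series_scale)
qed

interpretation LI: closed_csubspace_of linf c_zero by (rule c_zero_closed_subspace)

interpretation BS: cnormed_space B by (rule besov_cnormed_space)

lemma truncation_in_besov_h:
  assumes "\<And>k. k \<ge> m \<Longrightarrow> x k = 0"
  shows "J x \<in> besov_h chi s p"
  using assms
proof (induction m arbitrary: x)
  interpret H: csubspace_of B "besov_h chi s p" by unfold_locales (rule besov_h_csubspace)
  have closed: "J (\<lambda>k. c * (if k = m then 1 else 0)) \<in> besov_h chi s p" for c m
  proof -
    have e: "(\<lambda>k. if k = m then 1 else 0) \<in> vcarrier linf" unfolding linf_iff by (intro exI[of _ 1]) auto
    show ?thesis
      using H.C_scale[OF atom_class_in_besov_h[of m], of c] e by (simp add: B_scale series_tempered series_scale)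
  qed
  {
    case 0
    then have "x = (\<lambda>k. 0 * (if k = 0 then 1 else 0))" by auto
    then show ?case using closed[of 0 0] by simp
  next
    case (Suc m)
    define y where "y k = (if k < m then x k else 0)" for k
    define z where "z k = x m * (if k = m then 1 else 0)" for k
    have y: "J y \<in> besov_h chi s p" by (rule Suc.IH) (simp add: y_def)
    have z: "J z \<in> besov_h chi s p" using closed unfolding z_def .
    have "norm (y k) \<le> (\<Sum>i<m. norm (x i))" for k
      using member_le_sum[of k "{..<m}" "\<lambda>i. norm (x i)"] by (auto simp: y_def intro: sum_nonneg)
    then have yl: "y \<in> vcarrier linf" unfolding linf_iff by blast
    have "norm (z k) \<le> norm (x m)" for k by (simp add: z_def)
    then have zl: "z \<in> vcarrier linf" unfolding linf_iff by blast
    have "x = (\<lambda>k. y k + z k)" using Suc.prems by (auto simp: fun_eq_iff y_def z_def not_less less_Suc_eq_le)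
    then show ?case
      using H.C_add[OF y z] yl zl by (simp add: B_add series_tempered series_add)
  }
qed

lemma J_c_zero: "J ` c_zero \<subseteq> besov_h_closure chi s p"
proof
  fix X assume "X \<in> J ` c_zero"
  then obtain x where x: "x \<in> c_zero" and X: "X = J x" by blast
  have xl: "x \<in> vcarrier linf" by (rule LI.C_carrier[OF x])
  obtain K where K: "K \<ge> 0" "\<And>u. u \<in> vcarrier linf \<Longrightarrow> vnorm B (J u) \<le> K * vnorm linf u"
    using J_bounded by blast
  have JB: "J u \<in> vcarrier B" if "u \<in> vcarrier linf" for u using J_linear that by (auto simp: linear_map_def)
  have "besov_h chi s p \<subseteq> vcarrier B" by (auto simp: besov_h_def)
  note cl = BS.closure_iff[OF this]
  show "X \<in> besov_h_closure chi s p"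
    unfolding besov_h_closure_def cl X
  proof (intro conjI allI impI JB xl)
    fix e :: real assume e: "e > 0"
    \<comment> \<open>\<open>K + 1\<close> instead of \<open>K\<close> keeps the quotient meaningful
      when \<open>K\<close> is 0, and the factor 2 gives the strict inequality
      \<open>K * r < e\<close>.\<close>
    define r where "r = e / (2 * (K + 1))"
    have r: "r > 0" using e K by (simp add: r_def)
    obtain m where m: "\<And>k. k \<ge> m \<Longrightarrow> norm (x k) < r"
      using LIMSEQ_D[of x 0 r] x r by (auto simp: c_zero_def)
    define y where "y k = (if k < m then x k else 0)" for k
    have "norm (y k) \<le> vnorm linf x" for k
      using linf_norm_le[OF xl, of k] order_trans[OF norm_ge_zero linf_norm_le[OF xl, of k]] by (auto simp: y_def)
    then have yl: "y \<in> vcarrier linf" unfolding linf_iff by blast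
    have "vnorm linf (vsub linf x y) \<le> r"
      by (rule linf_norm_least) (use m r in \<open>auto simp: linf_sub y_def less_imp_le\<close>)
    then have "K * vnorm linf (vsub linf x y) \<le> K * r" using K(1) by (rule mult_left_mono)
    moreover have "K * r < e" using e K(1) mult_nonneg_nonneg[of K e] unfolding r_def
      by (simp add: divide_simps add_nonneg_pos)
    moreover have "vnorm B (vsub B (J x) (J y)) \<le> K * vnorm linf (vsub linf x y)"
      using K(2)[OF LI.sub_closed[OF xl yl]] linear_map_sub[OF J_linear xl yl LI.cvector_space_axioms] by simp
    ultimately have "vnorm B (vsub B (J x) (J y)) < e" by linarith
    moreover have "J y \<in> besov_h chi s p" by (rule truncation_in_besov_h[of m]) (simp add: y_def)
    ultimately show "\<exists>h\<in>besov_h chi s p. vnorm B (vsub B (J x) h) < e" by blast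
  qed
qed

text \<open>The estimate is first proved for classes with a member in S'_h. Its constant D/c does
  not depend on that class, so the triangle inequality extends it to the closure.\<close>

lemma J_lower_bound:
  obtains L where "L \<ge> 0" "\<And>x H. \<lbrakk>x \<in> vcarrier linf; H \<in> besov_h_closure chi s p\<rbrakk>
    \<Longrightarrow> vnorm (quotient_nspace linf c_zero) (coset linf c_zero x) \<le> L * vnorm B (vsub B (J x) H)"
proof -
  obtain D where D: "D > 0" "\<And>u m. block_norm u < \<infinity> \<Longrightarrow>
    norm (u (fourier (phi m))) \<le> D * 2 powr (real_of_int m * (lp_dim TYPE('a) p - s)) * enn2real (block_norm u)"
    using test_phi_bound by metis
  define c where "c = norm (LINT \<xi>|lborel. G \<xi>)"
  have c: "c > 0" using G_int by (simp add: c_def)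
  have JB: "J u \<in> vcarrier B" if "u \<in> vcarrier linf" for u using J_linear that by (auto simp: linear_map_def)
  have hB: "besov_h chi s p \<subseteq> vcarrier B" by (auto simp: besov_h_def)
  have main: "vnorm LI.Q (coset linf c_zero x) \<le> D / c * vnorm B (vsub B (J x) H)"
    if x: "x \<in> vcarrier linf" and H: "H \<in> besov_h chi s p" for x H
  proof -
    obtain h where h: "h \<in> H" "h \<in> tempered_h chi" "H \<in> vcarrier B" using H by (auto simp: besov_h_def)
    have ht: "h \<in> vcarrier tempered" using h by (simp add: tempered_h_iff)
    obtain h' where h': "h' \<in> vcarrier tempered" "H = cls h'" using h(3) by (auto simp: B_carrier)
    \<comment> \<open>The representative is replaced by the member in S'_h: the limit of the
      low-frequency pairings is available only for that one.\<close>
    have Hc: "H = cls h" using h h' TP.coset_mem_eq by metis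
    then have hf: "block_norm h < \<infinity>" using h(3) besov_enorm_cls[of h] by (simp add: besov_def)
    define w where "w f = series x f - h f" for f
    have wf: "block_norm w < \<infinity>"
      using block_norm_add_finite[OF series_finite[OF x] block_norm_scale_finite[OF hf, of "-1"]] by (simp add: w_def[abs_def])
    define N where "N = enn2real (block_norm w)"
    have N: "vnorm B (vsub B (J x) H) = N"
      unfolding Hc N_def w_def by (simp add: B_sub series_tempered x ht B_norm)
    have bd: "c * norm (x k) \<le> D * N + norm (h (fourier (phi (- int k))))" for k
    proof -
      let ?t = "fourier (phi (- int k))"
      have "amp k * (c * norm (x k)) = norm (series x ?t)"
        using amp_ge_1[of k] by (simp add: test_phi_series norm_mult c_def)
      also have "\<dots> \<le> norm (w ?t) + norm (h ?t)"
        using norm_triangle_ineq[of "w ?t" "h ?t"] by (simp add: w_def)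
      also have "norm (w ?t) \<le> D * amp k * N"
      proof -
        have "real k * (s - lp_dim TYPE('a) p) = real_of_int (- int k) * (lp_dim TYPE('a) p - s)"
          by (simp add: algebra_simps)
        then show ?thesis using D(2)[OF wf, of "- int k"] by (simp only: amp_def N_def)
      qed
      \<comment> \<open>Here s >= d/p enters, as \<open>amp k \<ge> 1\<close>: after division by
        \<open>amp k\<close> the contribution of \<open>h\<close> is still a null sequence.\<close>
      also have "norm (h ?t) \<le> amp k * norm (h ?t)"
        using amp_ge_1[of k] mult_right_mono[of 1 "amp k" "norm (h ?t)"] by simp
      finally have "amp k * (c * norm (x k)) \<le> amp k * (D * N + norm (h ?t))" by (simp add: algebra_simps)
      then show ?thesis using amp_ge_1[of k] by (simp add: mult_le_cancel_left)
    qed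
    show ?thesis
      unfolding N
    proof (rule field_le_epsilon)
      fix e :: real assume e: "e > 0"
      have N0: "N \<ge> 0" by (simp add: N_def)
      have "(\<lambda>k. norm (h (fourier (phi (- int k))))) \<longlonglongrightarrow> 0"
        using tempered_h_phi[OF h(2)] by (rule tendsto_norm_zero)
      then have "\<forall>\<^sub>F k in sequentially. norm (h (fourier (phi (- int k)))) < c * e"
        using c e by (intro order_tendstoD(2)) auto
      then have "\<forall>\<^sub>F k in sequentially. norm (x k) \<le> D / c * N + e"
      proof eventually_elim
        case (elim k)
        then have "c * norm (x k) \<le> D * N + c * e" using bd[of k] by linarith
        then show ?case using c by (simp add: field_simps)
      qed
      then show "vnorm LI.Q (coset linf c_zero x) \<le> D / c * N + e"
        using x D c N0 e by (intro linf_quotient_norm_le) auto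
    qed
  qed
  show ?thesis
  proof (rule that[of "D / c"])
    fix x H assume x: "x \<in> vcarrier linf" and H: "H \<in> besov_h_closure chi s p"
    have HB: "H \<in> vcarrier B" using H unfolding besov_h_closure_def BS.closure_iff[OF hB] by blast
    show "vnorm LI.Q (coset linf c_zero x) \<le> D / c * vnorm B (vsub B (J x) H)"
    proof (rule field_le_epsilon)
      fix e :: real assume e: "e > 0"
      then have "e * c / D > 0" using c D by simp
      then obtain H' where H': "H' \<in> besov_h chi s p" "vnorm B (vsub B H H') < e * c / D"
        using H unfolding besov_h_closure_def BS.closure_iff[OF hB] by blast
      have H'B: "H' \<in> vcarrier B" using H'(1) hB by blast
      have "vnorm LI.Q (coset linf c_zero x) \<le> D / c * vnorm B (vsub B (J x) H')" by (rule main[OF x H'(1)])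
      also have "\<dots> \<le> D / c * (vnorm B (vsub B (J x) H) + e * c / D)"
        using BS.norm_sub_triangle[OF JB[OF x] HB H'B] H'(2) c D by (intro mult_left_mono) auto
      also have "\<dots> = D / c * vnorm B (vsub B (J x) H) + e" using c D by (simp add: field_simps)
      finally show "vnorm LI.Q (coset linf c_zero x) \<le> D / c * vnorm B (vsub B (J x) H) + e" .
    qed
  qed (use c D in simp)
qed

text \<open>Two sequences with the same image have series that differ by a polynomial. Its blocks
  vanish, and the coefficients are read off from the blocks.\<close>

lemma J_injective: "inj_on J (vcarrier linf)"
proof (rule inj_onI)
  fix x y assume x: "x \<in> vcarrier linf" and y: "y \<in> vcarrier linf" and eq: "J x = J y"
  let ?z = "\<lambda>k. x k - y k"
  have z: "?z = vsub linf x y" by (simp add: linf_sub)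
  have zl: "?z \<in> vcarrier linf" unfolding z by (rule LI.sub_closed[OF x y])
  have "series ?z = (\<lambda>f. series x f - series y f)"
    using series_add[OF x LI.scale_closed[OF y, of "-1"]] series_scale[OF y, of "-1"] by (simp add: linf_def)
  moreover have "vsub tempered (series x) (series y) \<in> polys"
    using eq TP.coset_eq_iff[OF series_tempered[OF x] series_tempered[OF y]] by simp
  ultimately have "series ?z \<in> polys" by (simp add: tempered_sub)
  then have "dyadic_block chi m (series ?z) = (\<lambda>f. 0)" for m by (rule dyadic_block_polynomial)
  then have z0: "series ?z (fourier (phi (- int k))) = 0" for k by (simp add: test_phi_eq_block)
  have "x k - y k = 0" for k using z0[of k] amp_ge_1[of k] G_int unfolding test_phi_series by auto
  then show "x = y" by (simp add: fun_eq_iff)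
qed

end

theorem theorem16:
  fixes chi :: "real ^ 'n \<Rightarrow> real" and s :: real and p :: ereal
  assumes "lp_cutoff chi"
    and "1 \<le> p"
    and "ereal (real CARD('n)) / p \<le> ereal s"
  shows
    "\<not> separable_space
        (norm_topology (quotient_nspace (besov chi s p) (besov_h_closure chi s p))) \<and>
     \<not> separable_space (norm_topology (quotient_nspace linf c_zero)) \<and>
     (\<exists>J. embedding linf (besov chi s p) J \<and>
          J ` c_zero \<subseteq> besov_h_closure chi s p \<and>
          (\<exists>J'. (\<forall>u\<in>vcarrier linf.
                   J' (coset linf c_zero u) = coset (besov chi s p) (besov_h_closure chi s p) (J u)) \<and>
                quasi_isometry (quotient_nspace linf c_zero)
                  (quotient_nspace (besov chi s p) (besov_h_closure chi s p)) J'))"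
proof -
  \<comment> \<open>In the extended reals a finite number divided by infinity is 0, in accordance
    with \<open>lp_dim\<close>.\<close>
  have "lp_dim TYPE(real ^ 'n) p \<le> s"
    using assms(2)
  proof (cases rule: exponent_cases)
    case (fin q)
    then show ?thesis using assms(3) by (simp add: lp_dim_def)
  next
    case inf
    then show ?thesis using assms(3) by (simp add: lp_dim_def zero_ereal_def)
  qed
  then interpret besov_setting chi s p
    using assms by unfold_locales auto
  obtain G where G: "G \<in> schwartz" "(LINT \<xi>|lborel. G \<xi>) \<noteq> 0"
    "\<And>\<xi>. G \<xi> \<noteq> 0 \<Longrightarrow> 1 < norm \<xi> \<and> norm \<xi> \<le> 2 \<and> chi \<xi> = 1"
    using bump_exists by metis
  \<comment> \<open>The least natural number that is at least s - d/p, taken as the degree up to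
    which the waves are expanded.\<close>
  define n where "n = nat \<lceil>s - lp_dim TYPE(real ^ 'n) p\<rceil>"
  obtain T C where T: "polynomial_function T" "C \<ge> 0"
    "\<And>x. norm (inv_fourier G x - T x) \<le> C * norm x ^ Suc n"
    using inv_fourier_taylor[OF G(1), of n] by blast
  interpret lacunary chi s p G T C n
    by unfold_locales (use G T in \<open>auto simp: n_def intro: real_nat_ceiling_ge\<close>)
  let ?Q = "quotient_nspace linf c_zero" and ?R = "quotient_nspace B (besov_h_closure chi s p)"
  obtain K where K: "\<And>u. u \<in> vcarrier linf \<Longrightarrow> vnorm B (J u) \<le> K * vnorm linf u"
    using J_bounded by blast
  obtain L where L: "\<And>x H. \<lbrakk>x \<in> vcarrier linf; H \<in> besov_h_closure chi s p\<rbrakk>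
    \<Longrightarrow> vnorm ?Q (coset linf c_zero x) \<le> L * vnorm B (vsub B (J x) H)"
    using J_lower_bound by metis
  have emb: "embedding linf B J"
    unfolding embedding_def using J_linear K J_injective by blast
  have ind: "\<exists>J'. (\<forall>u\<in>vcarrier linf. J' (coset linf c_zero u) = coset B (besov_h_closure chi s p) (J u)) \<and>
      quasi_isometry ?Q ?R J'"
    by (rule induced_quasi_isometry[OF c_zero_closed_subspace besov_h_closure_closed J_linear K J_c_zero L])
  then obtain J' where qi: "quasi_isometry ?Q ?R J'" by blast
  obtain f :: "nat set \<Rightarrow> (nat \<Rightarrow> complex) set" where f: "\<And>S. f S \<in> vcarrier ?Q"
    "\<And>S T. S \<noteq> T \<Longrightarrow> 1 \<le> vnorm ?Q (vsub ?Q (f S) (f T))"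
    using linf_separated_family by metis
  have Q: "cnormed_space ?Q"
    by (rule closed_csubspace_of.quotient_cnormed_space[OF c_zero_closed_subspace])
  have R: "cnormed_space ?R"
    by (rule closed_csubspace_of.quotient_cnormed_space[OF besov_h_closure_closed])
  have "\<not> separable_space (norm_topology ?Q)"
    by (rule cnormed_space.not_separable[OF Q f(1) zero_less_one f(2)])
  moreover have "\<not> separable_space (norm_topology ?R)"
    by (rule quasi_isometry_not_separable[OF Q R qi f(1) zero_less_one f(2)])
  ultimately show ?thesis by (intro conjI exI[of _ J] emb J_c_zero ind)
qed

end
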